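(* Assume the standing assumptions, $\alpha_0<0$, and that $(\alpha_n)$ is generic. Let $q$ be the charge associated with the initial datum $\Psi_0=\varphi_{\alpha(0)}$. Then there are constants $A\in\mathbb R$, $C$, $B>0$ such that, as $t\to\infty$, $|q(t)|\le A\,t^{-3/2}+R(t)$ with $R(t)\sim Ce^{-Bt}$ (exponentially decaying).
   Context: Let $H_0=-\Delta$ on $L^2(\mathbb R^3)$, $U_0(t)=e^{-iH_0t}$ with kernel $U_0(t;\vec x)=(4\pi it)^{-3/2}e^{i|\vec x|^2/(4t)}$. For $\lambda>0$, $\mathcal G^\lambda(\vec x)=e^{-\sqrt\lambda|\vec x|}/(4\pi|\vec x|)$. For $a\in\mathbb R$, $H_a$ is the point interaction at the origin of strength $a$: domain $\{\Psi\in L^2(\mathbb R^3):\exists q\in\mathbb C,\ \Psi-q\mathcal G^\lambda\in H^2(\mathbb R^3),\ (\Psi-q\mathcal G^\lambda)(0)=(a+\sqrt\lambda/(4\pi))q\}$, $(H_a+\lambda)\Psi=(H_0+\lambda)(\Psi-q\mathcal G^\lambda)$. For $a<0$, $H_a$ has the unique eigenvalue $-(4\pi a)^2$ with normalized eigenfunction $\varphi_a(\vec x)=\sqrt{2|a|}e^{4\pi a|\vec x|}/|\vec x|$. Standing assumptions: $\alpha:\mathbb R\to\mathbb R$ continuous and $T$-periodic, $\omega=2\pi/T$, $\alpha(t)=\sum_n\alpha_ne^{-in\omega t}$, $(\alpha_n)\in\ell^1(\mathbb Z)$, $\alpha_n=\overline{\alpha_{-n}}$, $\alpha(0)<0$.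 Dynamics: $H_{\alpha(t)}$ generates a unitary propagator $U(t,s)$; for initial datum $\Psi_0$, $\Psi_t=U(t,0)\Psi_0=U_0(t)\Psi_0+i\int_0^tq(\tau)U_0(t-\tau;\cdot)d\tau$, where the charge $q$ is the unique solution of $q(t)+4\sqrt{\pi i}\int_0^t\frac{\alpha(\tau)q(\tau)}{\sqrt{t-\tau}}d\tau=4\sqrt{\pi i}\int_0^t\frac{(U_0(\tau)\Psi_0)(0)}{\sqrt{t-\tau}}d\tau$. Principal branch of square roots. Genericity: with $\tilde\alpha=(\alpha_1,\alpha_2,\dots)\in\ell^1(\mathbb N)$ and the shift $(\mathcal Ta)_n=a_{n+1}$ on $\ell^1(\mathbb N)$, $(\alpha_n)$ is generic if $e_1=(1,0,0,\dots)$ lies in the $\ell^1(\mathbb N)$-closure of the linear span of $\{\mathcal T^n\tilde\alpha:n\ge0\}$. *)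

theory Defs
  imports "HOL-Analysis.Analysis" "HOL-Library.Landau_Symbols"
begin

definition standing_assumptions :: "(real \<Rightarrow> real) \<Rightarrow> real \<Rightarrow> (int \<Rightarrow> complex) \<Rightarrow> bool" where
  "standing_assumptions \<alpha> T c \<longleftrightarrow>
     T > 0 \<and> continuous_on UNIV \<alpha> \<and> (\<forall>t. \<alpha> (t + T) = \<alpha> t) \<and>
     (\<lambda>n. norm (c n)) summable_on UNIV \<and>
     (\<forall>t. complex_of_real (\<alpha> t) =
            (\<Sum>\<^sub>\<infinity>n. c n * exp (- \<i> * of_int n * of_real (2 * pi / T) * of_real t))) \<and>
     (\<forall>n. c n = cnj (c (- n))) \<and>
     \<alpha> 0 < 0"

text \<open>Genericity: e_1 lies in the l^1(N)-closure of the span of the shifts of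
(alpha_1, alpha_2, ...). Sequences in l^1(N) are indexed from 0 here, so
(T^k alpha~)_j = alpha_(j+k+1) and e_1 = indicator of j = 0.\<close>
definition generic :: "(int \<Rightarrow> complex) \<Rightarrow> bool" where
  "generic c \<longleftrightarrow>
     (\<forall>\<epsilon>>0. \<exists>m (b :: nat \<Rightarrow> complex).
        (\<Sum>j. norm ((if j = 0 then 1 else 0) - (\<Sum>k<m. b k * c (int (j + k + 1))))) < \<epsilon>)"

text \<open>Bound state of H_a (a < 0).\<close>
definition phi :: "real \<Rightarrow> real^3 \<Rightarrow> complex" where
  "phi a x = complex_of_real (sqrt (2 * \<bar>a\<bar>) * exp (4 * pi * a * norm x) / norm x)"

text \<open>(U_0(tau) Psi)(0) = integral of U_0(tau; -y) Psi(y) dy, with principal branch.\<close>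
definition free_at_origin :: "(real^3 \<Rightarrow> complex) \<Rightarrow> real \<Rightarrow> complex" where
  "free_at_origin \<Psi> \<tau> =
     (LINT y|lborel. (4 * of_real pi * \<i> * of_real \<tau>) powr (-3/2)
                      * exp (\<i> * of_real ((norm y)\<^sup>2 / (4 * \<tau>))) * \<Psi> y)"

definition is_charge :: "(real \<Rightarrow> real) \<Rightarrow> (real^3 \<Rightarrow> complex) \<Rightarrow> (real \<Rightarrow> complex) \<Rightarrow> bool" where
  "is_charge \<alpha> \<Psi> q \<longleftrightarrow>
     (\<forall>t\<ge>0. set_integrable lborel {0..t} q) \<and>
     (\<forall>t\<ge>0. q t + 4 * csqrt (of_real pi * \<i>) *
               (LINT \<tau>:{0..t}|lborel. of_real (\<alpha> \<tau>) * q \<tau> / of_real (sqrt (t - \<tau>)))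
             = 4 * csqrt (of_real pi * \<i>) *
               (LINT \<tau>:{0..t}|lborel. free_at_origin \<Psi> \<tau> / of_real (sqrt (t - \<tau>))))"

end

theory Submission
  imports Defs "HOL-Complex_Analysis.Great_Picard"
begin

text \<open>
  The charge solves an Abel-type Volterra equation. Applying \<open>\<delta> - mix_kernel\<close> to it replaces the kernel
  \<open>1 / sqrt t\<close>, which is not integrable at infinity, by kernels that are \<open>O(t powr (-3/2))\<close>; the equation
  becomes \<open>A q = g\<close> with \<open>g = O(t powr (-3/2))\<close> and \<open>A\<close> commuting with translation by the period.
  A bounded Bloch solution of \<open>A y = 0\<close> (after damping by \<open>exp (- \<gamma> t)\<close>, \<open>\<gamma> \<ge> 0\<close>) has Fourier coefficients that
  solve \<open>sqrt (p + i n \<omega>) y_n / sqrt i + const * (\<alpha> y)_n = 0\<close>. Taking imaginary parts of the associated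
  quadratic form kills all negative frequencies, and genericity then kills the remaining ones one after the other.
  Compactness turns this uniqueness into an a priori bound \<open>|w| \<le> C |A w|\<close> for bounded functions, uniform in the damping.
  Applied to \<open>q\<close> times slowly varying weights, whose commutators with \<open>A\<close> are small, the bound first removes the
  exponential growth of \<open>q\<close> and then improves its polynomial decay until the exponent \<open>3/2\<close> of the kernels is reached.
\<close>

section \<open>Integrable convolution kernels\<close>

text \<open>Multiplication by \<open>1 - laplace mix_kernel\<close> replaces the transform sqrt pi /
  sqrt p of the Abel kernel, singular at p = 0, by \<open>laplace reg_kernel\<close>, which has no
  zero in the closed right half plane. Dividing this factor out again leaves sqrt p times y plus
  sqrt pi times \<open>kappa\<close> times the coefficient of \<alpha> y, so the regularization does
  not alter the homogeneous problem. The obstacle is that \<alpha> is not small and that 1 -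
  \<open>laplace mix_kernel\<close> vanishes at the threshold p = 0: no Neumann series inverts the
  operator down to zero damping. Its inverse bound must come from uniqueness plus compactness, at
  the price of a constant without a formula. That bound applies only to functions already known to
  be bounded. Every weight is therefore truncated, so that the supremum to be absorbed is finite
  beforehand, and the truncation is removed at the end because the resulting bound does not depend
  on it.\<close>

definition majorant :: "real \<Rightarrow> real" where
  "majorant x = (if 0 < x then min (1 / sqrt x) (1 / (x * sqrt x)) else 0)"

lemma majorant_measurable [measurable]: "majorant \<in> borel_measurable borel"
  unfolding majorant_def by measurable

lemma majorant_nonneg: "0 \<le> majorant x"
  by (simp add: majorant_def)

lemma majorant_le_sqrt: "0 < x \<Longrightarrow> majorant x \<le> 1 / sqrt x"
  by (simp add: majorant_def)

lemma majorant_le_tail: "0 < x \<Longrightarrow> majorant x \<le> 1 / (x * sqrt x)"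
  by (simp add: majorant_def)

lemma inverse_sqrt_integral:
  assumes "0 \<le> d"
  shows "set_integrable lborel {0<..d} (\<lambda>x. 1 / sqrt x)"
    and "(LINT x:{0<..d}|lborel. 1 / sqrt x) = 2 * sqrt d"
proof -
  have *: "set_integrable lborel {0<..d} (\<lambda>x. 1 / sqrt x) \<and> (LINT x:{0<..d}|lborel. 1 / sqrt x) = 2 * sqrt d"
  proof (cases "d = 0")
    case True
    then show ?thesis by (simp add: set_integrable_def set_lebesgue_integral_def)
  next
    case False
    with assms have d: "0 < d" by simp
    have lim0: "(((\<lambda>x. 2 * sqrt x) \<circ> real_of_ereal) \<longlongrightarrow> 0) (at_right (ereal 0))"
      by (simp add: ereal_tendsto_simps) (auto intro!: tendsto_eq_intros)
    have lim1: "(((\<lambda>x. 2 * sqrt x) \<circ> real_of_ereal) \<longlongrightarrow> 2 * sqrt d) (at_left (ereal d))"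
      by (simp add: ereal_tendsto_simps) (auto intro!: tendsto_eq_intros)
    have der: "DERIV (\<lambda>x. 2 * sqrt x) x :> 1 / sqrt x" if "0 < x" for x
      using that by (auto intro!: derivative_eq_intros simp: field_simps)
    have cont: "isCont (\<lambda>x. 1 / sqrt x) x" if "0 < x" for x
      using that by (auto intro!: continuous_intros)
    note F = interval_integral_FTC_nonneg[of "ereal 0" "ereal d" "\<lambda>x. 2 * sqrt x" "\<lambda>x. 1 / sqrt x" 0 "2 * sqrt d"]
    have 1: "set_integrable lborel (einterval 0 d) (\<lambda>x. 1 / sqrt x)"
      and 2: "(LBINT x=ereal 0..ereal d. 1 / sqrt x) = 2 * sqrt d"
      using F d lim0 lim1 der cont by (auto simp: zero_ereal_def)
    have e: "set_integrable lborel {0<..d} (\<lambda>x. 1 / sqrt x) \<longleftrightarrow> set_integrable lborel {0<..<d} (\<lambda>x. 1 / sqrt x)"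
      unfolding set_integrable_def
      by (rule integrable_cong_AE) (use AE_lborel_singleton[of d] in \<open>auto elim!: eventually_mono simp: indicator_def\<close>)
    have e2: "(LINT x:{0<..d}|lborel. 1 / sqrt x) = (LINT x:{0<..<d}|lborel. 1 / sqrt x)"
      unfolding set_lebesgue_integral_def
      by (rule integral_cong_AE) (use AE_lborel_singleton[of d] in \<open>auto elim!: eventually_mono simp: indicator_def\<close>)
    show ?thesis
      using 1 2 d e e2 by (auto simp: interval_lebesgue_integral_def zero_ereal_def)
  qed
  show "set_integrable lborel {0<..d} (\<lambda>x. 1 / sqrt x)"
    and "(LINT x:{0<..d}|lborel. 1 / sqrt x) = 2 * sqrt d"
    using * by auto
qed

lemma inverse_x_sqrt_integral:
  fixes d :: real
  assumes "0 < d"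
  shows "set_integrable lborel {d<..} (\<lambda>x. 1 / (x * sqrt x))"
    and "(LINT x:{d<..}|lborel. 1 / (x * sqrt x)) = 2 / sqrt d"
proof -
  have lim0: "(((\<lambda>x. - (2 / sqrt x)) \<circ> real_of_ereal) \<longlongrightarrow> - (2 / sqrt d)) (at_right (ereal d))"
    using assms by (simp add: ereal_tendsto_simps) (auto intro!: tendsto_eq_intros)
  have "((\<lambda>x. - (2 / sqrt x)) \<longlongrightarrow> 0) at_top"
    by real_asymp
  then have lim1: "(((\<lambda>x. - (2 / sqrt x)) \<circ> real_of_ereal) \<longlongrightarrow> 0) (at_left \<infinity>)"
    by (simp add: ereal_tendsto_simps)
  have der: "DERIV (\<lambda>x. - (2 / sqrt x)) x :> 1 / (x * sqrt x)" if "d < x" for x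
    using that assms by (auto intro!: derivative_eq_intros simp: field_simps)
  have cont: "isCont (\<lambda>x. 1 / (x * sqrt x)) x" if "d < x" for x
    using that assms by (auto intro!: continuous_intros)
  have nn: "AE x in lborel. ereal d < ereal x \<longrightarrow> ereal x < \<infinity> \<longrightarrow> 0 \<le> 1 / (x * sqrt x)"
    using assms by (intro AE_I2) auto
  note F = interval_integral_FTC_nonneg[of "ereal d" "\<infinity>" "\<lambda>x. - (2 / sqrt x)" "\<lambda>x. 1 / (x * sqrt x)" "- (2 / sqrt d)" 0]
  have 1: "set_integrable lborel (einterval d \<infinity>) (\<lambda>x. 1 / (x * sqrt x))"
    and 2: "(LBINT x=ereal d..\<infinity>. 1 / (x * sqrt x)) = 2 / sqrt d"
    using F lim0 lim1 der cont nn by auto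
  have "einterval d \<infinity> = {d<..}" by (auto simp: einterval_def)
  then show "set_integrable lborel {d<..} (\<lambda>x. 1 / (x * sqrt x))"
    and "(LINT x:{d<..}|lborel. 1 / (x * sqrt x)) = 2 / sqrt d"
    using 1 2 by (auto simp: interval_lebesgue_integral_def)
qed

text \<open>The bound 4 is 2 from (0,1] plus 2 from (1,oo), one contribution for each branch of the
  minimum.\<close>

lemma majorant_integrable: "integrable lborel majorant"
  and majorant_integral_le: "(LINT x|lborel. majorant x) \<le> 4"
proof -
  have h: "majorant x \<le> indicator {0<..1} x *\<^sub>R (1 / sqrt x) + indicator {1<..} x *\<^sub>R (1 / (x * sqrt x))" for x
    by (auto simp: majorant_def indicator_def)
  note i = inverse_sqrt_integral[of 1] inverse_x_sqrt_integral[of 1]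
  have I: "integrable lborel (\<lambda>x. indicator {0<..1} x *\<^sub>R (1 / sqrt x) + indicator {1<..} x *\<^sub>R (1 / (x * sqrt x)))"
    using i unfolding set_integrable_def by (intro Bochner_Integration.integrable_add) auto
  show 1: "integrable lborel majorant"
    by (rule Bochner_Integration.integrable_bound[OF I]) (use h majorant_nonneg in \<open>auto intro!: AE_I2 order_trans[OF h]\<close>)
  have "(LINT x|lborel. majorant x) \<le> (LINT x|lborel. indicator {0<..1} x *\<^sub>R (1 / sqrt x) + indicator {1<..} x *\<^sub>R (1 / (x * sqrt x)))"
    by (rule integral_mono[OF 1 I h])
  also have "\<dots> = 4"
    using i unfolding set_integrable_def set_lebesgue_integral_def
    by (subst Bochner_Integration.integral_add) auto
  finally show "(LINT x|lborel. majorant x) \<le> 4" .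
qed

text \<open>Domination by the one function \<open>majorant\<close> gives a common integrable bound
  for a whole family of damped kernels. Monotonicity controls translations in L1 without
  differentiating the kernel, which is singular at 0.\<close>

definition good_kernel :: "(real \<Rightarrow> real) \<Rightarrow> bool" where
  "good_kernel f \<longleftrightarrow> f \<in> borel_measurable borel \<and> (\<forall>x. 0 \<le> f x \<and> f x \<le> majorant x) \<and> antimono_on {0<..} f"

lemma good_kernelD:
  assumes "good_kernel f"
  shows "f \<in> borel_measurable borel" "0 \<le> f x" "f x \<le> majorant x" "x \<le> 0 \<Longrightarrow> f x = 0"
    "0 < x \<Longrightarrow> x \<le> y \<Longrightarrow> f y \<le> f x"
proof -
  show m: "f \<in> borel_measurable borel" "0 \<le> f x" "f x \<le> majorant x"
    using assms by (auto simp: good_kernel_def)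
  show "x \<le> 0 \<Longrightarrow> f x = 0" using m(2,3) by (simp add: majorant_def)
  show "0 < x \<Longrightarrow> x \<le> y \<Longrightarrow> f y \<le> f x"
    using assms by (auto simp: good_kernel_def monotone_on_def)
qed

lemma good_kernel_integrable:
  assumes "good_kernel f"
  shows "integrable lborel f"
  by (rule Bochner_Integration.integrable_bound[OF majorant_integrable])
    (use good_kernelD[OF assms] majorant_nonneg in auto)

lemma good_kernel_exp:
  assumes "good_kernel f" "0 \<le> \<gamma>"
  shows "good_kernel (\<lambda>x. exp (- \<gamma> * x) * f x)"
  unfolding good_kernel_def
proof (intro conjI allI)
  note g = good_kernelD[OF assms(1)]
  show "(\<lambda>x. exp (- \<gamma> * x) * f x) \<in> borel_measurable borel"
    using g(1) by measurable
  fix x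
  show "0 \<le> exp (- \<gamma> * x) * f x" using g(2) by simp
  show "exp (- \<gamma> * x) * f x \<le> majorant x"
  proof (cases "0 < x")
    case True
    then have "exp (- \<gamma> * x) * f x \<le> 1 * f x"
      using g(2) assms(2) by (intro mult_right_mono) auto
    then show ?thesis using g(3)[of x] by simp
  qed (use g(4) majorant_nonneg in auto)
next
  note g = good_kernelD[OF assms(1)]
  show "antimono_on {0<..} (\<lambda>x. exp (- \<gamma> * x) * f x)"
    unfolding monotone_on_def using g assms(2) by (auto intro!: mult_mono mult_left_mono)
qed

text \<open>The integral runs over the whole line instead of [0,t]. It stays causal because the
  kernels vanish on the nonpositive axis, and it also makes sense for Bloch functions, which have no
  initial time.\<close>

definition conv :: "(real \<Rightarrow> real) \<Rightarrow> (real \<Rightarrow> 'a::{banach, second_countable_topology}) \<Rightarrow> real \<Rightarrow> 'a" where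
  "conv f u t = (LINT x|lborel. f x *\<^sub>R u (t - x))"

lemma conv_measurable [measurable]:
  fixes u :: "real \<Rightarrow> 'a::{banach, second_countable_topology}"
  assumes [measurable]: "f \<in> borel_measurable borel" "u \<in> borel_measurable borel"
  shows "conv f u \<in> borel_measurable borel"
  unfolding conv_def by measurable

lemma conv_integrable:
  fixes u :: "real \<Rightarrow> 'a::{banach, second_countable_topology}"
  assumes f: "good_kernel f" and [measurable]: "u \<in> borel_measurable borel" and B: "\<And>t. norm (u t) \<le> B"
  shows "integrable lborel (\<lambda>x. f x *\<^sub>R u (t - x))"
proof (rule Bochner_Integration.integrable_bound)
  note [measurable] = good_kernelD(1)[OF f]
  show "integrable lborel (\<lambda>x. B * f x)" using good_kernel_integrable[OF f] by simp
  show "(\<lambda>x. f x *\<^sub>R u (t - x)) \<in> borel_measurable lborel" by measurable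
  show "AE x in lborel. norm (f x *\<^sub>R u (t - x)) \<le> norm (B * f x)"
  proof (rule AE_I2)
    fix x
    have "norm (f x *\<^sub>R u (t - x)) \<le> f x * B" 
      using good_kernelD(2)[OF f] B by (simp add: mult_left_mono)
    then show "norm (f x *\<^sub>R u (t - x)) \<le> norm (B * f x)" by (simp add: mult.commute)
  qed
qed

text \<open>For a decreasing kernel the difference has a fixed sign away from the jump at 0, so its
  integral telescopes. What remains is twice the mass of f on (0,d], and that mass is at most 2 sqrt
  d.\<close>

lemma good_kernel_translation_L1:
  assumes f: "good_kernel f" and d: "0 \<le> d"
  shows "integrable lborel (\<lambda>x. \<bar>f (x + d) - f x\<bar>)"
    and "(LINT x|lborel. \<bar>f (x + d) - f x\<bar>) \<le> 4 * sqrt d"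
proof -
  note g = good_kernelD[OF f]
  note [measurable] = g(1)
  note fi = good_kernel_integrable[OF f]
  have fd: "integrable lborel (\<lambda>x. f (x + d))"
    using lborel_integrable_real_affine[OF fi, of 1 d] by (simp add: add.commute)
  have fd2: "(LINT x|lborel. f (x + d)) = (LINT x|lborel. f x)"
    using lborel_integral_real_affine[of 1 f d] by (simp add: add.commute)
  \<comment> \<open>The sign of f x - f (x + d) is wrong only for -d < x <= 0, where f x = 0; the
    indicator term flips it there.\<close>
  have eq: "\<bar>f (x + d) - f x\<bar> = f x - f (x + d) + 2 * (indicator {0<..d} (x + d) * f (x + d))" for x
  proof (cases "0 < x")
    case True
    then show ?thesis using g(5)[of x "x+d"] d by (auto simp: indicator_def)
  next
    case False
    then show ?thesis using g(2,4)[of "x"] g(2,4)[of "x+d"] by (auto simp: indicator_def)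
  qed
  have ii: "integrable lborel (\<lambda>x. indicator {0<..d} x * f x)"
    by (rule Bochner_Integration.integrable_bound[OF fi]) (use g(2) in \<open>auto simp: indicator_def\<close>)
  have iid: "integrable lborel (\<lambda>x. indicator {0<..d} (x + d) * f (x + d))"
    using lborel_integrable_real_affine[OF ii, of 1 d] by (simp add: add.commute)
  have iid2: "(LINT x|lborel. indicator {0<..d} (x + d) * f (x + d)) = (LINT x|lborel. indicator {0<..d} x * f x)"
    using lborel_integral_real_affine[of 1 "\<lambda>x. indicator {0<..d} x * f x" d] by (simp add: add.commute)
  show "integrable lborel (\<lambda>x. \<bar>f (x + d) - f x\<bar>)"
    using fd fi by (intro integrable_abs Bochner_Integration.integrable_diff)
  have "(LINT x|lborel. \<bar>f (x + d) - f x\<bar>) = 2 * (LINT x|lborel. indicator {0<..d} x * f x)"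
    unfolding eq using fi fd iid fd2 iid2 by simp
  also have "(LINT x|lborel. indicator {0<..d} x * f x) \<le> (LINT x|lborel. indicator {0<..d} x *\<^sub>R (1 / sqrt x))"
  proof (rule integral_mono[OF ii])
    show "integrable lborel (\<lambda>x. indicator {0<..d} x *\<^sub>R (1 / sqrt x))"
      using inverse_sqrt_integral(1)[OF d] by (simp add: set_integrable_def)
    show "indicator {0<..d} x * f x \<le> indicator {0<..d} x *\<^sub>R (1 / sqrt x)" for x
      using g(3)[of x] majorant_le_sqrt[of x] by (auto simp: indicator_def)
  qed
  also have "\<dots> = 2 * sqrt d"
    using inverse_sqrt_integral(2)[OF d] by (simp add: set_lebesgue_integral_def)
  finally show "(LINT x|lborel. \<bar>f (x + d) - f x\<bar>) \<le> 4 * sqrt d" by simp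
qed

text \<open>The constant depends neither on the kernel nor on any regularity of u. This uniformity
  is the equicontinuity that Arzela-Ascoli will need.\<close>

lemma conv_Hoelder:
  fixes u :: "real \<Rightarrow> 'a::{banach, second_countable_topology}"
  assumes f: "good_kernel f" and u[measurable]: "u \<in> borel_measurable borel" and B: "\<And>t. norm (u t) \<le> B"
  shows "norm (conv f u t' - conv f u t) \<le> 4 * B * sqrt \<bar>t' - t\<bar>"
proof -
  note [measurable] = good_kernelD(1)[OF f]
  have *: "norm (conv f u (t + d) - conv f u t) \<le> 4 * B * sqrt d" if d: "0 \<le> d" for t d
  proof -
    have "conv f u (t + d) = (LINT x|lborel. f (x + d) *\<^sub>R u (t - x))"
      unfolding conv_def
      using lborel_integral_real_affine[of 1 "\<lambda>x. f x *\<^sub>R u (t + d - x)" d]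
      by (simp add: algebra_simps)
    moreover have "integrable lborel (\<lambda>x. f (x + d) *\<^sub>R u (t - x))"
      using lborel_integrable_real_affine[OF conv_integrable[OF f u B, of "t + d"], of 1 d]
      by (simp add: algebra_simps)
    ultimately have eq: "conv f u (t + d) - conv f u t = (LINT x|lborel. (f (x + d) - f x) *\<^sub>R u (t - x))"
      unfolding conv_def using conv_integrable[OF f u B, of t]
      by (simp add: scaleR_diff_left)
    note tr = good_kernel_translation_L1[OF f d]
    have bd: "norm ((f (x + d) - f x) *\<^sub>R u (t - x)) \<le> \<bar>f (x + d) - f x\<bar> * B" for x
      using B by (simp add: mult_left_mono)
    have I: "integrable lborel (\<lambda>x. (f (x + d) - f x) *\<^sub>R u (t - x))"
    proof (rule Bochner_Integration.integrable_bound)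
      show "integrable lborel (\<lambda>x. \<bar>f (x + d) - f x\<bar> * B)" using tr(1) by simp
    qed (use bd order_trans[OF norm_ge_zero B] in \<open>auto intro!: AE_I2 simp: abs_mult\<close>)
    have "norm (conv f u (t + d) - conv f u t) \<le> (LINT x|lborel. norm ((f (x + d) - f x) *\<^sub>R u (t - x)))"
      unfolding eq by (rule integral_norm_bound)
    also have "\<dots> \<le> (LINT x|lborel. \<bar>f (x + d) - f x\<bar> * B)"
      by (rule integral_mono[OF integrable_norm[OF I]]) (use tr bd in auto)
    also have "\<dots> \<le> 4 * sqrt d * B"
      using tr(2) order_trans[OF norm_ge_zero B] by (simp add: mult_right_mono)
    finally show ?thesis by (simp add: mult_ac)
  qed
  show ?thesis
  proof (cases "t \<le> t'")
    case True
    then show ?thesis using *[of "t' - t" t] by simp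
  next
    case False
    then show ?thesis using *[of "t - t'" t'] by (simp add: norm_minus_commute)
  qed
qed

lemma conv_continuous:
  fixes u :: "real \<Rightarrow> 'a::{banach, second_countable_topology}"
  assumes f: "good_kernel f" and u: "u \<in> borel_measurable borel" and B: "\<And>t. norm (u t) \<le> B"
  shows "continuous_on UNIV (conv f u)"
proof (intro continuous_at_imp_continuous_on ballI)
  fix t
  have lim: "((\<lambda>s. 4 * B * sqrt \<bar>s - t\<bar>) \<longlongrightarrow> 0) (at t)"
    by (rule tendsto_eq_intros refl | simp)+
  have "\<forall>\<^sub>F s in at t. norm (conv f u s - conv f u t) \<le> 4 * B * sqrt \<bar>s - t\<bar>"
    by (intro always_eventually allI conv_Hoelder[OF f u B])
  then have "((\<lambda>s. conv f u s - conv f u t) \<longlongrightarrow> 0) (at t)"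
    using lim by (rule Lim_null_comparison)
  then show "isCont (conv f u) t"
    unfolding isCont_def by (simp add: LIM_zero_iff)
qed

text \<open>Kernel and function vary together because in the compactness argument the damping
  parameter converges along with the functions.\<close>

lemma conv_tendsto:
  fixes u :: "nat \<Rightarrow> real \<Rightarrow> 'a::{banach, second_countable_topology}"
  assumes f: "\<And>k. good_kernel (f k)" and [measurable]: "g \<in> borel_measurable borel" "\<And>k. u k \<in> borel_measurable borel" "v \<in> borel_measurable borel"
    and B: "\<And>k t. norm (u k t) \<le> B"
    and fg: "\<And>x. (\<lambda>k. f k x) \<longlonglongrightarrow> g x" and uv: "\<And>t. (\<lambda>k. u k t) \<longlonglongrightarrow> v t"
  shows "(\<lambda>k. conv (f k) (u k) t) \<longlonglongrightarrow> conv g v t"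
  unfolding conv_def
proof (rule integral_dominated_convergence)
  note [measurable] = good_kernelD(1)[OF f]
  show "integrable lborel (\<lambda>x. majorant x * B)" using majorant_integrable by simp
  show "(\<lambda>x. g x *\<^sub>R v (t - x)) \<in> borel_measurable lborel" by measurable
  show "(\<lambda>x. f k x *\<^sub>R u k (t - x)) \<in> borel_measurable lborel" for k by measurable
  show "AE x in lborel. (\<lambda>k. f k x *\<^sub>R u k (t - x)) \<longlonglongrightarrow> g x *\<^sub>R v (t - x)"
    by (intro AE_I2 tendsto_scaleR fg uv)
  show "AE x in lborel. norm (f k x *\<^sub>R u k (t - x)) \<le> majorant x * B" for k
    using B good_kernelD(2,3)[OF f] by (auto intro!: AE_I2 mult_mono majorant_nonneg)
qed

section \<open>The Abel kernel and its regularization\<close>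

definition abel_kernel :: "real \<Rightarrow> real" where
  "abel_kernel x = (if 0 < x then 1 / sqrt x else 0)"

definition reg_kernel :: "real \<Rightarrow> real" where
  "reg_kernel x = (if 0 < x then 1 / sqrt x - 1 / sqrt (1 + x) else 0)"

text \<open>Chosen so that its convolution with \<open>abel_kernel\<close> is 1 / sqrt (1 + t),
  which has the same tail as the Abel kernel. Subtracting it leaves exactly
  \<open>reg_kernel\<close>.\<close>

definition mix_kernel :: "real \<Rightarrow> real" where
  "mix_kernel x = (if 0 < x then 1 / (pi * sqrt x * (1 + x)) else 0)"

lemma kernel_measurable [measurable]:
  "abel_kernel \<in> borel_measurable borel" "reg_kernel \<in> borel_measurable borel" "mix_kernel \<in> borel_measurable borel"
  unfolding abel_kernel_def reg_kernel_def mix_kernel_def by measurable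

text \<open>In the rationalized form positivity, monotonicity and the decay of order 3/2 can all be
  read off; in the difference of two roots none of them can.\<close>

lemma reg_kernel_alt:
  assumes "0 < x"
  shows "reg_kernel x = 1 / (sqrt x * (sqrt (1 + x) * (sqrt (1 + x) + sqrt x)))"
proof -
  have p: "0 < sqrt x" "0 < sqrt (1 + x)" using assms by auto
  have "(sqrt (1 + x) - sqrt x) * (sqrt (1 + x) + sqrt x) = 1"
  proof -
    have "(sqrt (1 + x) - sqrt x) * (sqrt (1 + x) + sqrt x) = (sqrt (1 + x))\<^sup>2 - (sqrt x)\<^sup>2"
      by (simp add: power2_eq_square algebra_simps)
    then show ?thesis using assms by simp
  qed
  then have "sqrt (1 + x) - sqrt x = 1 / (sqrt (1 + x) + sqrt x)"
    using add_pos_pos[OF p(2,1)] by (simp add: eq_divide_eq)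
  moreover have "reg_kernel x = (sqrt (1 + x) - sqrt x) / (sqrt x * sqrt (1 + x))"
    using assms p by (simp add: reg_kernel_def field_simps)
  ultimately show ?thesis by simp
qed

lemma good_kernel_reg_kernel: "good_kernel reg_kernel"
  unfolding good_kernel_def
proof (intro conjI allI)
  fix x :: real
  have *: "0 \<le> reg_kernel x \<and> reg_kernel x \<le> majorant x" if x: "0 < x"
  proof -
    have p: "0 < sqrt x" "0 < sqrt (1 + x)" using x by auto
    have "sqrt (1 + x) * (sqrt (1 + x) + sqrt x) = 1 + x + sqrt (1 + x) * sqrt x"
      using x by (simp add: distrib_left)
    then have m: "x \<le> sqrt (1 + x) * (sqrt (1 + x) + sqrt x)"
      using x p by (smt (verit) mult_nonneg_nonneg)
    have "reg_kernel x \<le> 1 / sqrt x" using x by (simp add: reg_kernel_def)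
    moreover have "reg_kernel x \<le> 1 / (sqrt x * x)"
      unfolding reg_kernel_alt[OF x] using p x m by (intro divide_left_mono mult_left_mono) auto
    moreover have "0 \<le> reg_kernel x" unfolding reg_kernel_alt[OF x] using x by simp
    ultimately show ?thesis using x by (simp add: majorant_def mult.commute)
  qed
  show "0 \<le> reg_kernel x" "reg_kernel x \<le> majorant x"
    using * by (cases "0 < x"; simp add: reg_kernel_def majorant_def)+
next
  show "antimono_on {0<..} reg_kernel"
    unfolding monotone_on_def
  proof (intro ballI impI)
    fix x y :: real assume "x \<in> {0<..}" "y \<in> {0<..}" "x \<le> y"
    then have xy: "0 < x" "0 < y" "x \<le> y" by auto
    show "reg_kernel y \<le> reg_kernel x"
      unfolding reg_kernel_alt[OF xy(1)] reg_kernel_alt[OF xy(2)] using xy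
      by (intro divide_left_mono mult_mono mult_pos_pos add_mono) (auto intro!: mult_pos_pos add_pos_pos)
  qed
qed measurable

lemma good_kernel_mix_kernel: "good_kernel mix_kernel"
  unfolding good_kernel_def
proof (intro conjI allI)
  fix x :: real
  have *: "mix_kernel x \<le> majorant x" if x: "0 < x"
  proof -
    have p: "1 \<le> pi" using pi_ge_two by linarith
    have "sqrt x * (1 * x) \<le> sqrt x * (pi * (1 + x))" 
      using x p by (intro mult_left_mono mult_mono) auto
    then have 1: "mix_kernel x \<le> 1 / (sqrt x * x)"
      using x pi_gt_zero by (auto simp: mix_kernel_def intro!: divide_left_mono simp: mult_ac)
    have "sqrt x * (1 * 1) \<le> sqrt x * (pi * (1 + x))" 
      using x p by (intro mult_left_mono mult_mono) auto
    then have 2: "mix_kernel x \<le> 1 / sqrt x"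
      using x pi_gt_zero by (auto simp: mix_kernel_def intro!: divide_left_mono simp: mult_ac)
    from 1 2 show ?thesis using x by (simp add: majorant_def mult.commute)
  qed
  show "0 \<le> mix_kernel x" by (simp add: mix_kernel_def)
  show "mix_kernel x \<le> majorant x" using * by (cases "0 < x") (auto simp add: mix_kernel_def majorant_def)
next
  show "antimono_on {0<..} mix_kernel"
    unfolding monotone_on_def mix_kernel_def by (auto intro!: divide_left_mono mult_mono)
qed measurable

text \<open>The substitution u = sqrt (x / (t - x)) turns the integrand into 2 / (1 + r^2 u^2) with
  r^2 = 1 + c t, whence the antiderivative \<open>F\<close>. The case c = 0 is the Beta integral
  behind the square of the Abel kernel, and c = 1 is the one behind
  \<open>mix_kernel\<close>.\<close>

lemma arctan_beta_integral:
  assumes t: "0 < t" and c: "0 \<le> c"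
  shows "set_integrable lborel {0<..<t} (\<lambda>x. 1 / (sqrt x * sqrt (t - x) * (1 + c * x)))"
    and "(LINT x:{0<..<t}|lborel. 1 / (sqrt x * sqrt (t - x) * (1 + c * x))) = pi / sqrt (1 + c * t)"
proof -
  define r where "r = sqrt (1 + c * t)"
  have ct: "0 < 1 + c * t" using t c by (simp add: add_pos_nonneg)
  have r: "0 < r" "r\<^sup>2 = 1 + c * t" using ct by (auto simp: r_def)
  define F where "F = (\<lambda>x. 2 / r * arctan (r * (sqrt x / sqrt (t - x))))"
  have der: "DERIV F x :> 1 / (sqrt x * sqrt (t - x) * (1 + c * x))" if x: "0 < x" "x < t" for x
  proof -
    define a b where "a = sqrt x" and "b = sqrt (t - x)"
    have ab: "0 < a" "0 < b" "a\<^sup>2 = x" "b\<^sup>2 = t - x" using x by (auto simp: a_def b_def)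
    have D1: "DERIV (\<lambda>x. sqrt x / sqrt (t - x)) x :> (1 / (2 * a) * b + a * (1 / (2 * b))) / b\<^sup>2"
      using x by (auto intro!: derivative_eq_intros simp: a_def b_def field_simps power2_eq_square)
    have "DERIV F x :> 2 / r * (inverse (1 + (r * (sqrt x / sqrt (t - x)))\<^sup>2) * (r * ((1 / (2 * a) * b + a * (1 / (2 * b))) / b\<^sup>2)))"
      unfolding F_def by (rule DERIV_cmult[OF DERIV_chain2[OF DERIV_arctan DERIV_cmult[OF D1]]])
    also have "2 / r * (inverse (1 + (r * (sqrt x / sqrt (t - x)))\<^sup>2) * (r * ((1 / (2 * a) * b + a * (1 / (2 * b))) / b\<^sup>2)))
       = (a\<^sup>2 + b\<^sup>2) / (a * b * (b\<^sup>2 + r\<^sup>2 * a\<^sup>2))"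
    proof -
      define S where "S = b\<^sup>2 + r\<^sup>2 * a\<^sup>2"
      have S: "0 < S" using ab(1,2) by (simp add: S_def add_pos_nonneg)
      have e1: "1 + (r * (sqrt x / sqrt (t - x)))\<^sup>2 = S / b\<^sup>2"
        unfolding a_def[symmetric] b_def[symmetric] S_def using ab(1,2) by (simp add: field_simps power_mult_distrib)
      have e2: "1 / (2 * a) * b + a * (1 / (2 * b)) = (a\<^sup>2 + b\<^sup>2) / (2 * a * b)"
        using ab(1,2) by (simp add: field_simps power2_eq_square)
      show ?thesis unfolding e1 e2 S_def[symmetric] using S ab(1,2) r(1) by (simp add: divide_simps)
    qed
    also have "\<dots> = t / (a * b * (t * (1 + c * x)))"
    proof -
      have "a\<^sup>2 + b\<^sup>2 = t" "b\<^sup>2 + r\<^sup>2 * a\<^sup>2 = t * (1 + c * x)"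
        unfolding ab r by (auto simp: algebra_simps)
      then show ?thesis by simp
    qed
    also have "\<dots> = 1 / (a * b * (1 + c * x))" using t by simp
    finally show ?thesis by (simp add: a_def b_def)
  qed
  have cont: "isCont (\<lambda>x. 1 / (sqrt x * sqrt (t - x) * (1 + c * x))) x" if "0 < x" "x < t" for x
    using that c by (auto intro!: continuous_intros simp: add_nonneg_eq_0_iff)
  have nn: "AE x in lborel. ereal 0 < ereal x \<longrightarrow> ereal x < ereal t \<longrightarrow> 0 \<le> 1 / (sqrt x * sqrt (t - x) * (1 + c * x))"
    using c by (intro AE_I2) auto
  have "(F \<longlongrightarrow> 2 / r * arctan (r * (sqrt 0 / sqrt (t - 0)))) (at_right 0)"
    unfolding F_def using t by (intro tendsto_intros) auto
  then have A: "((F \<circ> real_of_ereal) \<longlongrightarrow> 0) (at_right (ereal 0))"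
    by (simp add: ereal_tendsto_simps)
  have f1: "filterlim (\<lambda>x. sqrt (t - x)) (at_right 0) (at_left t)"
    unfolding filterlim_at
  proof
    show "((\<lambda>x. sqrt (t - x)) \<longlongrightarrow> 0) (at_left t)"
      by (rule tendsto_eq_intros refl | simp)+
    show "\<forall>\<^sub>F x in at_left t. sqrt (t - x) \<in> {0<..} \<and> sqrt (t - x) \<noteq> 0"
      by (auto simp: eventually_at_filter)
  qed
  have f2: "((\<lambda>x. sqrt x) \<longlongrightarrow> sqrt t) (at_left t)"
    by (rule tendsto_eq_intros refl | simp)+
  have inf: "filterlim (\<lambda>x. sqrt x / sqrt (t - x)) at_top (at_left t)"
    unfolding divide_inverse
    by (rule filterlim_tendsto_pos_mult_at_top[OF f2 _ filterlim_compose[OF filterlim_inverse_at_top_right f1]])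
      (use t in simp)
  have "filterlim (\<lambda>x. r * (sqrt x / sqrt (t - x))) at_top (at_left t)"
    by (rule filterlim_tendsto_pos_mult_at_top[OF tendsto_const r(1) inf])
  then have "((\<lambda>x. arctan (r * (sqrt x / sqrt (t - x)))) \<longlongrightarrow> pi / 2) (at_left t)"
    by (rule filterlim_compose[OF tendsto_arctan_at_top])
  then have "(F \<longlongrightarrow> 2 / r * (pi / 2)) (at_left t)"
    unfolding F_def by (intro tendsto_intros)
  then have B: "((F \<circ> real_of_ereal) \<longlongrightarrow> pi / r) (at_left (ereal t))"
    by (simp add: ereal_tendsto_simps)
  note FTC = interval_integral_FTC_nonneg[of "ereal 0" "ereal t" F "\<lambda>x. 1 / (sqrt x * sqrt (t - x) * (1 + c * x))", OF _ _ _ nn A B]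
  have "set_integrable lborel (einterval (ereal 0) (ereal t)) (\<lambda>x. 1 / (sqrt x * sqrt (t - x) * (1 + c * x)))"
    and "(LBINT x=ereal 0..ereal t. 1 / (sqrt x * sqrt (t - x) * (1 + c * x))) = pi / r - 0"
    using FTC t der cont by auto
  then show "set_integrable lborel {0<..<t} (\<lambda>x. 1 / (sqrt x * sqrt (t - x) * (1 + c * x)))"
    and "(LINT x:{0<..<t}|lborel. 1 / (sqrt x * sqrt (t - x) * (1 + c * x))) = pi / sqrt (1 + c * t)"
    using t by (auto simp: interval_lebesgue_integral_def r_def)
qed

lemma conv_abel_kernel_abel_kernel:
  shows "integrable lborel (\<lambda>x. abel_kernel x * abel_kernel (t - x))"
    and "conv abel_kernel abel_kernel t = (if 0 < t then pi else 0)"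
proof -
  have *: "integrable lborel (\<lambda>x. abel_kernel x * abel_kernel (t - x)) \<and> conv abel_kernel abel_kernel t = (if 0 < t then pi else 0)"
  proof (cases "0 < t")
    case True
    have "(\<lambda>x. abel_kernel x * abel_kernel (t - x)) = (\<lambda>x. indicator {0<..<t} x *\<^sub>R (1 / (sqrt x * sqrt (t - x) * (1 + 0 * x))))"
      by (auto simp: abel_kernel_def indicator_def)
    then show ?thesis using arctan_beta_integral[OF True, of 0] True
      by (simp add: conv_def set_integrable_def set_lebesgue_integral_def)
  next
    case False
    then have "(\<lambda>x. abel_kernel x * abel_kernel (t - x)) = (\<lambda>x. 0)" by (auto simp: abel_kernel_def)
    then show ?thesis using False by (simp add: conv_def)
  qed
  then show "integrable lborel (\<lambda>x. abel_kernel x * abel_kernel (t - x))"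
    and "conv abel_kernel abel_kernel t = (if 0 < t then pi else 0)" by auto
qed

lemma conv_mix_kernel_abel_kernel:
  shows "integrable lborel (\<lambda>x. mix_kernel x * abel_kernel (t - x))"
    and "conv mix_kernel abel_kernel t = abel_kernel t - reg_kernel t"
proof -
  have *: "integrable lborel (\<lambda>x. mix_kernel x * abel_kernel (t - x)) \<and> conv mix_kernel abel_kernel t = abel_kernel t - reg_kernel t"
  proof (cases "0 < t")
    case True
    define g where "g = (\<lambda>x. indicator {0<..<t} x *\<^sub>R (1 / (sqrt x * sqrt (t - x) * (1 + 1 * x))))"
    have "(\<lambda>x. mix_kernel x * abel_kernel (t - x)) = (\<lambda>x. (1 / pi) * g x)"
      by (auto simp: abel_kernel_def mix_kernel_def indicator_def g_def)
    moreover have "integrable lborel g" "(LINT x|lborel. g x) = pi / sqrt (1 + t)"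
      using arctan_beta_integral[OF True, of 1] by (auto simp: g_def set_integrable_def set_lebesgue_integral_def)
    ultimately show ?thesis using True
      by (simp add: conv_def abel_kernel_def[of t] reg_kernel_def)
  next
    case False
    then have "(\<lambda>x. mix_kernel x * abel_kernel (t - x)) = (\<lambda>x. 0)" by (auto simp: abel_kernel_def mix_kernel_def)
    then show ?thesis using False by (simp add: conv_def abel_kernel_def reg_kernel_def)
  qed
  then show "integrable lborel (\<lambda>x. mix_kernel x * abel_kernel (t - x))"
    and "conv mix_kernel abel_kernel t = abel_kernel t - reg_kernel t" by auto
qed

text \<open>Fubini after the shift w = x + y. Absolute convergence is assumed for the full triple
  product, since \<open>abel_kernel\<close> is not integrable and u is sometimes an exponential, so
  neither factor alone provides it.\<close>

lemma conv_assoc: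
  fixes u :: "real \<Rightarrow> 'a::{banach, second_countable_topology}"
  assumes [measurable]: "f \<in> borel_measurable borel" "g \<in> borel_measurable borel" "u \<in> borel_measurable borel"
    and fg: "\<And>w. integrable lborel (\<lambda>x. f x * g (w - x))"
    and fin: "(\<integral>\<^sup>+x. \<integral>\<^sup>+y. ennreal (norm (f x *\<^sub>R g y *\<^sub>R u (t - x - y))) \<partial>lborel \<partial>lborel) < \<infinity>"
  shows "conv f (conv g u) t = conv (conv f g) u t"
proof -
  define P where "P = (\<lambda>x w. f x *\<^sub>R g (w - x) *\<^sub>R u (t - w))"
  have Pm [measurable]: "case_prod P \<in> borel_measurable (lborel \<Otimes>\<^sub>M lborel)"
    unfolding P_def by measurable
  have int: "integrable (lborel \<Otimes>\<^sub>M lborel) (case_prod P)"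
  proof (rule integrableI_bounded)
    have "(\<integral>\<^sup>+ z. ennreal (norm (case_prod P z)) \<partial>(lborel \<Otimes>\<^sub>M lborel)) = (\<integral>\<^sup>+x. \<integral>\<^sup>+w. ennreal (norm (P x w)) \<partial>lborel \<partial>lborel)"
      by (subst lborel.nn_integral_fst[symmetric]) auto
    also have "\<dots> = (\<integral>\<^sup>+x. \<integral>\<^sup>+y. ennreal (norm (f x *\<^sub>R g y *\<^sub>R u (t - x - y))) \<partial>lborel \<partial>lborel)"
    proof (rule nn_integral_cong)
      fix x :: real
      show "(\<integral>\<^sup>+w. ennreal (norm (P x w)) \<partial>lborel) = (\<integral>\<^sup>+y. ennreal (norm (f x *\<^sub>R g y *\<^sub>R u (t - x - y))) \<partial>lborel)"
        by (subst nn_integral_real_affine[where c=1 and t=x]) (auto simp: P_def algebra_simps)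
    qed
    finally show "(\<integral>\<^sup>+ z. ennreal (norm (case_prod P z)) \<partial>(lborel \<Otimes>\<^sub>M lborel)) < \<infinity>"
      using fin by simp
  qed measurable
  have "conv f (conv g u) t = (LINT x|lborel. LINT w|lborel. P x w)"
    unfolding conv_def
  proof (rule Bochner_Integration.integral_cong[OF refl])
    fix x :: real
    have "(LINT w|lborel. P x w) = (LINT y|lborel. f x *\<^sub>R g y *\<^sub>R u (t - x - y))"
      using lborel_integral_real_affine[of 1 "P x" x] by (simp add: P_def algebra_simps)
    also have "\<dots> = f x *\<^sub>R (LINT y|lborel. g y *\<^sub>R u (t - x - y))"
      by (rule integral_scaleR_right)
    finally show "f x *\<^sub>R (LINT y|lborel. g y *\<^sub>R u (t - x - y)) = (LINT w|lborel. P x w)" by simp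
  qed
  also have "\<dots> = (LINT w|lborel. LINT x|lborel. P x w)"
    using lborel_pair.Fubini_integral[OF int] by simp
  also have "\<dots> = conv (conv f g) u t"
    unfolding conv_def
  proof (rule Bochner_Integration.integral_cong[OF refl])
    fix w :: real
    have "(LINT x|lborel. P x w) = (LINT x|lborel. (f x * g (w - x)) *\<^sub>R u (t - w))"
      by (simp add: P_def)
    also have "\<dots> = (LINT x|lborel. f x * g (w - x)) *\<^sub>R u (t - w)"
      by (rule integral_scaleR_left) (rule fg)
    finally show "(LINT x|lborel. P x w) = (LINT x|lborel. f x *\<^sub>R g (w - x)) *\<^sub>R u (t - w)" by simp
  qed
  finally show ?thesis .
qed

section \<open>Laplace transforms of the kernels\<close>

definition laplace :: "(real \<Rightarrow> real) \<Rightarrow> complex \<Rightarrow> complex" where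
  "laplace f p = (LINT x|lborel. f x *\<^sub>R exp (- (p * of_real x)))"

lemma laplace_integrable:
  assumes [measurable]: "f \<in> borel_measurable borel" and f0: "\<And>x. x \<le> 0 \<Longrightarrow> f x = 0"
    and int: "integrable lborel (\<lambda>x. exp (- \<delta> * x) * \<bar>f x\<bar>)" and p: "\<delta> \<le> Re p"
  shows "integrable lborel (\<lambda>x. f x *\<^sub>R exp (- (p * of_real x)))"
    and "norm (f x *\<^sub>R exp (- (p * of_real x))) \<le> exp (- \<delta> * x) * \<bar>f x\<bar>"
proof -
  have b: "norm (f x *\<^sub>R exp (- (p * of_real x))) \<le> exp (- \<delta> * x) * \<bar>f x\<bar>" for x
  proof (cases "x \<le> 0")
    case False
    then show ?thesis using p by (simp add: norm_exp_eq_Re mult.commute mult_left_mono mult_right_mono)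
  qed (simp add: f0)
  show "norm (f x *\<^sub>R exp (- (p * of_real x))) \<le> exp (- \<delta> * x) * \<bar>f x\<bar>" by (rule b)
  show "integrable lborel (\<lambda>x. f x *\<^sub>R exp (- (p * of_real x)))"
    by (rule Bochner_Integration.integrable_bound[OF int]) (use b in \<open>auto simp: abs_mult\<close>)
qed

lemma laplace_continuous:
  assumes f[measurable]: "f \<in> borel_measurable borel" and f0: "\<And>x. x \<le> 0 \<Longrightarrow> f x = 0"
    and int: "integrable lborel (\<lambda>x. exp (- \<delta> * x) * \<bar>f x\<bar>)"
  shows "continuous_on {p. \<delta> \<le> Re p} (laplace f)"
proof (rule continuous_on_sequentiallyI)
  fix P p assume P: "\<forall>n. P n \<in> {p. \<delta> \<le> Re p}" "p \<in> {p. \<delta> \<le> Re p}" "P \<longlonglongrightarrow> p"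
  show "(\<lambda>n. laplace f (P n)) \<longlonglongrightarrow> laplace f p"
    unfolding laplace_def
  proof (rule integral_dominated_convergence[OF _ _ int])
    show "AE x in lborel. (\<lambda>n. f x *\<^sub>R exp (- (P n * of_real x))) \<longlonglongrightarrow> f x *\<^sub>R exp (- (p * of_real x))"
      by (intro AE_I2 tendsto_intros P)
    show "AE x in lborel. norm (f x *\<^sub>R exp (- (P n * of_real x))) \<le> exp (- \<delta> * x) * \<bar>f x\<bar>" for n
      using P(1) by (intro AE_I2 laplace_integrable(2)[OF f f0 int]) auto
  qed measurable
qed

text \<open>The transform of f at p is \<open>conv f u 0\<close> for the exponential u, and
  exponentials are eigenfunctions of every convolution. Multiplicativity is thus an instance of
  associativity.\<close>

lemma laplace_conv:
  assumes [measurable]: "f \<in> borel_measurable borel" "g \<in> borel_measurable borel"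
    and f0: "\<And>x. x \<le> 0 \<Longrightarrow> f x = 0" and g0: "\<And>x. x \<le> 0 \<Longrightarrow> g x = 0"
    and fi: "integrable lborel (\<lambda>x. exp (- \<delta> * x) * \<bar>f x\<bar>)"
    and gi: "integrable lborel (\<lambda>x. exp (- \<delta> * x) * \<bar>g x\<bar>)"
    and p: "\<delta> \<le> Re p"
    and fg: "\<And>w. integrable lborel (\<lambda>x. f x * g (w - x))"
  shows "laplace (conv f g) p = laplace f p * laplace g p"
proof -
  define u where "u = (\<lambda>w::real. exp (p * of_real w))"
  have [measurable]: "u \<in> borel_measurable borel" unfolding u_def by measurable
  note Fi = laplace_integrable(1)[OF _ f0 fi p, THEN integrable_norm]
  note Gi = laplace_integrable(1)[OF _ g0 gi p, THEN integrable_norm]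
  have e: "norm (f x *\<^sub>R g y *\<^sub>R u (0 - x - y))
     = norm (f x *\<^sub>R exp (- (p * of_real x))) * norm (g y *\<^sub>R exp (- (p * of_real y)))" for x y
    by (simp add: u_def norm_exp_eq_Re abs_mult algebra_simps flip: exp_add)
  have "(\<integral>\<^sup>+x. \<integral>\<^sup>+y. ennreal (norm (f x *\<^sub>R g y *\<^sub>R u (0 - x - y))) \<partial>lborel \<partial>lborel)
     = (\<integral>\<^sup>+x. ennreal (norm (f x *\<^sub>R exp (- (p * of_real x)))) * (\<integral>\<^sup>+y. ennreal (norm (g y *\<^sub>R exp (- (p * of_real y)))) \<partial>lborel) \<partial>lborel)"
    unfolding e by (simp add: ennreal_mult' nn_integral_cmult del: norm_scaleR)
  also have "\<dots> = (\<integral>\<^sup>+x. ennreal (norm (f x *\<^sub>R exp (- (p * of_real x)))) \<partial>lborel) * (\<integral>\<^sup>+y. ennreal (norm (g y *\<^sub>R exp (- (p * of_real y)))) \<partial>lborel)"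
    by (rule nn_integral_multc) measurable
  also have "\<dots> < \<infinity>"
    using Fi Gi by (simp add: integrable_iff_bounded ennreal_mult_less_top del: norm_scaleR)
  finally have fin: "(\<integral>\<^sup>+x. \<integral>\<^sup>+y. ennreal (norm (f x *\<^sub>R g y *\<^sub>R u (0 - x - y))) \<partial>lborel \<partial>lborel) < \<infinity>" .
  have gu: "conv g u (0 - x) = exp (- (p * of_real x)) * laplace g p" for x
  proof -
    have "conv g u (0 - x) = (LINT y|lborel. exp (- (p * of_real x)) * (g y *\<^sub>R exp (- (p * of_real y))))"
      unfolding conv_def u_def
      by (intro Bochner_Integration.integral_cong) (auto simp: scaleR_conv_of_real algebra_simps exp_diff exp_minus field_simps)
    then show ?thesis unfolding laplace_def integral_mult_right_zero .
  qed
  have "laplace (conv f g) p = conv (conv f g) u 0"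
    by (simp add: laplace_def conv_def u_def)
  also have "\<dots> = conv f (conv g u) 0"
    by (rule conv_assoc[symmetric]) (use fg fin in auto)
  also have "\<dots> = (LINT x|lborel. (f x *\<^sub>R exp (- (p * of_real x))) * laplace g p)"
    unfolding conv_def[of f] gu by simp
  also have "\<dots> = laplace f p * laplace g p"
    unfolding laplace_def[of f] by (rule integral_mult_left_zero)
  finally show ?thesis .
qed

text \<open>The factor 1 + 1/\<delta> comes from the two branches of \<open>majorant\<close>: the
  exponential is at most 1 and also at most 1 / (\<delta> x).\<close>

lemma abel_kernel_exp_integrable:
  assumes "0 < \<delta>"
  shows "integrable lborel (\<lambda>x. exp (- \<delta> * x) * \<bar>abel_kernel x\<bar>)"
proof (rule Bochner_Integration.integrable_bound)
  show "integrable lborel (\<lambda>x. (1 + 1 / \<delta>) * majorant x)" using majorant_integrable by simp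
  show "(\<lambda>x. exp (- \<delta> * x) * \<bar>abel_kernel x\<bar>) \<in> borel_measurable lborel" by measurable
  have "exp (- \<delta> * x) * \<bar>abel_kernel x\<bar> \<le> (1 + 1 / \<delta>) * majorant x" for x
  proof (cases "0 < x")
    case True
    have e1: "exp (- \<delta> * x) \<le> 1" using True assms by simp
    have "\<delta> * x \<le> exp (\<delta> * x)" using exp_ge_add_one_self[of "\<delta> * x"] by linarith
    then have e2: "exp (- \<delta> * x) \<le> 1 / (\<delta> * x)"
      using True assms by (simp add: exp_minus field_simps)
    have a: "exp (- \<delta> * x) * (1 / sqrt x) \<le> 1 / sqrt x"
      using e1 True by (simp add: divide_right_mono)
    have "exp (- \<delta> * x) * (1 / sqrt x) \<le> 1 / (\<delta> * x) * (1 / sqrt x)"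
      using e2 True by (intro mult_right_mono) auto
    also have "\<dots> = 1 / \<delta> * (1 / (x * sqrt x))" by simp
    finally have b: "exp (- \<delta> * x) * (1 / sqrt x) \<le> 1 / \<delta> * (1 / (x * sqrt x))" .
    have "majorant x = 1 / sqrt x \<or> majorant x = 1 / (x * sqrt x)" using True by (simp add: majorant_def min_def)
    then have "exp (- \<delta> * x) * (1 / sqrt x) \<le> 1 * majorant x + 1 / \<delta> * majorant x"
    proof
      assume h: "majorant x = 1 / sqrt x"
      have "0 \<le> 1 / \<delta> * majorant x" using assms majorant_nonneg by simp
      then show ?thesis using a h by linarith
    next
      assume h: "majorant x = 1 / (x * sqrt x)"
      then show ?thesis using b[folded h] majorant_nonneg[of x] by linarith
    qed
    then show ?thesis using True by (simp add: abel_kernel_def distrib_right)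
  qed (simp add: abel_kernel_def majorant_def)
  moreover have "0 \<le> exp (- \<delta> * x) * \<bar>abel_kernel x\<bar>" for x by simp
  ultimately show "AE x in lborel. norm (exp (- \<delta> * x) * \<bar>abel_kernel x\<bar>) \<le> norm ((1 + 1 / \<delta>) * majorant x)"
    by (intro AE_I2) (smt (verit) real_norm_def)
qed

lemma laplace_const:
  assumes p: "0 < Re p"
  shows "laplace (\<lambda>x. if 0 < x then a else 0) p = of_real a / p"
proof -
  have p0: "p \<noteq> 0" using p by auto
  have pc: "einterval (ereal 0) \<infinity> = {0<..}" by (auto simp: einterval_def)
  have "((\<lambda>x. - exp (- Re p * x) / Re p) \<longlongrightarrow> 0) at_top"
    using p by real_asymp
  then have lim1: "(((\<lambda>x. - exp (- Re p * x) / Re p) \<circ> real_of_ereal) \<longlongrightarrow> 0) (at_left \<infinity>)"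
    by (simp add: ereal_tendsto_simps)
  have "((\<lambda>x. - exp (- Re p * x) / Re p) \<longlongrightarrow> - exp (- Re p * 0) / Re p) (at_right 0)"
    using p by (intro tendsto_intros) auto
  then have lim0: "(((\<lambda>x. - exp (- Re p * x) / Re p) \<circ> real_of_ereal) \<longlongrightarrow> - 1 / Re p) (at_right (ereal 0))"
    by (simp add: ereal_tendsto_simps)
  have der: "DERIV (\<lambda>x. - exp (- Re p * x) / Re p) x :> exp (- Re p * x)" for x
    using p by (auto intro!: derivative_eq_intros simp: field_simps)
  have I: "set_integrable lborel {0<..} (\<lambda>x. exp (- Re p * x))"
    using interval_integral_FTC_nonneg(1)[of "ereal 0" \<infinity> "\<lambda>x. - exp (- Re p * x) / Re p" "\<lambda>x. exp (- Re p * x)" "- 1 / Re p" 0]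
      der lim0 lim1 unfolding pc by auto
  have Ic: "set_integrable lborel {0<..} (\<lambda>x. exp (- (p * of_real x)))"
    unfolding set_integrable_def
    by (rule Bochner_Integration.integrable_bound[OF I[unfolded set_integrable_def]])
      (auto intro!: AE_I2 simp: norm_exp_eq_Re indicator_def)
  have cder: "((\<lambda>x. - exp (- (p * of_real x)) / p) has_vector_derivative exp (- (p * of_real x))) (at x)" for x
  proof -
    have "((\<lambda>z. - exp (- (p * z)) / p) has_field_derivative exp (- (p * of_real x))) (at (of_real x))"
      using p0 by (auto intro!: derivative_eq_intros)
    from has_vector_derivative_real_field[OF this] show ?thesis by (simp add: o_def)
  qed
  have "((\<lambda>x. - exp (- (p * of_real x)) / p) \<longlongrightarrow> - exp (- (p * of_real 0)) / p) (at_right 0)"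
    using p0 by (intro tendsto_intros) auto
  then have clim0: "(((\<lambda>x. - exp (- (p * of_real x)) / p) \<circ> real_of_ereal) \<longlongrightarrow> - 1 / p) (at_right (ereal 0))"
    by (simp add: ereal_tendsto_simps)
  have "((\<lambda>x. exp (- (Re p * x))) \<longlongrightarrow> 0) at_top"
    using p by real_asymp
  then have "((\<lambda>x. exp (- (Re p * x)) / norm p) \<longlongrightarrow> 0) at_top"
    by (rule tendsto_divide_zero)
  moreover have "norm (- exp (- (p * of_real x)) / p) \<le> exp (- (Re p * x)) / norm p" for x
    by (simp add: norm_divide norm_exp_eq_Re)
  then have "\<forall>\<^sub>F x in at_top. norm (- exp (- (p * of_real x)) / p) \<le> exp (- (Re p * x)) / norm p"
    by (intro always_eventually allI)
  ultimately have "((\<lambda>x. - exp (- (p * of_real x)) / p) \<longlongrightarrow> 0) at_top"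
    by (rule Lim_null_comparison[rotated])
  then have clim1: "(((\<lambda>x. - exp (- (p * of_real x)) / p) \<circ> real_of_ereal) \<longlongrightarrow> 0) (at_left \<infinity>)"
    by (simp add: ereal_tendsto_simps)
  have "(LBINT x=ereal 0..\<infinity>. exp (- (p * of_real x))) = 0 - (- 1 / p)"
    by (rule interval_integral_FTC_integrable[where F = "\<lambda>x. - exp (- (p * of_real x)) / p"])
      (use cder Ic clim0 clim1 pc in \<open>auto intro!: continuous_intros\<close>)
  then have r: "(LINT x:{0<..}|lborel. exp (- (p * of_real x))) = 1 / p"
    using pc by (simp add: interval_lebesgue_integral_def)
  have "laplace (\<lambda>x. if 0 < x then a else 0) p = (LINT x|lborel. of_real a * (indicator {0<..} x *\<^sub>R exp (- (p * of_real x))))"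
    unfolding laplace_def by (intro Bochner_Integration.integral_cong) (auto simp: indicator_def scaleR_conv_of_real)
  then show ?thesis using r unfolding integral_mult_right_zero set_lebesgue_integral_def by simp
qed

lemma abel_kernel_nonpos: "x \<le> 0 \<Longrightarrow> abel_kernel x = 0" by (simp add: abel_kernel_def)

text \<open>The Abel kernel convolved with itself is the constant pi on the positive axis, whose
  transform is elementary. This determines the transform of the Abel kernel up to sign.\<close>

lemma laplace_abel_kernel_square:
  assumes "0 < Re p"
  shows "(laplace abel_kernel p)\<^sup>2 = of_real pi / p"
proof -
  have "conv abel_kernel abel_kernel = (\<lambda>x. if 0 < x then pi else 0)"
    by (rule ext) (rule conv_abel_kernel_abel_kernel(2))
  moreover have "laplace (conv abel_kernel abel_kernel) p = laplace abel_kernel p * laplace abel_kernel p"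
    by (rule laplace_conv[where \<delta> = "Re p"]) (use abel_kernel_exp_integrable[OF assms] conv_abel_kernel_abel_kernel(1) abel_kernel_nonpos in auto)
  ultimately show ?thesis using laplace_const[OF assms] by (simp add: power2_eq_square)
qed

text \<open>The normalized product \<open>\<phi>\<close> is continuous with values 1 and -1 on a
  connected set, hence constant. At p = 1 it is nonnegative because the Abel kernel is, so the
  constant is 1.\<close>

lemma laplace_abel_kernel:
  assumes p: "0 < Re p"
  shows "laplace abel_kernel p * csqrt p = of_real (sqrt pi)"
proof -
  \<comment> \<open>The half plane must contain both p and the reference point 1 and stay away from
    Re z = 0.\<close>
  define \<delta> where "\<delta> = min 1 (Re p)"
  have d: "0 < \<delta>" "\<delta> \<le> 1" "\<delta> \<le> Re p" using p by (auto simp: \<delta>_def)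
  define H where "H = {z. \<delta> \<le> Re z}"
  define \<phi> where "\<phi> = (\<lambda>z. laplace abel_kernel z * csqrt z / of_real (sqrt pi))"
  have sq: "\<phi> z = 1 \<or> \<phi> z = -1" if "z \<in> H" for z
  proof -
    have z: "0 < Re z" using that d by (auto simp: H_def)
    then have "z \<noteq> 0" by auto
    have "(\<phi> z)\<^sup>2 = (laplace abel_kernel z)\<^sup>2 * (csqrt z)\<^sup>2 / (of_real ((sqrt pi)\<^sup>2))"
      by (simp add: \<phi>_def power_divide power_mult_distrib flip: of_real_power)
    also have "\<dots> = 1" using laplace_abel_kernel_square[OF z] \<open>z \<noteq> 0\<close> by simp
    finally show ?thesis by (simp add: power2_eq_1_iff)
  qed
  have "continuous_on H (laplace abel_kernel)"
    unfolding H_def by (rule laplace_continuous) (use abel_kernel_exp_integrable d abel_kernel_nonpos in auto)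
  moreover have "continuous_on H csqrt"
    by (intro continuous_at_imp_continuous_on ballI continuous_at_csqrt)
      (use d in \<open>auto simp: H_def complex_nonpos_Reals_iff\<close>)
  ultimately have cont: "continuous_on H \<phi>"
    unfolding \<phi>_def by (intro continuous_intros) auto
  have "convex H" unfolding H_def by (rule convex_halfspace_Re_ge)
  then have "connected (\<phi> ` H)"
    using cont by (intro connected_continuous_image convex_connected)
  moreover have "finite (\<phi> ` H)" by (rule finite_subset[of _ "{1,-1}"]) (use sq in auto)
  ultimately have c: "\<phi> ` H = {} \<or> (\<exists>x. \<phi> ` H = {x})"
    by (simp add: connected_finite_iff_sing)
  have H: "1 \<in> H" "p \<in> H" using d by (auto simp: H_def)
  then have e: "\<phi> p = \<phi> 1" using c by (metis empty_iff imageI singletonD)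
  have "laplace abel_kernel 1 = (LINT x|lborel. complex_of_real (abel_kernel x * exp (- x)))"
    unfolding laplace_def by (intro Bochner_Integration.integral_cong) (auto simp: scaleR_conv_of_real exp_of_real[symmetric])
  also have "\<dots> = of_real (LINT x|lborel. abel_kernel x * exp (- x))" by (rule integral_complex_of_real)
  finally have "\<phi> 1 = of_real ((LINT x|lborel. abel_kernel x * exp (- x)) / sqrt pi)"
    by (simp add: \<phi>_def)
  moreover have "0 \<le> (LINT x|lborel. abel_kernel x * exp (- x)) / sqrt pi"
    by (intro divide_nonneg_nonneg integral_nonneg_AE AE_I2) (auto simp: abel_kernel_def)
  ultimately have "\<phi> 1 \<noteq> -1"
    by (metis Re_complex_of_real neg_0_le_iff_le not_one_le_zero one_complex.simps(1) uminus_complex.simps(1))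
  then have "\<phi> p = 1" using e sq H by auto
  then show ?thesis by (simp add: \<phi>_def)
qed

lemma good_kernel_exp0:
  assumes "good_kernel f"
  shows "integrable lborel (\<lambda>x. exp (- 0 * x) * \<bar>f x\<bar>)"
  using good_kernel_integrable[OF assms] by simp

text \<open>For Re p > 0 this transforms the identity between \<open>mix_kernel\<close>,
  \<open>abel_kernel\<close> and \<open>reg_kernel\<close>. The imaginary axis, where the undamped
  problem lives, is reached by continuity, since only the two integrable kernels appear. At p = 0
  the identity yields total mass 1 for \<open>mix_kernel\<close>.\<close>

lemma laplace_symbol:
  assumes p: "0 \<le> Re p"
  shows "(1 - laplace mix_kernel p) * of_real (sqrt pi) = csqrt p * laplace reg_kernel p"
proof -
  note gl = good_kernelD[OF good_kernel_mix_kernel] and gs = good_kernelD[OF good_kernel_reg_kernel]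
  have pos: "(1 - laplace mix_kernel p) * of_real (sqrt pi) = csqrt p * laplace reg_kernel p" if p: "0 < Re p" for p
  proof -
    have l: "integrable lborel (\<lambda>x. exp (- Re p * x) * \<bar>mix_kernel x\<bar>)"
      using good_kernel_integrable[OF good_kernel_exp[OF good_kernel_mix_kernel, of "Re p"]] p gl(2) by simp
    have "laplace (conv mix_kernel abel_kernel) p = laplace mix_kernel p * laplace abel_kernel p"
      by (rule laplace_conv[where \<delta> = "Re p"]) (use l abel_kernel_exp_integrable[OF p] conv_mix_kernel_abel_kernel(1) abel_kernel_nonpos gl(4) in auto)
    moreover have "conv mix_kernel abel_kernel = (\<lambda>x. abel_kernel x - reg_kernel x)"
      by (rule ext) (rule conv_mix_kernel_abel_kernel(2))
    moreover have "laplace (\<lambda>x. abel_kernel x - reg_kernel x) p = laplace abel_kernel p - laplace reg_kernel p"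
    proof -
      have "integrable lborel (\<lambda>x. abel_kernel x *\<^sub>R exp (- (p * of_real x)))"
        by (rule laplace_integrable(1)[where \<delta> = "Re p"]) (use abel_kernel_exp_integrable[OF p] abel_kernel_nonpos in auto)
      moreover have "integrable lborel (\<lambda>x. reg_kernel x *\<^sub>R exp (- (p * of_real x)))"
        by (rule laplace_integrable(1)[where \<delta> = "0"]) (use good_kernel_exp0[OF good_kernel_reg_kernel] gs(4) p in auto)
      ultimately show ?thesis by (simp add: laplace_def scaleR_diff_left)
    qed
    ultimately have "laplace abel_kernel p * (1 - laplace mix_kernel p) = laplace reg_kernel p" by (simp add: algebra_simps)
    then have "csqrt p * laplace reg_kernel p = (laplace abel_kernel p * csqrt p) * (1 - laplace mix_kernel p)" by simp
    then show ?thesis unfolding laplace_abel_kernel[OF p] by (simp add: mult.commute)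
  qed
  have cl: "continuous_on {p. 0 \<le> Re p} (laplace mix_kernel)"
    by (rule laplace_continuous) (use good_kernel_exp0[OF good_kernel_mix_kernel] gl in auto)
  have cs: "continuous_on {p. 0 \<le> Re p} (laplace reg_kernel)"
    by (rule laplace_continuous) (use good_kernel_exp0[OF good_kernel_reg_kernel] gs in auto)
  define P where "P = (\<lambda>n. p + of_real (inverse (real (Suc n))))"
  have Plim: "P \<longlonglongrightarrow> p"
  proof -
    have "(\<lambda>n. p + of_real (inverse (real (Suc n)))) \<longlonglongrightarrow> p + of_real 0"
      by (intro tendsto_intros LIMSEQ_inverse_real_of_nat)
    then show ?thesis by (simp add: P_def)
  qed
  have Ppos: "0 < Re (P n)" for n using p by (simp add: P_def add_nonneg_pos)
  have cont: "(\<lambda>n. laplace f (P n)) \<longlonglongrightarrow> laplace f p" if "continuous_on {p. 0 \<le> Re p} (laplace f)" for f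
    using continuous_on_tendsto_compose[OF that Plim] p Ppos by (simp add: less_imp_le)
  have 1: "(\<lambda>n. (1 - laplace mix_kernel (P n)) * of_real (sqrt pi)) \<longlonglongrightarrow> (1 - laplace mix_kernel p) * of_real (sqrt pi)"
    by (intro tendsto_intros cont cl)
  have "isCont csqrt p \<or> p = 0"
    using p by (cases "p = 0") (auto intro!: isCont_csqrt' simp: complex_nonpos_Reals_iff complex_eq_iff)
  then have csq: "(\<lambda>n. csqrt (P n)) \<longlonglongrightarrow> csqrt p"
  proof
    assume "isCont csqrt p"
    then show ?thesis using Plim by (rule isCont_tendsto_compose)
  next
    \<comment> \<open>At the branch point continuity is read off from |csqrt z| = sqrt |z|.\<close>
    assume p0: "p = 0"
    have "norm (csqrt z) = sqrt (norm z)" for z :: complex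
      by (metis norm_ge_zero norm_power power2_csqrt real_sqrt_unique)
    moreover have "(\<lambda>n. sqrt (norm (P n))) \<longlonglongrightarrow> sqrt (norm p)"
      by (intro tendsto_intros Plim)
    ultimately have "(\<lambda>n. norm (csqrt (P n))) \<longlonglongrightarrow> 0" using p0 by simp
    then show ?thesis unfolding p0 csqrt_0 by (rule tendsto_norm_zero_cancel)
  qed
  have 2: "(\<lambda>n. csqrt (P n) * laplace reg_kernel (P n)) \<longlonglongrightarrow> csqrt p * laplace reg_kernel p"
    by (intro tendsto_intros cont cs csq)
  have "(\<lambda>n. (1 - laplace mix_kernel (P n)) * of_real (sqrt pi)) = (\<lambda>n. csqrt (P n) * laplace reg_kernel (P n))"
    using pos[OF Ppos] by simp
  then show ?thesis using 1 2 LIMSEQ_unique by metis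
qed

section \<open>Absence of zeros of the regularizing factor\<close>

lemma nonneg_AE_zero_contradiction:
  fixes a :: real
  assumes "0 < a" "AE x in lborel. f x = 0" "\<And>x. 0 < x \<Longrightarrow> x < a \<Longrightarrow> f x \<noteq> (0::real)"
  shows False
proof -
  have "AE x in lborel. x \<notin> {0<..<a}" using assms(2) by eventually_elim (use assms(3) in auto)
  then have "{0<..<a} \<in> null_sets lborel"
    by (subst AE_iff_null_sets) auto
  then show False using assms(1) by (simp add: null_sets_def)
qed

text \<open>A zero at p forces the transform of \<open>mix_kernel\<close> to be 1 there. As that
  kernel is nonnegative of mass 1, the real part of exp (- p x) would have to equal 1 for almost
  every x in its support, which leaves only p = 0. There the transform of \<open>reg_kernel\<close>
  is its integral, which is positive.\<close>

lemma laplace_reg_kernel_nonzero: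
  assumes p: "0 \<le> Re p"
  shows "laplace reg_kernel p \<noteq> 0"
proof
  assume z: "laplace reg_kernel p = 0"
  note gl = good_kernelD[OF good_kernel_mix_kernel] and gs = good_kernelD[OF good_kernel_reg_kernel]
  have one: "laplace mix_kernel p = 1" using laplace_symbol[OF p] z by simp
  have "laplace mix_kernel 0 = 1" using laplace_symbol[of 0] by simp
  moreover have "laplace mix_kernel 0 = of_real (LINT x|lborel. mix_kernel x)"
    by (simp add: laplace_def scaleR_conv_of_real)
  ultimately have L1: "(LINT x|lborel. mix_kernel x) = 1" by (metis of_real_eq_1_iff)
  have ii: "integrable lborel (\<lambda>x. mix_kernel x *\<^sub>R exp (- (p * of_real x)))"
    by (rule laplace_integrable(1)[where \<delta> = "0"]) (use good_kernel_exp0[OF good_kernel_mix_kernel] gl(4) p in auto)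
  define e where "e = (\<lambda>x. exp (- (Re p * x)) * cos (Im p * x))"
  have eR: "Re (mix_kernel x *\<^sub>R exp (- (p * of_real x))) = mix_kernel x * e x" for x
    by (simp add: e_def Re_exp)
  have ie: "integrable lborel (\<lambda>x. mix_kernel x * e x)"
    using integrable_Re[OF ii] unfolding eR .
  have "(LINT x|lborel. mix_kernel x * e x) = 1"
    using integral_Re[OF ii] one unfolding eR laplace_def[symmetric] by simp
  then have I0: "(LINT x|lborel. mix_kernel x * (1 - e x)) = 0"
    using ie L1 good_kernel_integrable[OF good_kernel_mix_kernel] by (simp add: right_diff_distrib)
  have e1: "e x \<le> 1" if "0 \<le> x" for x
  proof -
    have "e x \<le> exp (- (Re p * x)) * 1" unfolding e_def by (intro mult_left_mono) auto
    also have "\<dots> \<le> 1" using p that by simp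
    finally show ?thesis .
  qed
  have nn: "0 \<le> mix_kernel x * (1 - e x)" for x
    using e1[of x] gl(2,4)[of x] by (cases "0 \<le> x") auto
  have "integrable lborel (\<lambda>x. mix_kernel x * (1 - e x))"
    using ie good_kernel_integrable[OF good_kernel_mix_kernel] by (simp add: right_diff_distrib)
  then have ae: "AE x in lborel. mix_kernel x * (1 - e x) = 0"
    using integral_nonneg_eq_0_iff_AE[of lborel "\<lambda>x. mix_kernel x * (1 - e x)"] nn I0 by auto
  show False
  proof (cases "p = 0")
    case False
    show False
    proof (rule nonneg_AE_zero_contradiction[OF _ ae])
      \<comment> \<open>On this interval |Im p| x < 1 < pi, so for Re p = 0 the cosine is strictly
        below 1; adding 1 to the denominator covers Im p = 0.\<close>
      show "0 < 1 / (1 + \<bar>Im p\<bar>)" by (simp add: add_pos_nonneg)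
      fix x assume x: "0 < x" "x < 1 / (1 + \<bar>Im p\<bar>)"
      have small: "\<bar>Im p * x\<bar> < 1"
      proof -
        have "x * (1 + \<bar>Im p\<bar>) < 1" using x by (simp add: pos_less_divide_eq add_pos_nonneg)
        then have "\<bar>Im p\<bar> * x < 1" using x by (simp add: algebra_simps)
        then show ?thesis using x by (simp add: abs_mult)
      qed
      have "e x < 1"
      proof (cases "Re p = 0")
        case True
        with False have "Im p \<noteq> 0" by (simp add: complex_eq_iff)
        then have "0 < \<bar>Im p * x\<bar>" using x by simp
        moreover have "\<bar>Im p * x\<bar> < pi" using small pi_gt3 by linarith
        ultimately have "cos \<bar>Im p * x\<bar> < cos 0" by (intro cos_monotone_0_pi) auto
        then show ?thesis using True by (simp add: e_def cos_abs_real)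
      next
        case nz: False
        have "e x \<le> exp (- (Re p * x)) * 1" unfolding e_def by (intro mult_left_mono) auto
        also have "\<dots> < 1" using p nz x by simp
        finally show ?thesis .
      qed
      moreover have "0 < mix_kernel x" using x by (simp add: mix_kernel_def)
      ultimately show "mix_kernel x * (1 - e x) \<noteq> 0" by simp
    qed
  next
    case True
    have "laplace reg_kernel 0 = of_real (LINT x|lborel. reg_kernel x)"
      by (simp add: laplace_def scaleR_conv_of_real)
    then have "(LINT x|lborel. reg_kernel x) = 0" using z True by simp
    then have "AE x in lborel. reg_kernel x = 0"
      using integral_nonneg_eq_0_iff_AE[OF good_kernel_integrable[OF good_kernel_reg_kernel]] gs(2) by auto
    then show False
      by (rule nonneg_AE_zero_contradiction[of 1, rotated])
        (auto simp: reg_kernel_def)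
  qed
qed

section \<open>The homogeneous equations for the Fourier coefficients\<close>

text \<open>This is the quadratic form of multiplication by a real function, written in Fourier
  coefficients. The involution (n, j) to (n + j, - j) conjugates each term of the double sum, so the
  sum is real. Absolute summability, needed for reindexing, comes from 2 |y n| |y (n + j)| <= |y
  n|^2 + |y (n + j)|^2 and the shift invariance of the square sum.\<close>

lemma energy_form_real:
  fixes c y :: "int \<Rightarrow> complex"
  assumes c: "(\<lambda>n. norm (c n)) summable_on UNIV" and sym: "\<And>n. c n = cnj (c (- n))"
    and y: "(\<lambda>n. (norm (y n))\<^sup>2) summable_on UNIV"
  defines "S \<equiv> \<lambda>n. (\<Sum>\<^sub>\<infinity>j. c j * y (n + j))"
  shows "(\<lambda>n. cnj (y n) * S n) summable_on UNIV" and "Im (\<Sum>\<^sub>\<infinity>n. cnj (y n) * S n) = 0"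
proof -
  define F where "F = (\<lambda>(n, j). cnj (y n) * (c j * y (n + j)))"
  define Y where "Y = (\<Sum>\<^sub>\<infinity>n. (norm (y n))\<^sup>2)"
  have ysh: "((\<lambda>n. (norm (y (n + j)))\<^sup>2) has_sum Y) UNIV" for j
  proof -
    have "((\<lambda>n. (norm (y n))\<^sup>2) has_sum Y) UNIV" using y by (simp add: Y_def has_sum_infsum)
    moreover have "bij_betw (\<lambda>n. n + j) UNIV (UNIV :: int set)"
      by (rule bij_betw_byWitness[where f' = "\<lambda>n. n - j"]) auto
    ultimately show ?thesis
      using has_sum_reindex_bij_betw[of "\<lambda>n. n + j" UNIV UNIV "\<lambda>n. (norm (y n))\<^sup>2" Y] by simp
  qed
  have bd: "norm (F (n, j)) \<le> norm (c j) * (((norm (y n))\<^sup>2 + (norm (y (n + j)))\<^sup>2) / 2)" for n j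
  proof -
    have "norm (y n) * norm (y (n + j)) \<le> ((norm (y n))\<^sup>2 + (norm (y (n + j)))\<^sup>2) / 2"
      using sum_squares_bound[of "norm (y n)" "norm (y (n + j))"] by simp
    then have "norm (c j) * (norm (y n) * norm (y (n + j))) \<le> norm (c j) * (((norm (y n))\<^sup>2 + (norm (y (n + j)))\<^sup>2) / 2)"
      by (intro mult_left_mono) auto
    then show ?thesis by (simp add: F_def norm_mult mult_ac)
  qed
  have G: "((\<lambda>n. norm (c j) * (((norm (y n))\<^sup>2 + (norm (y (n + j)))\<^sup>2) / 2)) has_sum norm (c j) * Y) UNIV" for j
  proof -
    have "((\<lambda>n. (norm (y n))\<^sup>2 + (norm (y (n + j)))\<^sup>2) has_sum (Y + Y)) UNIV"
      using ysh[of 0] ysh[of j] by (intro has_sum_add) auto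
    from has_sum_cmult_right[OF this, of "norm (c j) / 2"] show ?thesis by (simp add: field_simps)
  qed
  have "(\<lambda>(j, n). norm (c j) * (((norm (y n))\<^sup>2 + (norm (y (n + j)))\<^sup>2) / 2)) summable_on (UNIV \<times> UNIV)"
    by (rule summable_on_SigmaI[where g = "\<lambda>j. norm (c j) * Y"])
      (use G c in \<open>auto intro: summable_on_cmult_left\<close>)
  then have "(\<lambda>(j, n). norm (F (n, j))) summable_on (UNIV \<times> UNIV)"
    by (rule summable_on_comparison_test) (use bd in auto)
  then have "(\<lambda>x. norm (F x)) summable_on (UNIV \<times> UNIV)"
    using summable_on_reindex_bij_betw[of prod.swap "UNIV \<times> UNIV" "UNIV \<times> UNIV" "\<lambda>(j, n). norm (F (n, j))"]
    by (simp add: case_prod_unfold)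
  then have sF: "F summable_on (UNIV \<times> UNIV)" by (rule abs_summable_summable)
  have inner: "(\<Sum>\<^sub>\<infinity>j. F (n, j)) = cnj (y n) * S n" for n
    by (simp add: F_def S_def infsum_cmult_right')
  show sum: "(\<lambda>n. cnj (y n) * S n) summable_on UNIV"
    using summable_on_Sigma_banach[of "\<lambda>n j. F (n, j)" UNIV "\<lambda>_. UNIV"] sF unfolding inner[symmetric]
    by (simp add: case_prod_unfold)
  have tot: "(\<Sum>\<^sub>\<infinity>n. cnj (y n) * S n) = infsum F (UNIV \<times> UNIV)"
    unfolding inner[symmetric] using infsum_Sigma'_banach[of "\<lambda>n j. F (n, j)" UNIV "\<lambda>_. UNIV"] sF
    by (simp add: case_prod_unfold)
  define \<tau> where "\<tau> = (\<lambda>(n::int, j::int). (n + j, - j))"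
  have "bij_betw \<tau> (UNIV \<times> UNIV) (UNIV \<times> UNIV)"
    by (rule bij_betw_byWitness[where f' = \<tau>]) (auto simp: \<tau>_def)
  then have "infsum F (UNIV \<times> UNIV) = infsum (\<lambda>x. F (\<tau> x)) (UNIV \<times> UNIV)"
    by (rule infsum_reindex_bij_betw[symmetric])
  also have "(\<lambda>x. F (\<tau> x)) = (\<lambda>x. cnj (F x))"
  proof (rule ext)
    fix x :: "int \<times> int"
    obtain n j where x: "x = (n, j)" by (cases x)
    have "c (- j) = cnj (c j)" using sym[of "- j"] by simp
    then show "F (\<tau> x) = cnj (F x)" by (simp add: x F_def \<tau>_def)
  qed
  also have "infsum (\<lambda>x. cnj (F x)) (UNIV \<times> UNIV) = cnj (infsum F (UNIV \<times> UNIV))"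
    by simp
  finally show "Im (\<Sum>\<^sub>\<infinity>n. cnj (y n) * S n) = 0"
    unfolding tot by (metis cnj.simps(2) neg_equal_zero)
qed

text \<open>Duality: the bounded sequence y is a continuous functional on the summable sequences. It
  vanishes on all shifts of the coefficients, hence on their closed span, and genericity puts the
  first unit vector into that span.\<close>

lemma generic_annihilator:
  fixes y :: "nat \<Rightarrow> complex"
  assumes gen: "generic c" and c: "(\<lambda>n. norm (c n)) summable_on UNIV"
    and Y: "\<And>n. norm (y n) \<le> Y"
    and ann: "\<And>m. (\<lambda>j. c (int (j + m + 1)) * y j) sums 0"
  shows "y 0 = 0"
proof -
  have Y0: "0 \<le> Y" using order_trans[OF norm_ge_zero Y] .
  have sh: "summable (\<lambda>j. norm (c (int (j + k + 1))))" for k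
  proof -
    have "(\<lambda>n. norm (c n)) summable_on range (\<lambda>j. int (j + k + 1))"
      using c by (rule summable_on_subset_banach) simp
    then have "(\<lambda>j. norm (c (int (j + k + 1)))) summable_on UNIV"
      by (subst (asm) summable_on_reindex) (auto simp: inj_on_def o_def)
    then show ?thesis by (rule summable_on_UNIV_nonneg_real_iff[THEN iffD1, rotated]) auto
  qed
  have "norm (y 0) \<le> Y * \<epsilon>" if e: "0 < \<epsilon>" for \<epsilon>
  proof -
    from gen e obtain m b where mb: "(\<Sum>j. norm ((if j = 0 then 1 else 0) - (\<Sum>k<m. b k * c (int (j + k + 1))))) < \<epsilon>"
      unfolding generic_def by blast
    define d where "d = (\<lambda>j. (if j = 0 then 1 else 0) - (\<Sum>k<m. b k * c (int (j + k + 1))))"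
    \<comment> \<open>The sum of a divergent series has a default value, so the bound by \<epsilon>
      in \<open>generic\<close> carries information only once absolute summability of
      \<open>d\<close> is known.\<close>
    have sd: "summable (\<lambda>j. norm (d j))"
    proof (rule summable_comparison_test')
      have "summable (\<lambda>j. if j = 0 then 1 else (0::real))" 
        by (rule summable_finite[of "{0}"]) auto
      then show "summable (\<lambda>j. (if j = 0 then 1 else 0) + (\<Sum>k<m. norm (b k) * norm (c (int (j + k + 1)))))"
        by (intro summable_add summable_sum summable_mult sh)
      show "norm (norm (d j)) \<le> (if j = 0 then 1 else 0) + (\<Sum>k<m. norm (b k) * norm (c (int (j + k + 1))))" for j
      proof -
        have "norm (d j) \<le> norm (if j = 0 then 1 else (0::complex)) + norm (\<Sum>k<m. b k * c (int (j + k + 1)))"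
          unfolding d_def by (rule norm_triangle_ineq4)
        also have "norm (\<Sum>k<m. b k * c (int (j + k + 1))) \<le> (\<Sum>k<m. norm (b k) * norm (c (int (j + k + 1))))"
          unfolding norm_mult[symmetric] by (rule norm_sum)
        finally show ?thesis by (simp split: if_splits)
      qed
    qed
    have "(\<lambda>j. (if j = 0 then 1 else 0) * y j) sums ((if (0::nat) = 0 then 1 else 0) * y 0)"
      using sums_finite[of "{0}" "\<lambda>j. (if j = 0 then 1 else 0) * y j"] by simp
    then have "(\<lambda>j. (if j = 0 then 1 else 0) * y j - (\<Sum>k<m. b k * (c (int (j + k + 1)) * y j))) sums (y 0 - (\<Sum>k<m. b k * 0))"
      by (intro sums_diff sums_sum sums_mult ann) simp
    moreover have "(\<lambda>j. (if j = 0 then 1 else 0) * y j - (\<Sum>k<m. b k * (c (int (j + k + 1)) * y j))) = (\<lambda>j. d j * y j)"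
      by (rule ext) (simp add: d_def left_diff_distrib sum_distrib_right mult.assoc)
    ultimately have s: "(\<lambda>j. d j * y j) sums y 0" by simp
    have nb: "norm (d j * y j) \<le> norm (d j) * Y" for j
      using Y by (simp add: norm_mult mult_left_mono)
    have "norm (y 0) \<le> (\<Sum>j. norm (d j) * Y)"
      unfolding sums_unique[OF s]
      by (rule norm_suminf_le[OF nb summable_mult2[OF sd]])
    also have "\<dots> = (\<Sum>j. norm (d j)) * Y" by (rule suminf_mult2[OF sd, symmetric])
    also have "\<dots> \<le> \<epsilon> * Y" using mb Y0 unfolding d_def by (intro mult_right_mono) auto
    finally show ?thesis by (simp add: mult.commute)
  qed
  then have "norm (y 0) \<le> 0"
  proof -
    assume *: "\<And>\<epsilon>. 0 < \<epsilon> \<Longrightarrow> norm (y 0) \<le> Y * \<epsilon>"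
    show ?thesis
    proof (rule field_le_epsilon)
      fix e :: real assume "0 < e"
      \<comment> \<open>Dividing by Y + 1 instead of Y covers Y = 0.\<close>
      then have "norm (y 0) \<le> Y * (e / (Y + 1))" using Y0 by (intro *) auto
      also have "\<dots> \<le> e" using Y0 \<open>0 < e\<close> by (simp add: field_simps)
      finally show "norm (y 0) \<le> 0 + e" by simp
    qed
  qed
  then show ?thesis by simp
qed

text \<open>Dissipation at negative frequencies kills the coefficients with negative index; genericity
  then propagates the vanishing upwards one index at a time.\<close>
lemma generic_kernel_trivial:
  fixes c y \<mu> :: "int \<Rightarrow> complex"
  assumes gen: "generic c" and c: "(\<lambda>n. norm (c n)) summable_on UNIV" and sym: "\<And>n. c n = cnj (c (- n))"
    and y: "(\<lambda>n. (norm (y n))\<^sup>2) summable_on UNIV" and Y: "\<And>n. norm (y n) \<le> Y"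
    and D: "0 < D" and eq: "\<And>n. \<mu> n * y n = - (of_real D * (\<Sum>\<^sub>\<infinity>j. c j * y (n + j)))"
    and mu: "\<And>n. Im (\<mu> n) \<le> 0" and mu_neg: "\<And>n. n < 0 \<Longrightarrow> Im (\<mu> n) < 0"
  shows "y n = 0"
proof -
  define S where "S = (\<lambda>n. (\<Sum>\<^sub>\<infinity>j. c j * y (n + j)))"
  have S_app: "(\<Sum>\<^sub>\<infinity>j. c j * y (n + j)) = S n" for n by (simp add: S_def)
  note en = energy_form_real[OF c sym y, unfolded S_app]
  \<comment> \<open>The equation is tested against y n. By the sign condition on \<mu> each of these
    imaginary parts is nonnegative, while their sum is 0 by \<open>energy_form_real\<close>; so each
    one vanishes.\<close>
  have im: "Im (cnj (y n) * S n) = - Im (\<mu> n) * (norm (y n))\<^sup>2 / D" for n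
  proof -
    have "of_real D * (cnj (y n) * S n) = - (\<mu> n * (y n * cnj (y n)))"
    proof -
      have "of_real D * S n = - (\<mu> n * y n)" using eq[of n] by (simp add: S_def)
      then have "cnj (y n) * (of_real D * S n) = cnj (y n) * (- (\<mu> n * y n))" by simp
      then show ?thesis by (simp add: mult_ac)
    qed
    also have "\<dots> = - (\<mu> n * of_real ((norm (y n))\<^sup>2))"
      by (simp only: complex_norm_square)
    finally have fin: "Im (of_real D * (cnj (y n) * S n)) = - Im (\<mu> n) * (norm (y n))\<^sup>2" by simp
    have Imw: "Im (of_real D * w) = D * Im w" for w by simp
    have "D * Im (cnj (y n) * S n) = - Im (\<mu> n) * (norm (y n))\<^sup>2"
      using fin unfolding Imw .
    then show ?thesis using D by (simp add: field_simps)
  qed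
  have nn: "0 \<le> Im (cnj (y n) * S n)" for n
    unfolding im using mu[of n] D by (intro divide_nonneg_pos mult_nonneg_nonneg) auto
  have ims: "((\<lambda>n. Im (cnj (y n) * S n)) has_sum 0) UNIV"
    using has_sum_Im[OF has_sum_infsum[OF en(1)]] en(2) by simp
  have im0: "Im (cnj (y n) * S n) = 0" for n
    using nonneg_infsum_le_0D[of "\<lambda>n. Im (cnj (y n) * S n)" UNIV n] ims nn
    by (auto simp: infsumI has_sum_imp_summable)
  have neg: "y n = 0" if "n < 0" for n
    using im[of n] im0[of n] mu_neg[OF that] D by auto
  have csum: "(\<lambda>j. c j * y (n + j)) summable_on UNIV" for n
  proof -
    have "(\<lambda>j. norm (c j) * Y) summable_on UNIV" using c by (rule summable_on_cmult_left)
    then have "(\<lambda>j. norm (c j * y (n + j))) summable_on UNIV"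
      by (rule summable_on_comparison_test) (auto simp: norm_mult intro!: mult_left_mono Y)
    then show ?thesis by (rule abs_summable_summable)
  qed
  have zero: "y (int N) = 0" for N
  proof (induction N rule: less_induct)
    case (less N)
    have below: "y n = 0" if "n < int N" for n
    proof (cases "n < 0")
      case False
      then show ?thesis using less[of "nat n"] that by auto
    qed (rule neg)
    have "(\<lambda>i. y (int N + int i)) 0 = 0"
    proof (rule generic_annihilator[OF gen c])
      show "norm (y (int N + int n)) \<le> Y" for n by (rule Y)
      fix m :: nat
      \<comment> \<open>In the equation with index n < N the left side is already 0, and the sum
        involves only y (n + j) with n + j >= N, that is j >= m + 1. This pairs the m-th shift of
        the coefficients with the sequence y N, y (N + 1), and so on.\<close>
      define n where "n = int N - 1 - int m"
      have "S n = 0" using eq[of n] below[of n] D by (simp add: n_def S_def)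
      then have hs: "((\<lambda>j. c j * y (n + j)) has_sum 0) UNIV"
        using has_sum_infsum[OF csum[of n]] by (simp add: S_def)
      have "((\<lambda>j. c j * y (n + j)) has_sum 0) (range (\<lambda>j. int (j + m + 1)))"
      proof (rule has_sum_cong_neutral[THEN iffD1, rotated 3, OF hs])
        fix x assume "x \<in> UNIV - range (\<lambda>j. int (j + m + 1))"
        then have "x < int m + 1"
        proof -
          have "x \<noteq> int (nat (x - int m - 1) + m + 1)" using \<open>x \<in> _\<close> by blast
          then show ?thesis by linarith
        qed
        then have "n + x < int N" by (simp add: n_def)
        then show "c x * y (n + x) = 0" using below by simp
      qed auto
      then have "((\<lambda>j. c (int (j + m + 1)) * y (n + int (j + m + 1))) has_sum 0) UNIV"
        by (subst (asm) has_sum_reindex) (auto simp: inj_on_def o_def)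
      then have "(\<lambda>j. c (int (j + m + 1)) * y (n + int (j + m + 1))) sums 0"
        by (rule has_sum_imp_sums)
      moreover have "n + int (j + m + 1) = int N + int j" for j by (simp add: n_def)
      ultimately show "(\<lambda>j. c (int (j + m + 1)) * y (int N + int j)) sums 0" by (simp only:)
    qed
    then show ?case by simp
  qed
  show ?thesis
  proof (cases "n < 0")
    case False
    then show ?thesis using zero[of "nat n"] by simp
  qed (rule neg)
qed

section \<open>Fourier coefficients of Bloch functions\<close>

text \<open>Conjugate of the Bloch wave with quasi-frequency \<sigma> and index n. The coefficients
  below carry no factor 1/T, so T appears in the orthogonality relation and in the bounds
  instead.\<close>

definition bloch_exp :: "real \<Rightarrow> real \<Rightarrow> int \<Rightarrow> real \<Rightarrow> complex" where
  "bloch_exp T \<sigma> n t = exp (- (\<i> * of_real ((\<sigma> + 2 * pi * of_int n / T) * t)))"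

definition bloch_coeff :: "real \<Rightarrow> real \<Rightarrow> (real \<Rightarrow> complex) \<Rightarrow> int \<Rightarrow> complex" where
  "bloch_coeff T \<sigma> y n = (LINT t:{0..T}|lborel. y t * bloch_exp T \<sigma> n t)"

lemma norm_bloch_exp [simp]: "norm (bloch_exp T \<sigma> n t) = 1"
  by (simp add: bloch_exp_def norm_exp_eq_Re)

lemma continuous_bloch_exp [continuous_intros]: "continuous_on S (bloch_exp T \<sigma> n)"
  unfolding bloch_exp_def by (intro continuous_intros)

lemma measurable_bloch_exp [measurable]: "bloch_exp T \<sigma> n \<in> borel_measurable borel"
  by (intro borel_measurable_continuous_onI continuous_bloch_exp)

lemma exp_minus_i_add:
  "exp (- (\<i> * of_real (a + b))) = exp (- (\<i> * of_real a)) * exp (- (\<i> * of_real b))"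
  by (simp add: distrib_left flip: exp_add)

lemma bloch_exp_diff: "bloch_exp T \<sigma> n t = bloch_exp T \<sigma> n x * bloch_exp T \<sigma> n (t - x)"
proof -
  have "(\<sigma> + 2 * pi * of_int n / T) * t = (\<sigma> + 2 * pi * of_int n / T) * x + (\<sigma> + 2 * pi * of_int n / T) * (t - x)"
    by (simp flip: distrib_left)
  then show ?thesis unfolding bloch_exp_def exp_minus_i_add[symmetric] by (simp only:)
qed

lemma bloch_exp_add_index: "bloch_exp T \<sigma> (n + j) t = exp (- \<i> * of_int j * of_real (2 * pi / T) * of_real t) * bloch_exp T \<sigma> n t"
  by (simp add: bloch_exp_def algebra_simps add_divide_distrib flip: exp_add)

lemma bloch_exp_period:
  assumes "0 < T"
  shows "bloch_exp T \<sigma> n (t + T) = exp (- (\<i> * of_real (\<sigma> * T))) * bloch_exp T \<sigma> n t"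
proof -
  have "(\<sigma> + 2 * pi * of_int n / T) * (t + T) = \<sigma> * T + (\<sigma> + 2 * pi * of_int n / T) * t + 2 * pi * of_int n"
    using assms by (simp add: field_simps)
  moreover have "exp (- (\<i> * of_real (2 * pi * of_int n))) = 1"
    using exp_integer_2pi[of "of_int n"] by (simp add: mult_ac exp_minus)
  ultimately show ?thesis unfolding bloch_exp_def by (simp only: exp_minus_i_add mult_1_right)
qed

lemma set_integrable_Icc_continuous:
  fixes f :: "real \<Rightarrow> complex"
  assumes "continuous_on UNIV f"
  shows "set_integrable lborel {a..b} f"
  by (rule borel_integrable_atLeastAtMost') (rule continuous_on_subset[OF assms], simp)

lemma bloch_exp_orthogonal:
  assumes T: "0 < T"
  shows "(LINT t:{0..T}|lborel. bloch_exp T \<sigma> n t * cnj (bloch_exp T \<sigma> m t)) = (if n = m then of_real T else 0)"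
proof (cases "n = m")
  case True
  have "bloch_exp T \<sigma> n t * cnj (bloch_exp T \<sigma> n t) = 1" for t
    using complex_norm_square[of "bloch_exp T \<sigma> n t"] by simp
  then show ?thesis using True T
    by (simp add: set_lebesgue_integral_def scaleR_conv_of_real)
next
  case False
  define k where "k = 2 * pi * of_int (m - n) / T"
  have k0: "k \<noteq> 0" using False T by (simp add: k_def)
  have e: "bloch_exp T \<sigma> n t * cnj (bloch_exp T \<sigma> m t) = exp (\<i> * of_real k * of_real t)" for t
  proof -
    have "cnj (bloch_exp T \<sigma> m t) = exp (- (\<i> * of_real (- ((\<sigma> + 2 * pi * of_int m / T) * t))))"
      by (simp add: bloch_exp_def exp_cnj)
    then have "bloch_exp T \<sigma> n t * cnj (bloch_exp T \<sigma> m t)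
       = exp (- (\<i> * of_real ((\<sigma> + 2 * pi * of_int n / T) * t + - ((\<sigma> + 2 * pi * of_int m / T) * t))))"
      by (simp only: bloch_exp_def exp_minus_i_add)
    also have "(\<sigma> + 2 * pi * of_int n / T) * t + - ((\<sigma> + 2 * pi * of_int m / T) * t) = - (k * t)"
      using T by (simp add: k_def field_simps)
    finally show ?thesis by (simp add: mult.assoc)
  qed
  have der: "((\<lambda>t. exp (\<i> * of_real k * of_real t) / (\<i> * of_real k)) has_vector_derivative exp (\<i> * of_real k * of_real t)) (at t within A)" for t A
  proof -
    have "((\<lambda>z. exp (\<i> * of_real k * z) / (\<i> * of_real k)) has_field_derivative exp (\<i> * of_real k * of_real t)) (at (of_real t))"
      using k0 by (auto intro!: derivative_eq_intros)
    from has_vector_derivative_real_field[OF this] show ?thesis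
      by (auto simp: o_def intro: has_vector_derivative_at_within)
  qed
  have "(LINT t:{0..T}|lborel. exp (\<i> * of_real k * of_real t))
      = exp (\<i> * of_real k * of_real T) / (\<i> * of_real k) - exp (\<i> * of_real k * of_real 0) / (\<i> * of_real k)"
    unfolding set_lebesgue_integral_def
    by (rule integral_FTC_atLeastAtMost) (use T der in \<open>auto intro!: continuous_intros\<close>)
  also have "exp (\<i> * of_real k * of_real T) = 1"
    using exp_integer_2pi[of "of_int (m - n)"] T by (simp add: k_def mult_ac)
  finally show ?thesis using False by (simp add: e)
qed

text \<open>For an antiderivative \<open>\<Phi>\<close> the function
  \<open>\<Phi> (s + T) - \<Phi> s\<close> has derivative 0 by periodicity, so integrals over
  windows of length T agree.\<close>

lemma periodic_integral_shift:
  fixes g :: "real \<Rightarrow> complex"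
  assumes T: "0 < T" and g: "continuous_on UNIV g" and per: "\<And>t. g (t + T) = g t"
  shows "(LINT t:{0..T}|lborel. g (t - x)) = (LINT t:{0..T}|lborel. g t)"
proof -
  \<comment> \<open>The interval covers all arguments between -|x| and |x| + T with a margin of 1,
    so that every point used is interior and has a two-sided derivative.\<close>
  define a b where "a = - \<bar>x\<bar> - 1" and "b = \<bar>x\<bar> + T + 1"
  obtain \<Phi> where \<Phi>: "\<And>s. s \<in> {a..b} \<Longrightarrow> (\<Phi> has_vector_derivative g s) (at s within {a..b})"
    using antiderivative_continuous[OF continuous_on_subset[OF g], of a b] by auto
  have \<Phi>': "(\<Phi> has_vector_derivative g s) (at s)" if "a < s" "s < b" for s
    using \<Phi>[of s] that by (simp add: at_within_Icc_at)
  have "((\<lambda>s. \<Phi> (s + T) - \<Phi> s) has_derivative (\<lambda>h. 0)) (at s within {- \<bar>x\<bar>..\<bar>x\<bar>})" if s: "s \<in> {- \<bar>x\<bar>..\<bar>x\<bar>}" for s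
  proof -
    have "((\<Phi> \<circ> (\<lambda>s. s + T)) has_vector_derivative (1 *\<^sub>R g (s + T))) (at s)"
      by (rule vector_diff_chain_at) (use s T in \<open>auto intro!: \<Phi>' derivative_eq_intros simp: a_def b_def\<close>)
    moreover have "(\<Phi> has_vector_derivative g s) (at s)"
      using s T by (intro \<Phi>') (auto simp: a_def b_def)
    ultimately have "((\<lambda>s. \<Phi> (s + T) - \<Phi> s) has_vector_derivative (1 *\<^sub>R g (s + T) - g s)) (at s)"
      by (intro has_vector_derivative_diff) (auto simp: o_def)
    then show ?thesis using per by (simp add: has_vector_derivative_def has_derivative_at_withinI)
  qed
  then obtain c where c: "\<And>s. s \<in> {- \<bar>x\<bar>..\<bar>x\<bar>} \<Longrightarrow> \<Phi> (s + T) - \<Phi> s = c"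
    using has_derivative_zero_constant[of "{- \<bar>x\<bar>..\<bar>x\<bar>}" "\<lambda>s. \<Phi> (s + T) - \<Phi> s"] by auto
  have eq: "\<Phi> (- x + T) - \<Phi> (- x) = \<Phi> (0 + T) - \<Phi> 0"
    using c[of "- x"] c[of 0] abs_ge_self[of x] abs_ge_minus_self[of x] by simp
  have ftc: "(LINT t:{u..v}|lborel. g t) = \<Phi> v - \<Phi> u" if "a < u" "u \<le> v" "v < b" for u v
    unfolding set_lebesgue_integral_def
  proof (rule integral_FTC_atLeastAtMost[OF that(2)])
    fix s assume "u \<le> s" "s \<le> v"
    then have "(\<Phi> has_vector_derivative g s) (at s)" using that by (intro \<Phi>') auto
    then show "(\<Phi> has_vector_derivative g s) (at s within {u..v})" by (rule has_vector_derivative_at_within)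
  qed (rule continuous_on_subset[OF g], simp)
  have "(LINT t:{0..T}|lborel. g (t - x)) = (LINT s:{- x..- x + T}|lborel. g s)"
  proof -
    have "(LINT s:{- x..- x + T}|lborel. g s) = (LINT t|lborel. indicator {- x..- x + T} (- x + 1 * t) *\<^sub>R g (- x + 1 * t))"
      unfolding set_lebesgue_integral_def by (subst lborel_integral_real_affine[of 1 _ "- x"]) auto
    also have "\<dots> = (LINT t:{0..T}|lborel. g (t - x))"
      unfolding set_lebesgue_integral_def by (intro Bochner_Integration.integral_cong) (auto simp: indicator_def)
    finally show ?thesis by simp
  qed
  also have "\<dots> = \<Phi> (- x + T) - \<Phi> (- x)" by (rule ftc) (use T in \<open>auto simp: a_def b_def\<close>)
  also have "\<dots> = (LINT t:{0..T}|lborel. g t)"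
    unfolding eq using ftc[of 0 T] T by (simp add: a_def b_def)
  finally show ?thesis .
qed

text \<open>The product of y with \<open>bloch_exp\<close> is T-periodic, so translating y by x only
  multiplies the coefficient by \<open>bloch_exp\<close> at x. Integrating that factor against f
  gives the Laplace transform on the imaginary axis.\<close>

lemma bloch_coeff_conv:
  assumes T: "0 < T" and f: "good_kernel f"
    and y: "continuous_on UNIV y" and B: "\<And>t. norm (y t) \<le> B"
    and per: "\<And>t. y (t + T) = exp (\<i> * of_real (\<sigma> * T)) * y t"
  shows "bloch_coeff T \<sigma> (conv f y) n = laplace f (\<i> * of_real (\<sigma> + 2 * pi * of_int n / T)) * bloch_coeff T \<sigma> y n"
proof -
  note [measurable] = good_kernelD(1)[OF f]
  have [measurable]: "y \<in> borel_measurable borel" using y by (rule borel_measurable_continuous_onI)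
  have B0: "0 \<le> B" using order_trans[OF norm_ge_zero B] .
  define P where "P = (\<lambda>t x. indicator {0..T} t *\<^sub>R (f x *\<^sub>R (y (t - x) * bloch_exp T \<sigma> n t)))"
  have int: "integrable (lborel \<Otimes>\<^sub>M lborel) (case_prod P)"
  proof (rule integrableI_bounded)
    show "case_prod P \<in> borel_measurable (lborel \<Otimes>\<^sub>M lborel)" unfolding P_def by measurable
    have "(\<integral>\<^sup>+ z. ennreal (norm (case_prod P z)) \<partial>(lborel \<Otimes>\<^sub>M lborel)) = (\<integral>\<^sup>+t. \<integral>\<^sup>+x. ennreal (norm (P t x)) \<partial>lborel \<partial>lborel)"
      by (subst lborel.nn_integral_fst[symmetric]) (auto simp: P_def)
    also have "\<dots> \<le> (\<integral>\<^sup>+t. \<integral>\<^sup>+x. ennreal (indicator {0..T} t * B) * ennreal (f x) \<partial>lborel \<partial>lborel)"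
    proof (intro nn_integral_mono)
      fix t x :: real
      have "f x * norm (y (t - x)) \<le> f x * B" using good_kernelD(2)[OF f] B by (intro mult_left_mono)
      then show "ennreal (norm (P t x)) \<le> ennreal (indicator {0..T} t * B) * ennreal (f x)"
        using good_kernelD(2)[OF f] B0
        by (auto simp: P_def norm_mult indicator_def ennreal_mult'[symmetric] mult.commute intro!: ennreal_leI)
    qed
    also have "\<dots> = (\<integral>\<^sup>+t. ennreal (indicator {0..T} t * B) \<partial>lborel) * (\<integral>\<^sup>+x. ennreal (f x) \<partial>lborel)"
      by (simp add: nn_integral_cmult nn_integral_multc)
    also have "\<dots> < \<infinity>"
    proof -
      have "integrable lborel (\<lambda>t. indicator {0..T} t * B)"
        by (intro integrable_mult_left integrable_real_indicator) (use T in auto)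
      then have "(\<integral>\<^sup>+t. ennreal (indicator {0..T} t * B) \<partial>lborel) < \<infinity>"
        using B0 by (subst nn_integral_eq_integral) auto
      moreover have "(\<integral>\<^sup>+x. ennreal (f x) \<partial>lborel) < \<infinity>"
        using good_kernel_integrable[OF f] good_kernelD(2)[OF f] by (simp add: integrable_iff_bounded)
      ultimately show ?thesis by (simp add: ennreal_mult_less_top)
    qed
    finally show "(\<integral>\<^sup>+ z. ennreal (norm (case_prod P z)) \<partial>(lborel \<Otimes>\<^sub>M lborel)) < \<infinity>" .
  qed
  have "bloch_coeff T \<sigma> (conv f y) n = (LINT t|lborel. LINT x|lborel. P t x)"
    unfolding bloch_coeff_def set_lebesgue_integral_def
  proof (rule Bochner_Integration.integral_cong[OF refl])
    fix t :: real
    have "(LINT x|lborel. P t x) = indicator {0..T} t *\<^sub>R (LINT x|lborel. (f x *\<^sub>R y (t - x)) * bloch_exp T \<sigma> n t)"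
      unfolding P_def integral_scaleR_right by simp
    then show "indicator {0..T} t *\<^sub>R (conv f y t * bloch_exp T \<sigma> n t) = (LINT x|lborel. P t x)"
      unfolding conv_def integral_mult_left_zero by simp
  qed
  also have "\<dots> = (LINT x|lborel. LINT t|lborel. P t x)"
    using lborel_pair.Fubini_integral[OF int] by simp
  also have "\<dots> = (LINT x|lborel. (f x *\<^sub>R bloch_exp T \<sigma> n x) * bloch_coeff T \<sigma> y n)"
  proof (rule Bochner_Integration.integral_cong[OF refl])
    fix x :: real
    define g where "g = (\<lambda>t. y t * bloch_exp T \<sigma> n t)"
    have gp: "g (t + T) = g t" for t
      unfolding g_def per bloch_exp_period[OF T] by (simp flip: exp_add)
    have gc: "continuous_on UNIV g" unfolding g_def by (intro continuous_intros y)
    have "(LINT t|lborel. P t x) = (LINT t|lborel. (f x *\<^sub>R bloch_exp T \<sigma> n x) * (indicator {0..T} t *\<^sub>R g (t - x)))"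
    proof (rule Bochner_Integration.integral_cong[OF refl])
      fix t
      show "P t x = (f x *\<^sub>R bloch_exp T \<sigma> n x) * (indicator {0..T} t *\<^sub>R g (t - x))"
        unfolding P_def g_def bloch_exp_diff[of T \<sigma> n t x] by (simp add: mult_ac)
    qed
    also have "\<dots> = (f x *\<^sub>R bloch_exp T \<sigma> n x) * (LINT t:{0..T}|lborel. g (t - x))"
      unfolding set_lebesgue_integral_def by (rule integral_mult_right_zero)
    also have "\<dots> = (f x *\<^sub>R bloch_exp T \<sigma> n x) * bloch_coeff T \<sigma> y n"
      using periodic_integral_shift[OF T gc gp, of x] by (simp only: bloch_coeff_def g_def)
    finally show "(LINT t|lborel. P t x) = (f x *\<^sub>R bloch_exp T \<sigma> n x) * bloch_coeff T \<sigma> y n" .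
  qed
  also have "\<dots> = (LINT x|lborel. f x *\<^sub>R bloch_exp T \<sigma> n x) * bloch_coeff T \<sigma> y n"
    by (rule integral_mult_left_zero)
  also have "(LINT x|lborel. f x *\<^sub>R bloch_exp T \<sigma> n x) = laplace f (\<i> * of_real (\<sigma> + 2 * pi * of_int n / T))"
    unfolding laplace_def bloch_exp_def by (simp add: mult_ac)
  finally show ?thesis .
qed

lemma laplace_exp_shift: "laplace (\<lambda>x. exp (- \<gamma> * x) * f x) p = laplace f (of_real \<gamma> + p)"
  unfolding laplace_def
  by (intro Bochner_Integration.integral_cong)
    (auto simp: scaleR_conv_of_real exp_of_real[symmetric] distrib_right exp_diff exp_minus field_simps simp flip: exp_add)

lemma bloch_coeff_bound:
  assumes T: "0 < T" and y: "y \<in> borel_measurable borel" and B: "\<And>t. norm (y t) \<le> B"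
  shows "norm (bloch_coeff T \<sigma> y n) \<le> T * B"
proof -
  have B0: "0 \<le> B" using order_trans[OF norm_ge_zero B] .
  have I: "integrable lborel (\<lambda>t. indicator {0..T} t * B)"
    by (intro integrable_mult_left integrable_real_indicator) (use T in auto)
  have "norm (bloch_coeff T \<sigma> y n) \<le> (LINT t|lborel. indicator {0..T} t * B)"
    unfolding bloch_coeff_def set_lebesgue_integral_def
  proof (rule Bochner_Integration.integral_norm_bound_integral[OF _ I])
    show "integrable lborel (\<lambda>t. indicator {0..T} t *\<^sub>R (y t * bloch_exp T \<sigma> n t))"
      by (rule Bochner_Integration.integrable_bound[OF I])
        (use y B B0 in \<open>auto simp: indicator_def norm_mult\<close>)
    show "norm (indicator {0..T} t *\<^sub>R (y t * bloch_exp T \<sigma> n t)) \<le> indicator {0..T} t * B" for t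
      using B by (simp add: indicator_def norm_mult)
  qed
  also have "\<dots> = T * B" using T by simp
  finally show ?thesis .
qed

text \<open>Bessel's inequality by testing y against the trigonometric polynomial \<open>g\<close>
  with the conjugate coefficients. Its pairing with y is the partial sum s and its square integral
  is T s, which leads to s <= (T^2 B^2 + s) / 2.\<close>

lemma bloch_coeff_Bessel:
  assumes T: "0 < T" and y: "continuous_on UNIV y" and B: "\<And>t. norm (y t) \<le> B"
  shows "(\<lambda>n. (norm (bloch_coeff T \<sigma> y n))\<^sup>2) summable_on UNIV"
proof (rule nonneg_bounded_partial_sums_imp_summable_on)
  fix n show "0 \<le> (norm (bloch_coeff T \<sigma> y n))\<^sup>2" by simp
next
  show "\<forall>\<^sub>F F in finite_subsets_at_top UNIV. (\<Sum>n\<in>F. (norm (bloch_coeff T \<sigma> y n))\<^sup>2) \<le> T\<^sup>2 * B\<^sup>2"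
  proof (rule eventually_finite_subsets_at_top_weakI)
    fix F :: "int set" assume F: "finite F"
    define a where "a = (\<lambda>n. cnj (bloch_coeff T \<sigma> y n))"
    define s where "s = (\<Sum>n\<in>F. (norm (bloch_coeff T \<sigma> y n))\<^sup>2)"
    define g where "g = (\<lambda>t. \<Sum>n\<in>F. a n * bloch_exp T \<sigma> n t)"
    have gc: "continuous_on UNIV g" unfolding g_def by (intro continuous_intros)
    have I: "set_integrable lborel {0..T} f" if "continuous_on UNIV f" for f :: "real \<Rightarrow> complex"
      by (rule set_integrable_Icc_continuous[OF that])
    have Ir: "set_integrable lborel {0..T} f" if "continuous_on UNIV f" for f :: "real \<Rightarrow> real"
      by (rule borel_integrable_atLeastAtMost') (rule continuous_on_subset[OF that], simp)
    have 1: "(LINT t:{0..T}|lborel. y t * g t) = of_real s"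
    proof -
      have "(LINT t:{0..T}|lborel. y t * g t) = (LINT t:{0..T}|lborel. (\<Sum>n\<in>F. a n * (y t * bloch_exp T \<sigma> n t)))"
        by (simp add: g_def sum_distrib_left mult_ac)
      also have "\<dots> = (\<Sum>n\<in>F. (LINT t:{0..T}|lborel. a n * (y t * bloch_exp T \<sigma> n t)))"
        unfolding set_lebesgue_integral_def scaleR_sum_right
        by (rule Bochner_Integration.integral_sum)
          (auto intro!: I[unfolded set_integrable_def] continuous_intros y)
      also have "\<dots> = (\<Sum>n\<in>F. a n * bloch_coeff T \<sigma> y n)"
        by (simp add: bloch_coeff_def)
      also have "\<dots> = of_real s" 
        unfolding s_def of_real_sum
        by (intro sum.cong refl) (simp add: a_def complex_norm_square mult.commute flip: of_real_power)
      finally show ?thesis .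
    qed
    have 2: "(LINT t:{0..T}|lborel. (norm (g t))\<^sup>2) = T * s"
    proof -
      have "of_real (LINT t:{0..T}|lborel. (norm (g t))\<^sup>2) = (LINT t:{0..T}|lborel. g t * cnj (g t))"
        unfolding set_lebesgue_integral_def
        by (subst integral_complex_of_real[symmetric], rule Bochner_Integration.integral_cong)
          (simp_all add: scaleR_conv_of_real complex_norm_square flip: of_real_power)
      also have "\<dots> = (LINT t:{0..T}|lborel. (\<Sum>n\<in>F. \<Sum>m\<in>F. (a n * cnj (a m)) * (bloch_exp T \<sigma> n t * cnj (bloch_exp T \<sigma> m t))))"
        by (simp add: g_def sum_product mult_ac)
      also have "\<dots> = (\<Sum>n\<in>F. \<Sum>m\<in>F. (LINT t:{0..T}|lborel. (a n * cnj (a m)) * (bloch_exp T \<sigma> n t * cnj (bloch_exp T \<sigma> m t))))"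
        unfolding set_lebesgue_integral_def scaleR_sum_right
        by (subst Bochner_Integration.integral_sum,
            (auto intro!: Bochner_Integration.integrable_sum I[unfolded set_integrable_def] continuous_intros)[1])
          (intro sum.cong refl Bochner_Integration.integral_sum I[unfolded set_integrable_def] continuous_intros)
      also have "\<dots> = (\<Sum>n\<in>F. \<Sum>m\<in>F. (a n * cnj (a m)) * (if n = m then of_real T else 0))"
        by (simp add: bloch_exp_orthogonal[OF T])
      also have "\<dots> = (\<Sum>n\<in>F. a n * cnj (a n) * of_real T)"
        using F by (intro sum.cong refl) (simp add: if_distrib[of "\<lambda>x. _ * x"] cong: if_cong)
      also have "\<dots> = of_real (T * s)"
        unfolding s_def of_real_mult of_real_sum sum_distrib_left
        by (intro sum.cong refl) (simp add: a_def complex_norm_square mult_ac flip: of_real_power)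
      finally show ?thesis by (simp only: of_real_eq_iff)
    qed
    have "s = norm (LINT t:{0..T}|lborel. y t * g t)"
      unfolding 1 norm_of_real by (simp add: s_def sum_nonneg)
    also have "\<dots> \<le> (LINT t:{0..T}|lborel. norm (y t * g t))"
      unfolding set_lebesgue_integral_def
      by (rule order_trans[OF integral_norm_bound]) simp
    also have "\<dots> \<le> (LINT t:{0..T}|lborel. (T * B\<^sup>2 + (norm (g t))\<^sup>2 / T) / 2)"
    proof (rule set_integral_mono)
      show "set_integrable lborel {0..T} (\<lambda>t. norm (y t * g t))" by (intro Ir continuous_intros y gc)
      show "set_integrable lborel {0..T} (\<lambda>t. (T * B\<^sup>2 + (norm (g t))\<^sup>2 / T) / 2)"
        using T by (intro Ir continuous_intros gc) auto
      fix t
      have "norm (y t * g t) \<le> B * norm (g t)" using B by (simp add: norm_mult mult_right_mono)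
      \<comment> \<open>The weight T is chosen so that the second term integrates to exactly s / 2
        and can be absorbed.\<close>
      also have "\<dots> \<le> (T * B\<^sup>2 + (norm (g t))\<^sup>2 / T) / 2"
      proof -
        have "0 \<le> (T * B - norm (g t))\<^sup>2 / T" using T by simp
        also have "\<dots> = T * B\<^sup>2 + (norm (g t))\<^sup>2 / T - 2 * (B * norm (g t))"
          using T by (simp add: power2_diff field_simps power2_eq_square)
        finally show ?thesis by simp
      qed
      finally show "norm (y t * g t) \<le> (T * B\<^sup>2 + (norm (g t))\<^sup>2 / T) / 2" .
    qed
    also have "\<dots> = (T * T * B\<^sup>2 + s) / 2"
    proof -
      have "set_integrable lborel {0..T} (\<lambda>t. (norm (g t))\<^sup>2 / T)"
        using T by (intro Ir continuous_intros gc) auto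
      moreover have "set_integrable lborel {0..T} (\<lambda>t. T * B\<^sup>2)"
        by (intro Ir continuous_intros)
      ultimately have "(LINT t:{0..T}|lborel. T * B\<^sup>2 + (norm (g t))\<^sup>2 / T) = (LINT t:{0..T}|lborel. T * B\<^sup>2) + (LINT t:{0..T}|lborel. (norm (g t))\<^sup>2 / T)"
        by (rule set_integral_add(2)[rotated])
      also have "(LINT t:{0..T}|lborel. T * B\<^sup>2) = T * T * B\<^sup>2" using T by (simp add: set_lebesgue_integral_def)
      also have "(LINT t:{0..T}|lborel. (norm (g t))\<^sup>2 / T) = s" using 2 T by simp
      finally show ?thesis by simp
    qed
    finally show "(\<Sum>n\<in>F. (norm (bloch_coeff T \<sigma> y n))\<^sup>2) \<le> T\<^sup>2 * B\<^sup>2"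
      by (simp add: s_def power2_eq_square)
  qed
qed

text \<open>The coefficients of \<alpha> are absolutely summable, so its finite Fourier sums
  converge uniformly with error at most the remaining tail. The coefficient functional is bounded in
  the sup norm and passes to the limit.\<close>

lemma bloch_coeff_mult:
  assumes T: "0 < T" and c: "(\<lambda>n. norm (c n)) summable_on UNIV"
    and \<alpha>: "\<And>t. complex_of_real (\<alpha> t) = (\<Sum>\<^sub>\<infinity>n. c n * exp (- \<i> * of_int n * of_real (2 * pi / T) * of_real t))"
    and ac: "continuous_on UNIV \<alpha>"
    and y: "continuous_on UNIV y" and B: "\<And>t. norm (y t) \<le> B"
  shows "((\<lambda>j. c j * bloch_coeff T \<sigma> y (n + j)) has_sum bloch_coeff T \<sigma> (\<lambda>t. of_real (\<alpha> t) * y t) n) UNIV"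
proof -
  define e where "e = (\<lambda>j t. exp (- \<i> * of_int j * of_real (2 * pi / T) * of_real t) :: complex)"
  have ne: "norm (e j t) = 1" for j t by (simp add: e_def norm_exp_eq_Re)
  have ec: "continuous_on UNIV (e j)" for j unfolding e_def by (intro continuous_intros)
  have B0: "0 \<le> B" using order_trans[OF norm_ge_zero B] .
  have sume: "(\<lambda>j. c j * e j t) summable_on UNIV" for t
    by (rule abs_summable_summable) (use c in \<open>simp add: norm_mult ne\<close>)
  define S where "S = (\<Sum>\<^sub>\<infinity>n. norm (c n))"
  have tail: "norm (of_real (\<alpha> t) - (\<Sum>j\<in>F. c j * e j t)) \<le> S - (\<Sum>j\<in>F. norm (c j))" if F: "finite F" for F t
  proof -
    have "of_real (\<alpha> t) - (\<Sum>j\<in>F. c j * e j t) = (\<Sum>\<^sub>\<infinity>j\<in>UNIV - F. c j * e j t)"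
    proof -
      have "of_real (\<alpha> t) = (\<Sum>\<^sub>\<infinity>j. c j * e j t)" by (simp only: \<alpha> e_def)
      then show ?thesis using sume F by (subst infsum_Diff) auto
    qed
    also have "norm \<dots> \<le> (\<Sum>\<^sub>\<infinity>j\<in>UNIV - F. norm (c j * e j t))"
      by (rule norm_infsum_bound) (use c in \<open>auto simp: norm_mult ne intro: summable_on_subset_banach\<close>)
    also have "\<dots> = (\<Sum>\<^sub>\<infinity>j\<in>UNIV - F. norm (c j))" by (simp add: norm_mult ne)
    also have "\<dots> = S - (\<Sum>j\<in>F. norm (c j))"
      unfolding S_def using c F by (subst infsum_Diff) auto
    finally show ?thesis .
  qed
  have I: "set_integrable lborel {0..T} f" if "continuous_on UNIV f" for f :: "real \<Rightarrow> complex"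
    by (rule set_integrable_Icc_continuous[OF that])
  have part: "bloch_coeff T \<sigma> (\<lambda>t. of_real (\<alpha> t) * y t) n - (\<Sum>j\<in>F. c j * bloch_coeff T \<sigma> y (n + j))
      = bloch_coeff T \<sigma> (\<lambda>t. (of_real (\<alpha> t) - (\<Sum>j\<in>F. c j * e j t)) * y t) n" if F: "finite F" for F
  proof -
    have "(\<Sum>j\<in>F. c j * bloch_coeff T \<sigma> y (n + j)) = (\<Sum>j\<in>F. (LINT t:{0..T}|lborel. c j * (y t * bloch_exp T \<sigma> (n + j) t)))"
      by (simp add: bloch_coeff_def)
    also have "\<dots> = (LINT t:{0..T}|lborel. (\<Sum>j\<in>F. c j * (y t * bloch_exp T \<sigma> (n + j) t)))"
      unfolding set_lebesgue_integral_def scaleR_sum_right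
      by (rule Bochner_Integration.integral_sum[symmetric])
        (auto intro!: I[unfolded set_integrable_def] continuous_intros y)
    finally have 1: "(\<Sum>j\<in>F. c j * bloch_coeff T \<sigma> y (n + j)) = (LINT t:{0..T}|lborel. (\<Sum>j\<in>F. c j * (y t * bloch_exp T \<sigma> (n + j) t)))" .
    have "bloch_coeff T \<sigma> (\<lambda>t. of_real (\<alpha> t) * y t) n - (\<Sum>j\<in>F. c j * bloch_coeff T \<sigma> y (n + j))
      = (LINT t:{0..T}|lborel. of_real (\<alpha> t) * y t * bloch_exp T \<sigma> n t - (\<Sum>j\<in>F. c j * (y t * bloch_exp T \<sigma> (n + j) t)))"
      unfolding 1 unfolding bloch_coeff_def
      by (rule set_integral_diff(2)[symmetric]) (intro I continuous_intros ac y)+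
    also have "\<dots> = bloch_coeff T \<sigma> (\<lambda>t. (of_real (\<alpha> t) - (\<Sum>j\<in>F. c j * e j t)) * y t) n"
      unfolding bloch_coeff_def bloch_exp_add_index e_def
      by (intro set_lebesgue_integral_cong) (auto simp: algebra_simps sum_distrib_left sum_distrib_right)
    finally show ?thesis .
  qed
  have bound: "norm ((\<Sum>j\<in>F. c j * bloch_coeff T \<sigma> y (n + j)) - bloch_coeff T \<sigma> (\<lambda>t. of_real (\<alpha> t) * y t) n) \<le> T * ((S - (\<Sum>j\<in>F. norm (c j))) * B)"
    if F: "finite F" for F
  proof -
    have "continuous_on UNIV (\<lambda>t. (of_real (\<alpha> t) - (\<Sum>j\<in>F. c j * e j t)) * y t)"
      by (intro continuous_intros ac y ec)
    then have "norm (bloch_coeff T \<sigma> (\<lambda>t. (of_real (\<alpha> t) - (\<Sum>j\<in>F. c j * e j t)) * y t) n) \<le> T * ((S - (\<Sum>j\<in>F. norm (c j))) * B)"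
      by (intro bloch_coeff_bound[OF T] borel_measurable_continuous_onI)
        (auto simp: norm_mult intro!: mult_mono tail[OF F] B order_trans[OF norm_ge_zero tail[OF F]])
    then show ?thesis unfolding part[OF F, symmetric] by (simp add: norm_minus_commute)
  qed
  show ?thesis
    unfolding has_sum_def
  proof (rule LIM_zero_cancel, rule Lim_null_comparison)
    show "\<forall>\<^sub>F F in finite_subsets_at_top UNIV. norm ((\<Sum>j\<in>F. c j * bloch_coeff T \<sigma> y (n + j)) - bloch_coeff T \<sigma> (\<lambda>t. of_real (\<alpha> t) * y t) n) \<le> T * ((S - (\<Sum>j\<in>F. norm (c j))) * B)"
      by (rule eventually_finite_subsets_at_top_weakI) (rule bound)
    have "((\<lambda>F. \<Sum>j\<in>F. norm (c j)) \<longlongrightarrow> S) (finite_subsets_at_top UNIV)"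
      using has_sum_infsum[OF c] unfolding has_sum_def S_def .
    then have "((\<lambda>F. T * ((S - (\<Sum>j\<in>F. norm (c j))) * B)) \<longlongrightarrow> T * ((S - S) * B)) (finite_subsets_at_top UNIV)"
      by (intro tendsto_intros)
    then show "((\<lambda>F. T * ((S - (\<Sum>j\<in>F. norm (c j))) * B)) \<longlongrightarrow> 0) (finite_subsets_at_top UNIV)"
      by simp
  qed
qed

section \<open>Uniqueness of Bloch coefficients by polynomial approximation on the circle\<close>

lemma continuous_real_polynomial_function:
  assumes "real_polynomial_function p"
  shows "continuous_on S p"
  using assms by (induction rule: real_polynomial_function.induct)
    (auto intro: linear_continuous_on continuous_on_add continuous_on_mult)

text \<open>Multiplication by E or its conjugate shifts the index by one, so vanishing of all
  coefficients survives multiplication by polynomials in both. The induction runs over all functions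
  at once, since for a product the second factor is applied to the function already multiplied by
  the first.\<close>

lemma polynomial_preserves_bloch_coeff_zero:
  assumes T: "0 < T" and p: "real_polynomial_function p"
  defines "E \<equiv> \<lambda>t. bloch_exp T 0 (- 1) t"
  shows "continuous_on UNIV \<psi> \<Longrightarrow> (\<And>n. bloch_coeff T \<sigma> \<psi> n = 0) \<Longrightarrow> bloch_coeff T \<sigma> (\<lambda>t. \<psi> t * of_real (p (E t))) n = 0"
  using p
proof (induction arbitrary: \<psi> n rule: real_polynomial_function.induct)
  case (linear f)
  have lin: "f w = Re w * f 1 + Im w * f \<i>" for w
  proof -
    have "w = Re w *\<^sub>R 1 + Im w *\<^sub>R \<i>" by (simp add: complex_eq_iff)
    then have "f w = f (Re w *\<^sub>R 1 + Im w *\<^sub>R \<i>)" by simp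
    also have "\<dots> = Re w *\<^sub>R f 1 + Im w *\<^sub>R f \<i>"
      using linear(1) by (simp add: linear_simps)
    finally show ?thesis by simp
  qed
  \<comment> \<open>Every real-linear functional on the complex plane has the form a w + b cnj
    w.\<close>
  define a b where "a = (of_real (f 1) - \<i> * of_real (f \<i>)) / 2" and "b = (of_real (f 1) + \<i> * of_real (f \<i>)) / 2"
  have fE: "complex_of_real (f w) = a * w + b * cnj w" for w
    unfolding a_def b_def lin[of w] by (simp add: complex_eq_iff field_simps)
  have E1: "E t * bloch_exp T \<sigma> n t = bloch_exp T \<sigma> (n - 1) t" for t
    using bloch_exp_add_index[of T \<sigma> n "- 1" t] by (simp add: E_def bloch_exp_def mult_ac)
  have E2: "cnj (E t) * bloch_exp T \<sigma> n t = bloch_exp T \<sigma> (n + 1) t" for t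
    using bloch_exp_add_index[of T \<sigma> n "1" t] by (simp add: E_def bloch_exp_def exp_cnj mult_ac)
  have I: "set_integrable lborel {0..T} f" if "continuous_on UNIV f" for f :: "real \<Rightarrow> complex"
    by (rule set_integrable_Icc_continuous[OF that])
  have "bloch_coeff T \<sigma> (\<lambda>t. \<psi> t * of_real (f (E t))) n = (LINT t:{0..T}|lborel. a * (\<psi> t * bloch_exp T \<sigma> (n - 1) t) + b * (\<psi> t * bloch_exp T \<sigma> (n + 1) t))"
    unfolding bloch_coeff_def fE E1[symmetric] E2[symmetric] by (simp add: algebra_simps)
  also have "\<dots> = (LINT t:{0..T}|lborel. a * (\<psi> t * bloch_exp T \<sigma> (n - 1) t)) + (LINT t:{0..T}|lborel. b * (\<psi> t * bloch_exp T \<sigma> (n + 1) t))"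
    by (rule set_integral_add(2)) (intro I continuous_intros linear)+
  also have "\<dots> = a * bloch_coeff T \<sigma> \<psi> (n - 1) + b * bloch_coeff T \<sigma> \<psi> (n + 1)"
    by (simp add: bloch_coeff_def)
  finally show ?case using linear(3) by simp
next
  case (const c)
  have "bloch_coeff T \<sigma> (\<lambda>t. \<psi> t * of_real c) n = (LINT t:{0..T}|lborel. of_real c * (\<psi> t * bloch_exp T \<sigma> n t))"
    by (simp add: bloch_coeff_def mult_ac)
  also have "\<dots> = of_real c * bloch_coeff T \<sigma> \<psi> n" by (simp add: bloch_coeff_def)
  finally show ?case using const by simp
next
  case (add f g)
  have I: "set_integrable lborel {0..T} f" if "continuous_on UNIV f" for f :: "real \<Rightarrow> complex"
    by (rule set_integrable_Icc_continuous[OF that])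
  have Ec: "continuous_on UNIV E" unfolding E_def by (rule continuous_bloch_exp)
  have fc: "continuous_on UNIV (\<lambda>t. f (E t))" "continuous_on UNIV (\<lambda>t. g (E t))"
    using continuous_on_compose[OF Ec continuous_real_polynomial_function] add(1,2) by (auto simp: o_def)
  have "bloch_coeff T \<sigma> (\<lambda>t. \<psi> t * of_real (f (E t) + g (E t))) n
     = (LINT t:{0..T}|lborel. \<psi> t * of_real (f (E t)) * bloch_exp T \<sigma> n t + \<psi> t * of_real (g (E t)) * bloch_exp T \<sigma> n t)"
    by (simp add: bloch_coeff_def algebra_simps)
  also have "\<dots> = bloch_coeff T \<sigma> (\<lambda>t. \<psi> t * of_real (f (E t))) n + bloch_coeff T \<sigma> (\<lambda>t. \<psi> t * of_real (g (E t))) n"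
    unfolding bloch_coeff_def by (rule set_integral_add(2)) (intro I continuous_intros add(5) fc)+
  finally show ?case using add.IH add.prems by simp
next
  case (mult f g)
  have Ec: "continuous_on UNIV E" unfolding E_def by (rule continuous_bloch_exp)
  have fc: "continuous_on UNIV (\<lambda>t. f (E t))"
    using continuous_on_compose[OF Ec continuous_real_polynomial_function] mult(1) by (auto simp: o_def)
  have "bloch_coeff T \<sigma> (\<lambda>t. (\<psi> t * of_real (f (E t))) * of_real (g (E t))) n = 0"
    by (rule mult.IH(2)) (use mult.IH(1) mult.prems fc in \<open>auto intro!: continuous_intros\<close>)
  then show ?case by (simp add: mult.assoc)
qed

text \<open>After removing the phase, y becomes a periodic function v, which factors through the
  circle parametrized by \<open>E\<close>. Stone-Weierstrass approximates the conjugate of v by a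
  polynomial in \<open>E\<close>. As v is orthogonal to such polynomials, the integral of |v|^2 is
  as small as the approximation error.\<close>

lemma bloch_coeff_unique:
  assumes T: "0 < T" and y: "continuous_on UNIV y"
    and per: "\<And>t. y (t + T) = exp (\<i> * of_real (\<sigma> * T)) * y t"
    and z: "\<And>n. bloch_coeff T \<sigma> y n = 0" and t: "t \<in> {0..T}"
  shows "y t = 0"
proof -
  define E where "E = (\<lambda>t. bloch_exp T 0 (- 1) t)"
  define u where "u = (\<lambda>t. cnj (y t * bloch_exp T \<sigma> 0 t))"
  have Ec: "continuous_on UNIV E" unfolding E_def by (rule continuous_bloch_exp)
  have uc: "continuous_on UNIV u" unfolding u_def by (intro continuous_intros y)
  have uT: "u T = u 0"
  proof -
    have "y T * bloch_exp T \<sigma> 0 T = (exp (\<i> * of_real (\<sigma> * T)) * exp (- (\<i> * of_real (\<sigma> * T)))) * (y 0 * bloch_exp T \<sigma> 0 0)"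
      using per[of 0] bloch_exp_period[OF T, of \<sigma> 0 0] by (simp add: mult_ac)
    also have "exp (\<i> * of_real (\<sigma> * T)) * exp (- (\<i> * of_real (\<sigma> * T))) = 1"
      by (simp flip: exp_add)
    finally show ?thesis by (simp only: u_def mult_1_left)
  qed
  have Eexp: "E t = exp (\<i> * of_real (2 * pi * t / T))" for t by (simp add: E_def bloch_exp_def)
  \<comment> \<open>Within one period \<open>E\<close> identifies only the two endpoints, where u
    agrees by \<open>uT\<close>.\<close>
  have Einj: "u s = u s'" if "s \<in> {0..T}" "s' \<in> {0..T}" "E s = E s'" for s s'
  proof -
    from that(3) obtain k :: int where "\<i> * of_real (2 * pi * s / T) = \<i> * of_real (2 * pi * s' / T) + (2 * of_int k * pi) * \<i>"
      unfolding Eexp exp_eq by auto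
    then have "\<i> * of_real (2 * pi * s / T) = \<i> * of_real (2 * pi * s' / T + 2 * pi * of_int k)"
      by (simp add: algebra_simps)
    then have "2 * pi * s / T = 2 * pi * s' / T + 2 * pi * of_int k"
      by (metis complex_i_not_zero mult_cancel_left of_real_eq_iff)
    then have "(2 * pi) * s = (2 * pi) * (s' + T * of_int k)" using T by (simp add: field_simps)
    then have sk: "s = s' + T * of_int k" by (simp del: mult.commute)
    have "\<bar>T * of_int k\<bar> \<le> T" using sk that(1,2) by auto
    then have "\<bar>real_of_int k\<bar> \<le> 1" using T by (simp add: abs_mult)
    then have "k = 0 \<or> k = 1 \<or> k = - 1" by linarith
    then show ?thesis using sk that(1,2) uT by auto
  qed
  define f where "f = (\<lambda>w. u (SOME s. s \<in> {0..T} \<and> E s = w))"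
  have fE: "f (E s) = u s" if "s \<in> {0..T}" for s
  proof -
    have "\<exists>s'. s' \<in> {0..T} \<and> E s' = E s" using that by blast
    from someI_ex[OF this] show ?thesis unfolding f_def using that by (intro Einj) auto
  qed
  define C where "C = E ` {0..T}"
  have comp: "compact C" unfolding C_def by (intro compact_continuous_image continuous_on_subset[OF Ec]) auto
  \<comment> \<open>The graph of f is the continuous image of [0,T] under (E, u), hence compact, and
    f has a compact range; so f is continuous although it is defined by choice.\<close>
  have fc: "continuous_on C f"
  proof (rule continuous_from_closed_graph)
    show "compact (u ` {0..T})" by (intro compact_continuous_image continuous_on_subset[OF uc]) auto
    show "f \<in> C \<rightarrow> u ` {0..T}" using fE by (auto simp: C_def)
    have "(\<lambda>x. (x, f x)) ` C = (\<lambda>s. (E s, u s)) ` {0..T}"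
      unfolding C_def image_image using fE by (intro image_cong) auto
    moreover have "compact ((\<lambda>s. (E s, u s)) ` {0..T})"
      by (intro compact_continuous_image continuous_on_Pair continuous_on_subset[OF uc] continuous_on_subset[OF Ec]) auto
    ultimately show "closed ((\<lambda>x. (x, f x)) ` C)" by (simp add: compact_imp_closed)
  qed
  define v where "v = (\<lambda>t. y t * bloch_exp T \<sigma> 0 t)"
  have vc: "continuous_on UNIV v" unfolding v_def by (intro continuous_intros y)
  have "compact (v ` {0..T})" by (intro compact_continuous_image continuous_on_subset[OF vc]) auto
  then have "bounded (v ` {0..T})" by (rule compact_imp_bounded)
  then obtain B where B: "\<And>s. s \<in> {0..T} \<Longrightarrow> norm (v s) \<le> B"
    unfolding bounded_iff by blast
  have I: "set_integrable lborel {0..T} f" if "continuous_on UNIV f" for f :: "real \<Rightarrow> complex"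
    by (rule set_integrable_Icc_continuous[OF that])
  have Ir: "set_integrable lborel {0..T} f" if "continuous_on UNIV f" for f :: "real \<Rightarrow> real"
    by (rule borel_integrable_atLeastAtMost') (rule continuous_on_subset[OF that], simp)
  have small: "(LINT s:{0..T}|lborel. (norm (v s))\<^sup>2) \<le> T * (B * e)" if e: "0 < e" for e
  proof -
    obtain g where g: "polynomial_function g" "\<And>w. w \<in> C \<Longrightarrow> norm (f w - g w) < e"
      using Stone_Weierstrass_polynomial_function[OF comp fc e] by auto
    have gr: "real_polynomial_function (\<lambda>w. Re (g w))" "real_polynomial_function (\<lambda>w. Im (g w))"
      using g(1) bounded_linear_Re bounded_linear_Im unfolding polynomial_function_def by (auto simp: o_def)
    have gc: "continuous_on UNIV (\<lambda>t. Re (g (E t)))" "continuous_on UNIV (\<lambda>t. Im (g (E t)))"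
      using continuous_on_compose[OF Ec continuous_real_polynomial_function[OF gr(1)]]
        continuous_on_compose[OF Ec continuous_real_polynomial_function[OF gr(2)]] by (auto simp: o_def)
    have gEc: "continuous_on UNIV (\<lambda>t. g (E t))"
    proof -
      have eq: "(\<lambda>t. g (E t)) = (\<lambda>t. of_real (Re (g (E t))) + \<i> * of_real (Im (g (E t))))"
        by (simp add: complex_eq_iff fun_eq_iff)
      have "continuous_on UNIV (\<lambda>t. of_real (Re (g (E t))) + \<i> * of_real (Im (g (E t))) :: complex)"
        by (intro continuous_intros gc)
      then show ?thesis by (rule iffD2[OF arg_cong[OF eq, of "continuous_on UNIV"]])
    qed
    have z0: "(LINT s:{0..T}|lborel. v s * of_real (Re (g (E s)))) = 0" "(LINT s:{0..T}|lborel. v s * of_real (Im (g (E s)))) = 0"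
      using polynomial_preserves_bloch_coeff_zero[OF T gr(1) y z, of 0] polynomial_preserves_bloch_coeff_zero[OF T gr(2) y z, of 0]
      by (simp_all add: bloch_coeff_def v_def E_def mult_ac)
    have "(LINT s:{0..T}|lborel. v s * g (E s)) = (LINT s:{0..T}|lborel. v s * of_real (Re (g (E s))) + \<i> * (v s * of_real (Im (g (E s)))))"
      by (intro set_lebesgue_integral_cong) (auto simp: complex_eq_iff algebra_simps)
    also have "\<dots> = (LINT s:{0..T}|lborel. v s * of_real (Re (g (E s)))) + (LINT s:{0..T}|lborel. \<i> * (v s * of_real (Im (g (E s)))))"
      by (rule set_integral_add(2)) (intro I continuous_intros vc gc)+
    also have "\<dots> = 0" using z0 by simp
    finally have zero: "(LINT s:{0..T}|lborel. v s * g (E s)) = 0" .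
    have "of_real (LINT s:{0..T}|lborel. (norm (v s))\<^sup>2) = (LINT s:{0..T}|lborel. v s * cnj (v s))"
      unfolding set_lebesgue_integral_def
      by (subst integral_complex_of_real[symmetric], rule Bochner_Integration.integral_cong)
        (simp_all add: scaleR_conv_of_real complex_norm_square flip: of_real_power)
    also have "\<dots> = (LINT s:{0..T}|lborel. v s * cnj (v s)) - (LINT s:{0..T}|lborel. v s * g (E s))"
      using zero by simp
    also have "\<dots> = (LINT s:{0..T}|lborel. v s * cnj (v s) - v s * g (E s))"
      by (rule set_integral_diff(2)[symmetric]) (intro I continuous_intros vc gEc)+
    finally have "norm (complex_of_real (LINT s:{0..T}|lborel. (norm (v s))\<^sup>2)) = norm (LINT s:{0..T}|lborel. v s * cnj (v s) - v s * g (E s))"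
      by (simp only:)
    also have "\<dots> \<le> (LINT s:{0..T}|lborel. norm (v s * cnj (v s) - v s * g (E s)))"
      unfolding set_lebesgue_integral_def by (rule order_trans[OF integral_norm_bound]) simp
    also have "\<dots> \<le> (LINT s:{0..T}|lborel. B * e)"
    proof (rule set_integral_mono)
      show "set_integrable lborel {0..T} (\<lambda>s. norm (v s * cnj (v s) - v s * g (E s)))"
        by (intro Ir continuous_intros vc gEc)
      show "set_integrable lborel {0..T} (\<lambda>s. B * e)" by (intro Ir continuous_intros)
      fix s assume s: "s \<in> {0..T}"
      have "norm (cnj (v s) - g (E s)) \<le> e"
        using g(2)[of "E s"] s fE[OF s] by (auto simp: C_def u_def v_def)
      then have "norm (v s) * norm (cnj (v s) - g (E s)) \<le> B * e"
        using B[OF s] e by (intro mult_mono) (auto intro: order_trans[OF norm_ge_zero])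
      then show "norm (v s * cnj (v s) - v s * g (E s)) \<le> B * e"
        by (simp add: norm_mult flip: right_diff_distrib)
    qed
    also have "\<dots> = T * (B * e)" using T by (simp add: set_lebesgue_integral_def)
    finally show ?thesis by simp
  qed
  have "(LINT s:{0..T}|lborel. (norm (v s))\<^sup>2) \<le> 0"
  proof (rule field_le_epsilon)
    fix e :: real assume "0 < e"
    have B0: "0 \<le> B" using B[of 0] T by (auto intro: order_trans[OF norm_ge_zero])
    have "(LINT s:{0..T}|lborel. (norm (v s))\<^sup>2) \<le> T * (B * (e / (T * B + 1)))"
      using \<open>0 < e\<close> B0 T by (intro small) (auto intro!: divide_pos_pos add_nonneg_pos)
    also have "\<dots> \<le> e" using \<open>0 < e\<close> B0 T by (simp add: divide_simps add_nonneg_pos add_nonneg_eq_0_iff)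
    finally show "(LINT s:{0..T}|lborel. (norm (v s))\<^sup>2) \<le> 0 + e" by simp
  qed
  moreover have "(LINT s:{0..T}|lborel. (norm (v s))\<^sup>2) = integral {0..T} (\<lambda>s. (norm (v s))\<^sup>2)"
    by (rule set_borel_integral_eq_integral) (intro Ir continuous_intros vc)
  moreover have "0 \<le> (LINT s:{0..T}|lborel. (norm (v s))\<^sup>2)"
    unfolding set_lebesgue_integral_def by (intro integral_nonneg_AE) (auto simp: indicator_def)
  ultimately have "integral {0..T} (\<lambda>s. (norm (v s))\<^sup>2) = 0" by simp
  moreover have "continuous_on {0..T} (\<lambda>s. (norm (v s))\<^sup>2)"
    by (intro continuous_intros continuous_on_subset[OF vc]) auto
  ultimately have "(norm (v t))\<^sup>2 = 0" using integral_eq_0_iff[of 0 T "\<lambda>s. (norm (v s))\<^sup>2"] T t by auto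
  then show ?thesis by (simp add: v_def) (metis norm_bloch_exp norm_zero zero_neq_one)
qed

section \<open>The regularized operator\<close>

definition kappa :: complex where
  "kappa = 4 * csqrt (of_real pi * \<i>)"

text \<open>The phase of \<open>kappa\<close> is that of 1 + i. Multiplication by 1 - i therefore
  makes the coupling in the coefficient equations real.\<close>

lemma kappa_eq: "kappa = of_real (4 * (sqrt pi / sqrt 2)) * (1 + \<i>)"
proof -
  have "csqrt (of_real pi * \<i>) = of_real (sqrt pi / sqrt 2) * (1 + \<i>)"
  proof (rule csqrt_unique)
    have e1: "(1 + \<i>)\<^sup>2 = 2 * \<i>" by (simp add: power2_eq_square algebra_simps)
    have e2: "(complex_of_real (sqrt pi / sqrt 2))\<^sup>2 = of_real (pi / 2)"
      by (simp add: power_divide flip: of_real_power)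
    show "(of_real (sqrt pi / sqrt 2) * (1 + \<i>))\<^sup>2 = of_real pi * \<i>"
      unfolding power_mult_distrib e1 e2 by simp
  qed simp
  then show ?thesis by (simp add: kappa_def)
qed

text \<open>The damping is a conjugation: applied to exp (- \<gamma> t) u, the operator with damping
  \<gamma> gives exp (- \<gamma> t) times the undamped operator applied to u.\<close>

definition reg_op :: "(real \<Rightarrow> real) \<Rightarrow> real \<Rightarrow> (real \<Rightarrow> complex) \<Rightarrow> real \<Rightarrow> complex" where
  "reg_op \<alpha> \<gamma> v t = v t - conv (\<lambda>x. exp (- \<gamma> * x) * mix_kernel x) v t
     + kappa * conv (\<lambda>x. exp (- \<gamma> * x) * reg_kernel x) (\<lambda>s. of_real (\<alpha> s) * v s) t"

locale ionization =
  fixes \<alpha> :: "real \<Rightarrow> real" and T :: real and c :: "int \<Rightarrow> complex"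
  assumes standing: "standing_assumptions \<alpha> T c" and gen: "generic c"
begin

lemma T_pos: "0 < T" and alpha_cont: "continuous_on UNIV \<alpha>" and alpha_per: "\<alpha> (t + T) = \<alpha> t"
  and c_summable: "(\<lambda>n. norm (c n)) summable_on UNIV"
  and alpha_series: "complex_of_real (\<alpha> t) = (\<Sum>\<^sub>\<infinity>n. c n * exp (- \<i> * of_int n * of_real (2 * pi / T) * of_real t))"
  and c_sym: "c n = cnj (c (- n))" and alpha0: "\<alpha> 0 < 0"
  using standing unfolding standing_assumptions_def by blast+

lemma alpha_meas [measurable]: "\<alpha> \<in> borel_measurable borel"
  by (rule borel_measurable_continuous_onI[OF alpha_cont])

definition alpha_norm :: real where "alpha_norm = (\<Sum>\<^sub>\<infinity>n. norm (c n))"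

lemma alpha_bound: "\<bar>\<alpha> t\<bar> \<le> alpha_norm"
proof -
  have "\<bar>\<alpha> t\<bar> = norm (complex_of_real (\<alpha> t))" by simp
  also have "\<dots> \<le> (\<Sum>\<^sub>\<infinity>n. norm (c n * exp (- \<i> * of_int n * of_real (2 * pi / T) * of_real t)))"
    unfolding alpha_series by (rule norm_infsum_bound) (use c_summable in \<open>simp add: norm_mult norm_exp_eq_Re\<close>)
  also have "\<dots> = alpha_norm" by (simp add: alpha_norm_def norm_mult norm_exp_eq_Re)
  finally show ?thesis .
qed

lemma alpha_norm_nonneg: "0 \<le> alpha_norm"
  unfolding alpha_norm_def by (intro infsum_nonneg) auto

lemma alpha_mult_bound:
  assumes "norm x \<le> B"
  shows "norm (of_real (\<alpha> t) * (x::complex)) \<le> alpha_norm * B"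
  using alpha_bound[of t] assms alpha_norm_nonneg by (auto simp: norm_mult intro!: mult_mono)

text \<open>On coefficients both convolutions act as multiplication by transforms at p n = \<gamma>
  + i \<nu> n. \<open>laplace_symbol\<close> exposes the common nonzero factor
  \<open>laplace reg_kernel (p n)\<close>, which cancels, and multiplying by 1 - i brings the rest
  into the form required by \<open>generic_kernel_trivial\<close>.\<close>

lemma bloch_solution_trivial:
  assumes \<gamma>: "0 \<le> \<gamma>" and y: "continuous_on UNIV y" and B: "\<And>t. norm (y t) \<le> B"
    and per: "\<And>t. y (t + T) = exp (\<i> * of_real (\<sigma> * T)) * y t" and \<sigma>: "0 \<le> \<sigma>" "\<sigma> < 2 * pi / T"
    and eq: "\<And>t. reg_op \<alpha> \<gamma> y t = 0" and t: "t \<in> {0..T}"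
  shows "y t = 0"
proof -
  define \<nu> where "\<nu> = (\<lambda>n::int. \<sigma> + 2 * pi * of_int n / T)"
  define p where "p = (\<lambda>n. of_real \<gamma> + \<i> * of_real (\<nu> n))"
  define ay where "ay = (\<lambda>t. of_real (\<alpha> t) * y t)"
  have ayc: "continuous_on UNIV ay" unfolding ay_def by (intro continuous_intros alpha_cont y)
  have ayB: "norm (ay t) \<le> alpha_norm * B" for t unfolding ay_def by (rule alpha_mult_bound[OF B])
  have ayper: "ay (t + T) = exp (\<i> * of_real (\<sigma> * T)) * ay t" for t
    by (simp add: ay_def per alpha_per)
  have gl: "good_kernel (\<lambda>x. exp (- \<gamma> * x) * mix_kernel x)" and gs: "good_kernel (\<lambda>x. exp (- \<gamma> * x) * reg_kernel x)"
    using good_kernel_exp[OF good_kernel_mix_kernel \<gamma>] good_kernel_exp[OF good_kernel_reg_kernel \<gamma>] by auto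
  have m: "y \<in> borel_measurable borel" "ay \<in> borel_measurable borel"
    using y ayc by (auto intro: borel_measurable_continuous_onI)
  have I: "set_integrable lborel {0..T} f" if "continuous_on UNIV f" for f :: "real \<Rightarrow> complex"
    by (rule set_integrable_Icc_continuous[OF that])
  define cl where "cl = conv (\<lambda>x. exp (- \<gamma> * x) * mix_kernel x) y"
  define cs where "cs = conv (\<lambda>x. exp (- \<gamma> * x) * reg_kernel x) ay"
  have cc: "continuous_on UNIV cl" "continuous_on UNIV cs"
    unfolding cl_def cs_def by (rule conv_continuous[OF gl m(1) B]) (rule conv_continuous[OF gs m(2) ayB])
  have lin: "bloch_coeff T \<sigma> y n - bloch_coeff T \<sigma> cl n + kappa * bloch_coeff T \<sigma> cs n = 0" for n
  proof -
    have "bloch_coeff T \<sigma> y n - bloch_coeff T \<sigma> cl n + kappa * bloch_coeff T \<sigma> cs n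
      = (LINT t:{0..T}|lborel. y t * bloch_exp T \<sigma> n t) - (LINT t:{0..T}|lborel. cl t * bloch_exp T \<sigma> n t) + (LINT t:{0..T}|lborel. kappa * (cs t * bloch_exp T \<sigma> n t))"
      by (simp add: bloch_coeff_def)
    also have "\<dots> = (LINT t:{0..T}|lborel. y t * bloch_exp T \<sigma> n t - cl t * bloch_exp T \<sigma> n t) + (LINT t:{0..T}|lborel. kappa * (cs t * bloch_exp T \<sigma> n t))"
      by (subst set_integral_diff(2)) (intro I continuous_intros y cc refl)+
    also have "\<dots> = (LINT t:{0..T}|lborel. (y t * bloch_exp T \<sigma> n t - cl t * bloch_exp T \<sigma> n t) + kappa * (cs t * bloch_exp T \<sigma> n t))"
      by (rule set_integral_add(2)[symmetric]) (intro I continuous_intros y cc)+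
    also have "\<dots> = (LINT t:{0..T}|lborel. reg_op \<alpha> \<gamma> y t * bloch_exp T \<sigma> n t)"
      unfolding reg_op_def cl_def cs_def ay_def by (simp add: algebra_simps)
    finally show ?thesis by (simp add: eq)
  qed
  have key: "csqrt (p n) * (1 - \<i>) * bloch_coeff T \<sigma> y n = - (of_real (8 * pi / sqrt 2) * bloch_coeff T \<sigma> ay n)" for n
  proof -
    have rp: "0 \<le> Re (p n)" using \<gamma> by (simp add: p_def)
    have "bloch_coeff T \<sigma> cl n = laplace mix_kernel (p n) * bloch_coeff T \<sigma> y n"
      unfolding cl_def bloch_coeff_conv[OF T_pos gl y B per] laplace_exp_shift by (simp add: p_def \<nu>_def)
    moreover have "bloch_coeff T \<sigma> cs n = laplace reg_kernel (p n) * bloch_coeff T \<sigma> ay n"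
      unfolding cs_def bloch_coeff_conv[OF T_pos gs ayc ayB ayper] laplace_exp_shift by (simp add: p_def \<nu>_def)
    ultimately have "(1 - laplace mix_kernel (p n)) * bloch_coeff T \<sigma> y n + kappa * laplace reg_kernel (p n) * bloch_coeff T \<sigma> ay n = 0"
      using lin[of n] by (simp add: algebra_simps)
    then have "of_real (sqrt pi) * ((1 - laplace mix_kernel (p n)) * bloch_coeff T \<sigma> y n + kappa * laplace reg_kernel (p n) * bloch_coeff T \<sigma> ay n) = 0"
      by simp
    then have "((1 - laplace mix_kernel (p n)) * of_real (sqrt pi)) * bloch_coeff T \<sigma> y n + of_real (sqrt pi) * kappa * laplace reg_kernel (p n) * bloch_coeff T \<sigma> ay n = 0"
      by (simp add: algebra_simps)
    then have "laplace reg_kernel (p n) * (csqrt (p n) * bloch_coeff T \<sigma> y n + of_real (sqrt pi) * kappa * bloch_coeff T \<sigma> ay n) = 0"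
      unfolding laplace_symbol[OF rp] by (simp add: algebra_simps)
    then have "csqrt (p n) * bloch_coeff T \<sigma> y n + of_real (sqrt pi) * kappa * bloch_coeff T \<sigma> ay n = 0"
      using laplace_reg_kernel_nonzero[OF rp] by simp
    then have "csqrt (p n) * bloch_coeff T \<sigma> y n = - (of_real (sqrt pi) * kappa * bloch_coeff T \<sigma> ay n)"
      by (simp add: eq_neg_iff_add_eq_0)
    then have "(1 - \<i>) * (csqrt (p n) * bloch_coeff T \<sigma> y n) = - (((1 - \<i>) * of_real (sqrt pi) * kappa) * bloch_coeff T \<sigma> ay n)"
      by (simp add: mult_ac)
    \<comment> \<open>Origin of the constant D: (1 - i) (1 + i) = 2 and 2 sqrt pi times the modulus
      factor 4 sqrt pi / sqrt 2 of \<open>kappa\<close> is 8 pi / sqrt 2.\<close>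
    moreover have "(1 - \<i>) * of_real (sqrt pi) * kappa = of_real (8 * pi / sqrt 2)"
    proof -
      have "(1 - \<i>) * of_real (sqrt pi) * kappa = of_real (sqrt pi * (4 * (sqrt pi / sqrt 2))) * ((1 - \<i>) * (1 + \<i>))"
        unfolding kappa_eq by (simp add: mult_ac)
      also have "(1 - \<i>) * (1 + \<i>) = of_real 2" by (simp add: algebra_simps)
      also have "sqrt pi * (4 * (sqrt pi / sqrt 2)) = 4 * pi / sqrt 2" by simp
      finally show ?thesis by simp
    qed
    moreover have "csqrt (p n) * (1 - \<i>) * bloch_coeff T \<sigma> y n = (1 - \<i>) * (csqrt (p n) * bloch_coeff T \<sigma> y n)"
      by (simp only: mult_ac)
    ultimately show ?thesis by (simp only:)
  qed
  have fz: "bloch_coeff T \<sigma> y n = 0" for n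
  proof (rule generic_kernel_trivial[OF gen c_summable c_sym bloch_coeff_Bessel[OF T_pos y B] bloch_coeff_bound[OF T_pos m(1) B],
        where D = "8 * pi / sqrt 2" and \<mu> = "\<lambda>n. csqrt (p n) * (1 - \<i>)"])
    show "0 < 8 * pi / sqrt 2" by simp
    fix n :: int
    have "(\<Sum>\<^sub>\<infinity>j. c j * bloch_coeff T \<sigma> y (n + j)) = bloch_coeff T \<sigma> ay n"
      unfolding ay_def by (rule infsumI) (rule bloch_coeff_mult[OF T_pos c_summable alpha_series alpha_cont y B])
    then show "csqrt (p n) * (1 - \<i>) * bloch_coeff T \<sigma> y n = - (of_real (8 * pi / sqrt 2) * (\<Sum>\<^sub>\<infinity>j. c j * bloch_coeff T \<sigma> y (n + j)))"
      using key[of n] by simp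
    \<comment> \<open>Writing csqrt (p n) = a + i b, the imaginary part of \<mu> n is b - a. From
      a^2 - b^2 = \<gamma> >= 0 and a >= 0 it is never positive, and it is negative once 2 a b =
      \<nu> n < 0.\<close>
    define a b where "a = Re (csqrt (p n))" and "b = Im (csqrt (p n))"
    have im: "Im (csqrt (p n) * (1 - \<i>)) = b - a" by (simp add: a_def b_def)
    have square_parts: "Re (w\<^sup>2) = (Re w)\<^sup>2 - (Im w)\<^sup>2" "Im (w\<^sup>2) = 2 * Re w * Im w" for w :: complex
      by (simp_all add: power2_eq_square)
    have "(csqrt (p n))\<^sup>2 = p n" by simp
    then have "Re ((csqrt (p n))\<^sup>2) = \<gamma>" "Im ((csqrt (p n))\<^sup>2) = \<nu> n" by (auto simp: p_def)
    then have ab: "a\<^sup>2 - b\<^sup>2 = \<gamma>" "2 * a * b = \<nu> n"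
      unfolding square_parts a_def b_def by auto
    have a0: "0 \<le> a" using csqrt_principal[of "p n"] by (auto simp: a_def)
    have "b\<^sup>2 \<le> a\<^sup>2" using ab \<gamma> by simp
    then have "b \<le> a" using a0 by (rule power2_le_imp_le)
    then show "Im (csqrt (p n) * (1 - \<i>)) \<le> 0" using im by simp
    \<comment> \<open>The restriction \<sigma> < 2 pi / T makes all frequencies with negative index
      negative.\<close>
    assume "n < 0"
    then have "real_of_int n \<le> -1" by linarith
    then have "2 * pi * of_int n / T \<le> 2 * pi * (-1) / T" using T_pos by (intro divide_right_mono mult_left_mono) auto
    then have "\<nu> n < 0" using \<sigma> by (simp add: \<nu>_def)
    then have "a * b < 0" using ab by simp
    then have "b < a" using a0 by (smt (verit) mult_nonneg_nonneg)
    then show "Im (csqrt (p n) * (1 - \<i>)) < 0" using im by simp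
  qed
  show ?thesis by (rule bloch_coeff_unique[OF T_pos y per fz t])
qed

end

section \<open>A priori estimates\<close>

lemma roots_of_unity_orthogonal:
  fixes m n N :: nat
  assumes "m < N" "n < N"
  defines "\<zeta> \<equiv> \<lambda>j::nat. cis (2 * pi * j / N)"
  shows "(\<Sum>j<N. \<zeta> j ^ m * inverse (\<zeta> j) ^ n) = (if m = n then of_nat N else 0)"
proof (cases "m = n")
  case True
  have "\<zeta> j ^ n * inverse (\<zeta> j) ^ n = 1" for j
  proof -
    have "\<zeta> j * inverse (\<zeta> j) = 1" by (simp add: \<zeta>_def cis_mult)
    then show ?thesis by (simp only: power_mult_distrib[symmetric] power_one)
  qed
  then show ?thesis using True by simp
next
  case False
  define x where "x = cis (2 * pi * (real m - real n) / N)"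
  have N: "0 < N" using assms(1) by simp
  have t: "\<zeta> j ^ m * inverse (\<zeta> j) ^ n = x ^ j" for j
  proof -
    have "\<zeta> j ^ m * inverse (\<zeta> j) ^ n = cis (real m * (2 * pi * j / N)) * cis (real n * - (2 * pi * j / N))"
      by (simp only: \<zeta>_def Complex.DeMoivre cis_inverse)
    also have "\<dots> = cis (real m * (2 * pi * j / N) + real n * - (2 * pi * j / N))" by (simp only: cis_mult)
    also have "real m * (2 * pi * j / N) + real n * - (2 * pi * j / N) = real j * (2 * pi * (real m - real n) / N)"
      using N by (simp add: field_simps)
    also have "cis \<dots> = x ^ j" by (simp only: x_def Complex.DeMoivre)
    finally show ?thesis .
  qed
  have xN: "x ^ N = 1"
  proof -
    have "x ^ N = cis (real N * (2 * pi * (real m - real n) / N))" by (simp only: x_def Complex.DeMoivre)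
    also have "real N * (2 * pi * (real m - real n) / N) = 2 * pi * of_int (int m - int n)" using N by simp
    finally show ?thesis using cis_multiple_2pi[of "of_int (int m - int n)"] by simp
  qed
  have "x \<noteq> 1"
  proof
    assume "x = 1"
    then have "exp (\<i> * of_real (2 * pi * (real m - real n) / N)) = 1" by (simp add: x_def cis_conv_exp)
    then obtain k :: int where "2 * pi * (real m - real n) / N = of_int (2 * k) * pi"
      unfolding exp_eq_1 by auto
    then have "(2 * pi) * (real m - real n) = (2 * pi) * (of_int k * N)" using N by (simp add: field_simps)
    then have "real_of_int (int m - int n) = real_of_int (k * int N)" by (simp del: mult.commute)
    then have mn: "int m - int n = k * int N" by (simp only: of_int_eq_iff)
    moreover have "\<bar>int m - int n\<bar> < int N" using assms by linarith
    ultimately have "\<bar>k\<bar> * int N < 1 * int N" by (simp add: abs_mult)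
    then have "\<bar>k\<bar> < 1" by (simp only: mult_less_cancel_right)
    then show False using mn False by simp
  qed
  then show ?thesis using False xN geometric_sum[of x N] by (simp add: t)
qed

section \<open>Linearity and translation invariance of the regularized operator\<close>

lemma conv_shift: "conv f u (t + a) = conv f (\<lambda>s. u (s + a)) t"
  unfolding conv_def by (simp add: algebra_simps)

lemma conv_cmult: "conv f (\<lambda>s. a * u s) t = a * conv f u t" for a :: complex
proof -
  have "conv f (\<lambda>s. a * u s) t = (LINT x|lborel. a * (f x *\<^sub>R u (t - x)))"
    unfolding conv_def by simp
  then show ?thesis unfolding conv_def integral_mult_right_zero .
qed

lemma conv_sum:
  fixes u :: "'i \<Rightarrow> real \<Rightarrow> complex"
  assumes "good_kernel f" "\<And>i. i \<in> I \<Longrightarrow> u i \<in> borel_measurable borel" "\<And>i t. i \<in> I \<Longrightarrow> norm (u i t) \<le> B"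
  shows "conv f (\<lambda>s. \<Sum>i\<in>I. u i s) t = (\<Sum>i\<in>I. conv f (u i) t)"
  unfolding conv_def scaleR_sum_right
  by (rule Bochner_Integration.integral_sum) (use assms in \<open>auto intro: conv_integrable\<close>)

context ionization
begin

lemma alpha_per_int: "\<alpha> (t + of_int m * T) = \<alpha> t"
proof -
  have nat: "\<alpha> (t + real k * T) = \<alpha> t" for k t
  proof (induction k)
    case (Suc k)
    have "\<alpha> (t + real (Suc k) * T) = \<alpha> ((t + real k * T) + T)" by (simp add: algebra_simps)
    then show ?case using Suc alpha_per by simp
  qed simp
  show ?thesis
  proof (cases "0 \<le> m")
    case True
    then show ?thesis using nat[of t "nat m"] by simp
  next
    case False
    then show ?thesis using nat[of "t + of_int m * T" "nat (- m)"] by simp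
  qed
qed

lemma reg_op_shift: "reg_op \<alpha> \<gamma> v (t + of_int m * T) = reg_op \<alpha> \<gamma> (\<lambda>s. v (s + of_int m * T)) t"
  unfolding reg_op_def conv_shift alpha_per_int ..

lemma reg_op_cmult: "reg_op \<alpha> \<gamma> (\<lambda>s. a * v s) t = a * reg_op \<alpha> \<gamma> v t"
proof -
  have "(\<lambda>s. of_real (\<alpha> s) * (a * v s)) = (\<lambda>s. a * (of_real (\<alpha> s) * v s))" by (simp add: mult_ac)
  then show ?thesis unfolding reg_op_def by (simp add: conv_cmult algebra_simps)
qed

lemma reg_op_sum:
  assumes \<gamma>: "0 \<le> \<gamma>" and I: "finite I" and m: "\<And>i. i \<in> I \<Longrightarrow> u i \<in> borel_measurable borel" and B: "\<And>i t. i \<in> I \<Longrightarrow> norm (u i t) \<le> B"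
  shows "reg_op \<alpha> \<gamma> (\<lambda>s. \<Sum>i\<in>I. u i s) t = (\<Sum>i\<in>I. reg_op \<alpha> \<gamma> (u i) t)"
proof -
  have "(\<lambda>s. of_real (\<alpha> s) * (\<Sum>i\<in>I. u i s)) = (\<lambda>s. \<Sum>i\<in>I. of_real (\<alpha> s) * u i s)" by (simp add: sum_distrib_left)
  moreover have "conv (\<lambda>x. exp (- \<gamma> * x) * mix_kernel x) (\<lambda>s. \<Sum>i\<in>I. u i s) t = (\<Sum>i\<in>I. conv (\<lambda>x. exp (- \<gamma> * x) * mix_kernel x) (u i) t)"
    by (rule conv_sum[OF good_kernel_exp[OF good_kernel_mix_kernel \<gamma>] m B])
  moreover have "conv (\<lambda>x. exp (- \<gamma> * x) * reg_kernel x) (\<lambda>s. \<Sum>i\<in>I. of_real (\<alpha> s) * u i s) t = (\<Sum>i\<in>I. conv (\<lambda>x. exp (- \<gamma> * x) * reg_kernel x) (\<lambda>s. of_real (\<alpha> s) * u i s) t)"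
  proof (rule conv_sum[OF good_kernel_exp[OF good_kernel_reg_kernel \<gamma>]])
    show "(\<lambda>s. of_real (\<alpha> s) * u i s) \<in> borel_measurable borel" if "i \<in> I" for i
      using m[OF that] by measurable
    show "norm (of_real (\<alpha> t) * u i t) \<le> alpha_norm * B" if "i \<in> I" for i t
      by (rule alpha_mult_bound[OF B[OF that]])
  qed
  ultimately show ?thesis unfolding reg_op_def by (simp add: sum.distrib sum_subtractf sum_distrib_left)
qed

section \<open>Compactness: from uniqueness of Bloch solutions to quantitative bounds\<close>

definition bdd_meas :: "(real \<Rightarrow> complex) \<Rightarrow> bool" where
  "bdd_meas v \<longleftrightarrow> v \<in> borel_measurable borel \<and> (\<exists>V. \<forall>t. norm (v t) \<le> V)"

text \<open>A sequence of normalized approximate Bloch solutions would have a limit that is an exact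
  bounded Bloch solution and hence 0. The convergence is uniform on one period, so this contradicts
  the values of modulus at least 1/2 at the points \<open>s k\<close>, which may move with
  k.\<close>

lemma approximate_bloch_limit:
  assumes \<gamma>: "\<And>k. \<gamma> k \<in> {0..\<Gamma>}" and z: "\<And>k. norm (z k) = 1"
    and u[measurable]: "\<And>k. u k \<in> borel_measurable borel" and B: "\<And>k t. norm (u k t) \<le> 1"
    and qp: "\<And>k t. norm (u k (t + T) - z k * u k t) \<le> 1 / real (Suc k)"
    and A: "\<And>k t. norm (reg_op \<alpha> (\<gamma> k) (u k) t) \<le> 1 / real (Suc k)"
    and s: "\<And>k. s k \<in> {0..T}" "\<And>k. 1 / 2 \<le> norm (u k (s k))"
  shows False
proof -
  have "compact ({0..\<Gamma>} \<times> sphere (0::complex) 1)" by (intro compact_Times compact_Icc compact_sphere)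
  moreover have "\<forall>k. (\<gamma> k, z k) \<in> {0..\<Gamma>} \<times> sphere (0::complex) 1" using \<gamma> z by simp
  ultimately obtain l r1 where l: "l \<in> {0..\<Gamma>} \<times> sphere (0::complex) 1" and r1: "strict_mono r1" and lim: "((\<lambda>k. (\<gamma> k, z k)) \<circ> r1) \<longlonglongrightarrow> l"
    by (rule seq_compactE[OF compact_imp_seq_compact])
  define \<gamma>0 z0 where "\<gamma>0 = fst l" and "z0 = snd l"
  have l': "0 \<le> \<gamma>0" "norm z0 = 1" using l by (auto simp: \<gamma>0_def z0_def)
  have lims: "(\<lambda>k. \<gamma> (r1 k)) \<longlonglongrightarrow> \<gamma>0" "(\<lambda>k. z (r1 k)) \<longlonglongrightarrow> z0"
    using tendsto_fst[OF lim] tendsto_snd[OF lim] by (auto simp: o_def \<gamma>0_def z0_def)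
  \<comment> \<open>The functions \<open>u k\<close> need not be continuous. Subtracting the small
    residual leaves a combination of convolutions, which is uniformly Hoelder continuous.\<close>
  define w where "w = (\<lambda>k t. u k t - reg_op \<alpha> (\<gamma> k) (u k) t)"
  have gl: "good_kernel (\<lambda>x. exp (- \<gamma> k * x) * mix_kernel x)" and gs: "good_kernel (\<lambda>x. exp (- \<gamma> k * x) * reg_kernel x)" for k
    using good_kernel_exp[OF good_kernel_mix_kernel, of "\<gamma> k"] good_kernel_exp[OF good_kernel_reg_kernel, of "\<gamma> k"] \<gamma>[of k] by auto
  have aum[measurable]: "(\<lambda>s. of_real (\<alpha> s) * u k s) \<in> borel_measurable borel" for k by measurable
  have auB: "norm (of_real (\<alpha> t) * u k t) \<le> alpha_norm" for k t using alpha_mult_bound[OF B] by simp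
  have w_eq: "w k t = conv (\<lambda>x. exp (- \<gamma> k * x) * mix_kernel x) (u k) t - kappa * conv (\<lambda>x. exp (- \<gamma> k * x) * reg_kernel x) (\<lambda>s. of_real (\<alpha> s) * u k s) t" for k t
    by (simp add: w_def reg_op_def)
  define H where "H = 4 + norm kappa * (4 * alpha_norm)"
  have H0: "0 < H" using alpha_norm_nonneg by (simp add: H_def add_pos_nonneg)
  have hoelder: "norm (w k t' - w k t) \<le> H * sqrt \<bar>t' - t\<bar>" for k t t'
  proof -
    have "w k t' - w k t = (conv (\<lambda>x. exp (- \<gamma> k * x) * mix_kernel x) (u k) t' - conv (\<lambda>x. exp (- \<gamma> k * x) * mix_kernel x) (u k) t)
       - kappa * (conv (\<lambda>x. exp (- \<gamma> k * x) * reg_kernel x) (\<lambda>s. of_real (\<alpha> s) * u k s) t' - conv (\<lambda>x. exp (- \<gamma> k * x) * reg_kernel x) (\<lambda>s. of_real (\<alpha> s) * u k s) t)"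
      unfolding w_eq by (simp add: algebra_simps)
    also have "norm \<dots> \<le> 4 * 1 * sqrt \<bar>t' - t\<bar> + norm kappa * (4 * alpha_norm * sqrt \<bar>t' - t\<bar>)"
      unfolding norm_mult[symmetric]
      by (rule order_trans[OF norm_triangle_ineq4], unfold norm_mult,
          rule add_mono[OF conv_Hoelder[OF gl u B] mult_left_mono[OF conv_Hoelder[OF gs aum auB] norm_ge_zero]])
    finally show ?thesis by (simp add: H_def algebra_simps)
  qed
  obtain g r2 where g: "continuous_on {0..T} g" "strict_mono (r2 :: nat \<Rightarrow> nat)"
    "\<And>e. 0 < e \<Longrightarrow> \<exists>N. \<forall>n x. n \<ge> N \<and> x \<in> {0..T} \<longrightarrow> norm (w (r1 (r2 n)) x - g x) < e"
  proof (rule Arzela_Ascoli[of "{0..T}" "\<lambda>n. w (r1 n)" 2])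
    show "compact {0..T}" by simp
    show "norm (w (r1 n) x) \<le> 2" for n x
    proof -
      have "norm (w (r1 n) x) \<le> norm (u (r1 n) x) + norm (reg_op \<alpha> (\<gamma> (r1 n)) (u (r1 n)) x)"
        unfolding w_def by (rule norm_triangle_ineq4)
      also have "\<dots> \<le> 1 + 1 / real (Suc (r1 n))" by (intro add_mono B A)
      also have "\<dots> \<le> 2" by simp
      finally show ?thesis .
    qed
    fix x e :: real assume e: "0 < e"
    show "\<exists>d>0. \<forall>n y. y \<in> {0..T} \<and> norm (x - y) < d \<longrightarrow> norm (w (r1 n) x - w (r1 n) y) < e"
    proof (intro exI[of _ "(e / H)\<^sup>2"] conjI allI impI)
      show "0 < (e / H)\<^sup>2" using e H0 by simp
      fix n y assume "y \<in> {0..T} \<and> norm (x - y) < (e / H)\<^sup>2"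
      then have "sqrt \<bar>x - y\<bar> < e / H" using e H0 by (simp add: real_less_lsqrt)
      then have "H * sqrt \<bar>x - y\<bar> < e" using H0 by (simp add: field_simps)
      then show "norm (w (r1 n) x - w (r1 n) y) < e" using hoelder[of "r1 n" x y] by linarith
    qed
  qed (rule that)
  define r where "r = r1 \<circ> r2"
  have r: "strict_mono r" unfolding r_def using r1 g(2) by (rule strict_mono_o)
  have inv: "(\<lambda>k. 1 / real (Suc (r k))) \<longlonglongrightarrow> 0"
    using LIMSEQ_subseq_LIMSEQ[OF LIMSEQ_inverse_real_of_nat r] by (simp add: o_def inverse_eq_divide)
  have gr: "(\<lambda>k. \<gamma> (r k)) \<longlonglongrightarrow> \<gamma>0" and zr: "(\<lambda>k. z (r k)) \<longlonglongrightarrow> z0"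
    using LIMSEQ_subseq_LIMSEQ[OF lims(1) g(2)] LIMSEQ_subseq_LIMSEQ[OF lims(2) g(2)] by (auto simp: o_def r_def)
  have Azero: "(\<lambda>k. reg_op \<alpha> (\<gamma> (r k)) (u (r k)) t) \<longlonglongrightarrow> 0" for t
    by (rule Lim_null_comparison[OF always_eventually inv]) (use A in auto)
  have u_lim: "(\<lambda>k. u (r k) t) \<longlonglongrightarrow> g t" if "t \<in> {0..T}" for t
  proof -
    have "(\<lambda>k. w (r k) t) \<longlonglongrightarrow> g t"
      unfolding r_def o_def by (rule LIMSEQ_I) (use g(3) that in blast)
    from tendsto_add[OF this Azero[of t]] show ?thesis by (simp add: w_def)
  qed
  have qzero: "(\<lambda>k. u (r k) (t + T) - z (r k) * u (r k) t) \<longlonglongrightarrow> 0" for t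
    by (rule Lim_null_comparison[OF always_eventually inv]) (use qp in auto)
  have step_up: "convergent (\<lambda>k. u (r k) (t + T))" if "convergent (\<lambda>k. u (r k) t)" for t
  proof -
    from that obtain L where "(\<lambda>k. u (r k) t) \<longlonglongrightarrow> L" by (auto simp: convergent_def)
    from tendsto_add[OF qzero[of t] tendsto_mult[OF zr this]] show ?thesis by (auto simp: convergent_def)
  qed
  \<comment> \<open>The approximate Bloch relation can be solved backwards because the multipliers
    have modulus 1. Together with \<open>step_up\<close> it carries convergence from one period to
    the whole line.\<close>
  have step_down: "convergent (\<lambda>k. u (r k) (t - T))" if "convergent (\<lambda>k. u (r k) t)" for t
  proof -
    from that obtain L where L: "(\<lambda>k. u (r k) t) \<longlonglongrightarrow> L" by (auto simp: convergent_def)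
    have "(\<lambda>k. inverse (z (r k)) * (u (r k) t - (u (r k) ((t - T) + T) - z (r k) * u (r k) (t - T)))) \<longlonglongrightarrow> inverse z0 * (L - 0)"
      by (intro tendsto_intros zr L qzero) (use l' in auto)
    moreover have "z k \<noteq> 0" for k using z[of k] by auto
    ultimately have "(\<lambda>k. u (r k) (t - T)) \<longlonglongrightarrow> inverse z0 * L" by (simp add: field_simps)
    then show ?thesis by (auto simp: convergent_def)
  qed
  have conv_all: "convergent (\<lambda>k. u (r k) t)" for t
  proof -
    have T: "0 < T" by (rule T_pos)
    have period: "convergent (\<lambda>k. u (r k) x)" if "x \<in> {0..T}" for x
      using u_lim[OF that] by (auto simp: convergent_def)
    have all: "convergent (\<lambda>k. u (r k) (x + of_int m * T))" if "x \<in> {0..T}" for x m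
    proof (induction m rule: int_induct[of _ 0])
      case base then show ?case using period[OF that] by simp
    next
      case (step1 i)
      then show ?case using step_up[of "x + of_int i * T"] by (simp add: algebra_simps)
    next
      case (step2 i)
      then show ?case using step_down[of "x + of_int i * T"] by (simp add: algebra_simps)
    qed
    define m where "m = \<lfloor>t / T\<rfloor>"
    have "of_int m * T \<le> t" "t < (of_int m + 1) * T"
      using T floor_divide_lower[of T t] floor_divide_upper[of T t] by (auto simp: m_def)
    then have "t - of_int m * T \<in> {0..T}" by (auto simp: algebra_simps)
    from all[OF this, of m] show ?thesis by simp
  qed
  define y where "y = (\<lambda>t. lim (\<lambda>k. u (r k) t))"
  have ylim: "(\<lambda>k. u (r k) t) \<longlonglongrightarrow> y t" for t
    using conv_all unfolding y_def by (simp add: convergent_LIMSEQ_iff)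
  have ym[measurable]: "y \<in> borel_measurable borel"
    by (rule borel_measurable_LIMSEQ_metric[OF _ ylim]) measurable
  have yB: "norm (y t) \<le> 1" for t
    by (rule LIMSEQ_le_const2[OF tendsto_norm[OF ylim]]) (use B in auto)
  have yper: "y (t + T) = z0 * y t" for t
  proof -
    have "(\<lambda>k. u (r k) (t + T) - z (r k) * u (r k) t) \<longlonglongrightarrow> y (t + T) - z0 * y t"
      by (intro tendsto_intros ylim zr)
    from LIMSEQ_unique[OF this qzero] show ?thesis by simp
  qed
  have gl0: "good_kernel (\<lambda>x. exp (- \<gamma>0 * x) * mix_kernel x)" and gs0: "good_kernel (\<lambda>x. exp (- \<gamma>0 * x) * reg_kernel x)"
    using l'(1) by (rule good_kernel_exp[OF good_kernel_mix_kernel] good_kernel_exp[OF good_kernel_reg_kernel])+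
  have aym[measurable]: "(\<lambda>s. of_real (\<alpha> s) * y s) \<in> borel_measurable borel" by measurable
  have ayB: "norm (of_real (\<alpha> t) * y t) \<le> alpha_norm" for t using alpha_mult_bound[OF yB] by simp
  have yA: "reg_op \<alpha> \<gamma>0 y t = 0" for t
  proof -
    have "(\<lambda>k. conv (\<lambda>x. exp (- \<gamma> (r k) * x) * mix_kernel x) (u (r k)) t) \<longlonglongrightarrow> conv (\<lambda>x. exp (- \<gamma>0 * x) * mix_kernel x) y t"
      by (rule conv_tendsto[OF gl _ u ym B]) (use good_kernelD(1)[OF gl0] in \<open>auto intro!: tendsto_intros gr ylim\<close>)
    moreover have "(\<lambda>k. conv (\<lambda>x. exp (- \<gamma> (r k) * x) * reg_kernel x) (\<lambda>s. of_real (\<alpha> s) * u (r k) s) t) \<longlonglongrightarrow> conv (\<lambda>x. exp (- \<gamma>0 * x) * reg_kernel x) (\<lambda>s. of_real (\<alpha> s) * y s) t"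
      by (rule conv_tendsto[OF gs _ aum aym auB]) (use good_kernelD(1)[OF gs0] in \<open>auto intro!: tendsto_intros gr ylim\<close>)
    ultimately have "(\<lambda>k. reg_op \<alpha> (\<gamma> (r k)) (u (r k)) t) \<longlonglongrightarrow> reg_op \<alpha> \<gamma>0 y t"
      unfolding reg_op_def by (intro tendsto_intros ylim)
    from LIMSEQ_unique[OF this Azero] show ?thesis .
  qed
  \<comment> \<open>A pointwise limit is only measurable; continuity comes from the limit equation,
    which expresses y by its own convolutions.\<close>
  have yc: "continuous_on UNIV y"
  proof -
    have eq: "y = (\<lambda>t. conv (\<lambda>x. exp (- \<gamma>0 * x) * mix_kernel x) y t - kappa * conv (\<lambda>x. exp (- \<gamma>0 * x) * reg_kernel x) (\<lambda>s. of_real (\<alpha> s) * y s) t)"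
      using yA unfolding reg_op_def by (auto simp: algebra_simps add_eq_0_iff)
    have "continuous_on UNIV (\<lambda>t. conv (\<lambda>x. exp (- \<gamma>0 * x) * mix_kernel x) y t - kappa * conv (\<lambda>x. exp (- \<gamma>0 * x) * reg_kernel x) (\<lambda>s. of_real (\<alpha> s) * y s) t)"
      by (intro continuous_on_diff continuous_on_mult_left conv_continuous[OF gl0 ym yB] conv_continuous[OF gs0 aym ayB])
    then show ?thesis by (rule iffD2[OF arg_cong[OF eq, of "continuous_on UNIV"]])
  qed
  \<comment> \<open>The argument is taken in [0, 2 pi), which is the range of \<sigma> that makes
    exactly the negative indices dissipative in \<open>bloch_solution_trivial\<close>.\<close>
  define \<sigma> where "\<sigma> = Arg2pi z0 / T"
  have z0_exp: "exp (\<i> * of_real (\<sigma> * T)) = z0"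
    using Arg2pi_eq[of z0] l'(2) T_pos by (simp add: \<sigma>_def)
  have sig: "0 \<le> \<sigma>" "\<sigma> < 2 * pi / T"
    using Arg2pi_ge_0[of z0] Arg2pi_lt_2pi[of z0] T_pos by (auto simp: \<sigma>_def divide_strict_right_mono)
  have y0: "y t = 0" if "t \<in> {0..T}" for t
    by (rule bloch_solution_trivial[OF l'(1) yc yB _ sig yA that]) (simp only: z0_exp yper)
  \<comment> \<open>Uniform closeness of w to g, the vanishing of g, and a residual below 1/8 bound
    the value at the moving point by 1/4.\<close>
  obtain N1 where N1: "\<And>n x. n \<ge> N1 \<Longrightarrow> x \<in> {0..T} \<Longrightarrow> norm (w (r n) x - g x) < 1 / 8"
    using g(3)[of "1/8"] unfolding r_def o_def by auto
  obtain N2 where N2: "\<And>n. n \<ge> N2 \<Longrightarrow> 1 / real (Suc (r n)) < 1 / 8"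
    using order_tendstoD(2)[OF inv, of "1/8"] unfolding eventually_sequentially by auto
  define n where "n = max N1 N2"
  have sn: "s (r n) \<in> {0..T}" by (rule s)
  have "g (s (r n)) = 0" using LIMSEQ_unique[OF u_lim[OF sn] ylim] y0[OF sn] by simp
  then have "norm (w (r n) (s (r n))) < 1 / 8" using N1[of n "s (r n)"] sn by (simp add: n_def)
  moreover have "norm (u (r n) (s (r n))) \<le> norm (w (r n) (s (r n))) + norm (reg_op \<alpha> (\<gamma> (r n)) (u (r n)) (s (r n)))"
    unfolding w_def by (metis diff_add_cancel norm_triangle_ineq)
  moreover have "norm (reg_op \<alpha> (\<gamma> (r n)) (u (r n)) (s (r n))) < 1 / 8"
    by (rule le_less_trans[OF A N2]) (simp add: n_def)
  ultimately show False using s(2)[of "r n"] by linarith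
qed

text \<open>If every constant failed, the constants k + 1 would give counterexamples. Dividing by
  the supremum and translating a near-maximum into one period by a multiple of T turns them into the
  sequence excluded by \<open>approximate_bloch_limit\<close>.\<close>

lemma bloch_estimate:
  "\<exists>C>0. \<forall>\<gamma> z v E. \<gamma> \<in> {0..\<Gamma>} \<longrightarrow> norm z = 1 \<longrightarrow> bdd_meas v \<longrightarrow> (\<forall>t. norm (v (t + T) - z * v t) \<le> E)
     \<longrightarrow> (\<forall>t. norm (reg_op \<alpha> \<gamma> v t) \<le> E) \<longrightarrow> (\<forall>t. norm (v t) \<le> C * E)"
proof (rule ccontr)
  assume neg: "\<not> ?thesis"
  have "\<exists>\<gamma> z u s. \<gamma> \<in> {0..\<Gamma>} \<and> norm z = 1 \<and> u \<in> borel_measurable borel \<and> (\<forall>t. norm (u t) \<le> 1)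
     \<and> (\<forall>t. norm (u (t + T) - z * u t) \<le> 1 / real (Suc k)) \<and> (\<forall>t. norm (reg_op \<alpha> \<gamma> u t) \<le> 1 / real (Suc k))
     \<and> s \<in> {0..T} \<and> 1 / 2 \<le> norm (u s)" for k :: nat
  proof -
    have "0 < real (Suc k)" by simp
    with neg obtain \<gamma> z v E t0 where *: "\<gamma> \<in> {0..\<Gamma>}" "norm z = 1" "bdd_meas v"
      "\<And>t. norm (v (t + T) - z * v t) \<le> E" "\<And>t. norm (reg_op \<alpha> \<gamma> v t) \<le> E" "real (Suc k) * E < norm (v t0)"
      by (metis linorder_not_le)
    have E0: "0 \<le> E" using order_trans[OF norm_ge_zero *(4)] .
    from *(3) have vm[measurable]: "v \<in> borel_measurable borel" and "\<exists>V. \<forall>t. norm (v t) \<le> V" by (auto simp: bdd_meas_def)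
    then have bdd: "bdd_above (range (\<lambda>t. norm (v t)))" by (auto simp: bdd_above_def)
    define V where "V = (SUP t. norm (v t))"
    have vV: "norm (v t) \<le> V" for t unfolding V_def by (rule cSUP_upper[OF _ bdd]) simp
    have V: "real (Suc k) * E < V" using *(6) vV[of t0] by linarith
    have V0: "0 < V" using V E0 by (smt (verit) mult_nonneg_nonneg of_nat_0_le_iff)
    have "V / 2 < V" using V0 by simp
    then obtain t1 where t1: "V / 2 < norm (v t1)"
      using less_cSUP_iff[of UNIV "\<lambda>t. norm (v t)" "V / 2", OF _ bdd] unfolding V_def[symmetric] by auto
    \<comment> \<open>A translation by a multiple of T commutes with the operator, because \<alpha>
      has period T.\<close>
    define m where "m = \<lfloor>t1 / T\<rfloor>"
    define u where "u = (\<lambda>s. of_real (inverse V) * v (s + of_int m * T))"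
    have iV: "norm (complex_of_real (inverse V)) = inverse V"
      unfolding norm_of_real using V0 by simp
    have EV: "inverse V * E \<le> 1 / real (Suc k)"
      using V V0 by (simp add: field_simps)
    have "u \<in> borel_measurable borel" unfolding u_def by measurable
    moreover have "norm (u t) \<le> 1" for t
      unfolding u_def norm_mult iV using vV[of "t + of_int m * T"] V0 by (simp add: field_simps)
    moreover have "norm (u (t + T) - z * u t) \<le> 1 / real (Suc k)" for t
    proof -
      have "u (t + T) - z * u t = of_real (inverse V) * (v ((t + of_int m * T) + T) - z * v (t + of_int m * T))"
        by (simp add: u_def algebra_simps)
      then have "norm (u (t + T) - z * u t) = inverse V * norm (v ((t + of_int m * T) + T) - z * v (t + of_int m * T))"
        by (simp only: norm_mult iV)
      also have "\<dots> \<le> inverse V * E" using V0 *(4) by (intro mult_left_mono) auto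
      finally show ?thesis using EV by linarith
    qed
    moreover have "norm (reg_op \<alpha> \<gamma> u t) \<le> 1 / real (Suc k)" for t
    proof -
      have "reg_op \<alpha> \<gamma> u t = of_real (inverse V) * reg_op \<alpha> \<gamma> v (t + of_int m * T)"
        unfolding u_def reg_op_cmult reg_op_shift ..
      then have "norm (reg_op \<alpha> \<gamma> u t) = inverse V * norm (reg_op \<alpha> \<gamma> v (t + of_int m * T))"
        by (simp only: norm_mult iV)
      also have "\<dots> \<le> inverse V * E" using V0 *(5) by (intro mult_left_mono) auto
      finally show ?thesis using EV by linarith
    qed
    moreover have "t1 - of_int m * T \<in> {0..T}"
    proof -
      have "of_int m * T \<le> t1" "t1 < (of_int m + 1) * T"
        using T_pos floor_divide_lower[of T t1] floor_divide_upper[of T t1] by (auto simp: m_def)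
      then show ?thesis by (auto simp: algebra_simps)
    qed
    moreover have "1 / 2 \<le> norm (u (t1 - of_int m * T))"
      unfolding u_def norm_mult iV using t1 V0 by (simp add: field_simps)
    ultimately show ?thesis using *(1,2) by blast
  qed
  then obtain \<gamma> z u s where "\<And>k. \<gamma> k \<in> {0..\<Gamma>} \<and> norm (z k) = 1 \<and> u k \<in> borel_measurable borel \<and> (\<forall>t. norm (u k t) \<le> 1)
     \<and> (\<forall>t. norm (u k (t + T) - z k * u k t) \<le> 1 / real (Suc k)) \<and> (\<forall>t. norm (reg_op \<alpha> (\<gamma> k) (u k) t) \<le> 1 / real (Suc k))
     \<and> s k \<in> {0..T} \<and> 1 / 2 \<le> norm (u k (s k))"
    by metis
  then show False
    by (intro approximate_bloch_limit[of \<gamma> \<Gamma> z u s]) blast+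
qed

text \<open>Passing from approximate Bloch functions to arbitrary bounded functions: a Fejer-type average
  of the translates of \<open>w\<close> is an approximate Bloch function, and averaging it over the \<open>N\<close>-th roots of
  unity returns \<open>w\<close>.\<close>
lemma apriori_estimate:
  "\<exists>C>0. \<forall>\<gamma> w E. \<gamma> \<in> {0..\<Gamma>} \<longrightarrow> bdd_meas w \<longrightarrow> (\<forall>t. norm (reg_op \<alpha> \<gamma> w t) \<le> E) \<longrightarrow> (\<forall>t. norm (w t) \<le> C * E)"
proof -
  obtain C where C: "0 < C" and bloch: "\<And>\<gamma> z v E t. \<gamma> \<in> {0..\<Gamma>} \<Longrightarrow> norm z = 1 \<Longrightarrow> bdd_meas v \<Longrightarrow> (\<And>t. norm (v (t + T) - z * v t) \<le> E)
     \<Longrightarrow> (\<And>t. norm (reg_op \<alpha> \<gamma> v t) \<le> E) \<Longrightarrow> norm (v t) \<le> C * E"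
    using bloch_estimate[of \<Gamma>] by meson
  \<comment> \<open>The bound 8 C^2 <= N makes the coefficient 4 C^2 / N of the supremum W at most
    1/2, so that W can be absorbed at the end.\<close>
  define N where "N = nat \<lceil>8 * C\<^sup>2\<rceil> + 1"
  have N: "0 < N" "8 * C\<^sup>2 \<le> real N" unfolding N_def by linarith+
  \<comment> \<open>Twice the coefficient of E that remains after inserting the bound on P into the
    bound on v; the factor 2 comes from absorbing W / 2.\<close>
  define C' where "C' = 2 * (2 * C\<^sup>2 + C * real N)"
  have C': "0 < C'" using C N by (simp add: C'_def add_pos_pos)
  show ?thesis
  proof (intro exI[of _ C'] conjI allI impI)
    show "0 < C'" by (rule C')
    fix \<gamma> w E t
    assume \<gamma>: "\<gamma> \<in> {0..\<Gamma>}" and bw: "bdd_meas w" and A: "\<forall>t. norm (reg_op \<alpha> \<gamma> w t) \<le> E"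
    from \<gamma> have \<gamma>0: "0 \<le> \<gamma>" by simp
    from bw have wm[measurable]: "w \<in> borel_measurable borel" and "\<exists>V. \<forall>t. norm (w t) \<le> V" by (auto simp: bdd_meas_def)
    then have bdd: "bdd_above (range (\<lambda>t. norm (w t)))" by (auto simp: bdd_above_def)
    define W where "W = (SUP t. norm (w t))"
    have wW: "norm (w t) \<le> W" for t unfolding W_def by (rule cSUP_upper[OF _ bdd]) simp
    have W0: "0 \<le> W" using order_trans[OF norm_ge_zero wW] .
    have E0: "0 \<le> E" using order_trans[OF norm_ge_zero] A by blast
    \<comment> \<open>The Bloch defect of this unnormalized sum telescopes to two boundary terms, so
      it is at most 2 W however large N is; only the bound on the residual grows with N.\<close>
    define P where "P = (\<lambda>z t. \<Sum>n<N. inverse z ^ n * w (t + of_int (int n) * T))"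
    \<comment> \<open>Averaging P over backward translates telescopes a second time. The division by
      N makes the new defect small, which a single average would not achieve since its boundary
      terms are compared with W itself.\<close>
    define v where "v = (\<lambda>z t. \<Sum>m<N. (z ^ m / of_nat N) * P z (t + of_int (- int m) * T))"
    have [measurable]: "P z \<in> borel_measurable borel" for z unfolding P_def by measurable
    have [measurable]: "v z \<in> borel_measurable borel" for z unfolding v_def by measurable
    have PB: "norm (P z t) \<le> real N * W" if z: "norm z = 1" for z t
    proof -
      have "norm (P z t) \<le> (\<Sum>n<N. W)" unfolding P_def
        by (rule sum_norm_le) (use wW z in \<open>auto simp: norm_mult norm_power norm_inverse\<close>)
      then show ?thesis by simp
    qed
    have PT: "norm (P z (t + T) - z * P z t) \<le> 2 * W" if z: "norm z = 1" for z t
    proof -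
      have z0: "z \<noteq> 0" using z by auto
      define f where "f = (\<lambda>n. inverse z ^ n * w (t + of_int (int n) * T))"
      have "P z (t + T) - z * P z t = (\<Sum>n<N. z * (f (Suc n) - f n))"
        unfolding P_def sum_distrib_left sum_subtractf[symmetric]
        by (intro sum.cong refl) (use z0 in \<open>simp add: f_def algebra_simps\<close>)
      also have "\<dots> = z * (f N - f 0)"
        by (simp only: sum_distrib_left[symmetric] sum_lessThan_telescope)
      finally have "norm (P z (t + T) - z * P z t) = norm (f N - f 0)" by (simp add: norm_mult z)
      also have "\<dots> \<le> norm (f N) + norm (f 0)" by (rule norm_triangle_ineq4)
      also have "\<dots> \<le> W + W"
        by (intro add_mono) (use wW z in \<open>auto simp: f_def norm_mult norm_power norm_inverse\<close>)
      finally show ?thesis by simp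
    qed
    have PA: "norm (reg_op \<alpha> \<gamma> (P z) t) \<le> real N * E" if z: "norm z = 1" for z t
    proof -
      have "reg_op \<alpha> \<gamma> (P z) t = (\<Sum>n<N. reg_op \<alpha> \<gamma> (\<lambda>t. inverse z ^ n * w (t + of_int (int n) * T)) t)"
        unfolding P_def
        by (rule reg_op_sum[OF \<gamma>0, where B = W]) (use wW z in \<open>auto simp: norm_mult norm_power norm_inverse\<close>)
      also have "norm \<dots> \<le> (\<Sum>n<N. E)"
        by (rule sum_norm_le) (use A z in \<open>auto simp only: reg_op_cmult reg_op_shift[symmetric] norm_mult norm_power norm_inverse, simp\<close>)
      finally show ?thesis by simp
    qed
    define E1 where "E1 = 2 * W + real N * E"
    have PC: "norm (P z t) \<le> C * E1" if z: "norm z = 1" for z t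
    proof (rule bloch[OF \<gamma> z])
      show "bdd_meas (P z)" unfolding bdd_meas_def using PB[OF z] by auto
      show "norm (P z (t + T) - z * P z t) \<le> E1" for t using PT[OF z, of t] E0 by (simp add: E1_def add_increasing2)
      show "norm (reg_op \<alpha> \<gamma> (P z) t) \<le> E1" for t using PA[OF z, of t] W0 by (simp add: E1_def add_increasing)
    qed
    have vB: "norm ((z ^ m / of_nat N) * P z s) \<le> C * E1 / N" if z: "norm z = 1" for z m s
      using PC[OF z, of s] N z by (simp add: norm_mult norm_divide norm_power divide_right_mono)
    have vT: "norm (v z (t + T) - z * v z t) \<le> 2 * (C * E1) / N" if z: "norm z = 1" for z t
    proof -
      define h where "h = (\<lambda>m. (z ^ m / of_nat N) * P z (t + T + of_int (- int m) * T))"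
      have "v z (t + T) - z * v z t = (\<Sum>m<N. h m - h (Suc m))"
        unfolding v_def sum_distrib_left sum_subtractf[symmetric]
        by (intro sum.cong refl) (simp add: h_def algebra_simps)
      also have "\<dots> = h 0 - h N" by (rule sum_lessThan_telescope')
      also have "norm \<dots> \<le> norm (h 0) + norm (h N)" by (rule norm_triangle_ineq4)
      also have "\<dots> \<le> C * E1 / N + C * E1 / N" unfolding h_def by (intro add_mono vB z)
      finally show ?thesis by simp
    qed
    have vA: "norm (reg_op \<alpha> \<gamma> (v z) t) \<le> real N * E" if z: "norm z = 1" for z t
    proof -
      have "reg_op \<alpha> \<gamma> (v z) t = (\<Sum>m<N. reg_op \<alpha> \<gamma> (\<lambda>t. (z ^ m / of_nat N) * P z (t + of_int (- int m) * T)) t)"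
        unfolding v_def by (rule reg_op_sum[OF \<gamma>0, where B = "C * E1 / N"]) (use vB[OF z] in auto)
      also have "\<dots> = (\<Sum>m<N. (z ^ m / of_nat N) * reg_op \<alpha> \<gamma> (P z) (t + of_int (- int m) * T))"
        by (simp only: reg_op_cmult reg_op_shift)
      also have "norm \<dots> \<le> (\<Sum>m<N. E)"
      proof (rule sum_norm_le)
        fix m
        have "norm ((z ^ m / of_nat N) * reg_op \<alpha> \<gamma> (P z) (t + of_int (- int m) * T)) = norm (reg_op \<alpha> \<gamma> (P z) (t + of_int (- int m) * T)) / N"
          by (simp only: norm_mult norm_divide norm_power z norm_of_nat) simp
        also have "\<dots> \<le> real N * E / N" by (intro divide_right_mono PA z) simp
        finally show "norm ((z ^ m / of_nat N) * reg_op \<alpha> \<gamma> (P z) (t + of_int (- int m) * T)) \<le> E" using N by simp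
      qed
      finally show ?thesis by simp
    qed
    have E10: "0 \<le> C * E1 / N" using C W0 E0 by (simp add: E1_def)
    have vC: "norm (v z t) \<le> C * (2 * (C * E1) / N + real N * E)" if z: "norm z = 1" for z t
    proof (rule bloch[OF \<gamma> z])
      have "norm (v z t) \<le> (\<Sum>m<N. C * E1 / N)" for t
        unfolding v_def by (rule sum_norm_le) (rule vB[OF z])
      then show "bdd_meas (v z)" unfolding bdd_meas_def by auto
      show "norm (v z (t + T) - z * v z t) \<le> 2 * (C * E1) / N + real N * E" for t
        using vT[OF z, of t] E0 by (simp add: add_increasing2)
      show "norm (reg_op \<alpha> \<gamma> (v z) t) \<le> 2 * (C * E1) / N + real N * E" for t
        using vA[OF z, of t] E10 by (simp add: add_increasing)
    qed
    have "C * (2 * (C * E1) / N + real N * E) = (4 * C\<^sup>2 / N) * W + (2 * C\<^sup>2 + C * real N) * E"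
      using N by (simp add: E1_def field_simps power2_eq_square)
    also have "\<dots> \<le> (1 / 2) * W + (C' / 2) * E"
    proof -
      have "4 * C\<^sup>2 / N \<le> 1 / 2" using N by (simp add: field_simps)
      then show ?thesis unfolding C'_def using W0 E0 by (intro add_mono mult_right_mono) auto
    qed
    finally have small: "C * (2 * (C * E1) / N + real N * E) \<le> W / 2 + C' / 2 * E" by simp
    \<comment> \<open>Summing over the roots of unity keeps only the pairs m = n, in which the
      forward and the backward translation cancel.\<close>
    have avg: "(\<Sum>j<N. v (cis (2 * pi * real j / N)) t) = of_nat N * w t" for t
    proof -
      define \<zeta> where "\<zeta> = (\<lambda>j::nat. cis (2 * pi * real j / N))"
      have "(\<Sum>j<N. v (\<zeta> j) t) = (\<Sum>j<N. \<Sum>m<N. \<Sum>n<N. (\<zeta> j ^ m * inverse (\<zeta> j) ^ n) * (w (t + of_int (- int m) * T + of_int (int n) * T) / of_nat N))"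
        unfolding v_def P_def by (simp add: sum_distrib_left mult_ac)
      also have "\<dots> = (\<Sum>m<N. \<Sum>n<N. \<Sum>j<N. (\<zeta> j ^ m * inverse (\<zeta> j) ^ n) * (w (t + of_int (- int m) * T + of_int (int n) * T) / of_nat N))"
      proof -
        have "(\<Sum>j<N. \<Sum>m<N. \<Sum>n<N. F j m n) = (\<Sum>m<N. \<Sum>n<N. \<Sum>j<N. F j m n)" for F :: "nat \<Rightarrow> nat \<Rightarrow> nat \<Rightarrow> complex"
        proof -
          have "(\<Sum>j<N. \<Sum>m<N. \<Sum>n<N. F j m n) = (\<Sum>m<N. \<Sum>j<N. \<Sum>n<N. F j m n)" by (rule sum.swap)
          also have "\<dots> = (\<Sum>m<N. \<Sum>n<N. \<Sum>j<N. F j m n)" by (intro sum.cong refl sum.swap)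
          finally show ?thesis .
        qed
        then show ?thesis .
      qed
      also have "\<dots> = (\<Sum>m<N. \<Sum>n<N. (if m = n then of_nat N else 0) * (w (t + of_int (- int m) * T + of_int (int n) * T) / of_nat N))"
        unfolding sum_distrib_right[symmetric]
        by (intro sum.cong refl) (simp only: \<zeta>_def roots_of_unity_orthogonal lessThan_iff)
      also have "\<dots> = (\<Sum>m<N. w t)"
      proof (rule sum.cong[OF refl])
        fix m assume m: "m \<in> {..<N}"
        have "(\<Sum>n<N. (if m = n then of_nat N else 0) * (w (t + of_int (- int m) * T + of_int (int n) * T) / of_nat N))
           = (\<Sum>n<N. if m = n then w t else 0)"
          by (intro sum.cong refl) (use N in auto)
        also have "\<dots> = w t" using m by simp
        finally show "(\<Sum>n<N. (if m = n then of_nat N else 0) * (w (t + of_int (- int m) * T + of_int (int n) * T) / of_nat N)) = w t" .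
      qed
      finally show ?thesis by (simp add: \<zeta>_def)
    qed
    have wle: "norm (w t) \<le> W / 2 + C' / 2 * E" for t
    proof -
      have "real N * norm (w t) = norm (of_nat N * w t)" by (simp add: norm_mult)
      also have "\<dots> = norm (\<Sum>j<N. v (cis (2 * pi * real j / N)) t)" by (simp only: avg)
      also have "\<dots> \<le> (\<Sum>j<N. W / 2 + C' / 2 * E)"
        by (rule sum_norm_le) (rule order_trans[OF vC small], simp)
      also have "\<dots> = real N * (W / 2 + C' / 2 * E)" by simp
      finally show ?thesis using N by simp
    qed
    \<comment> \<open>Absorption is legitimate because W is finite: w is bounded by
      assumption.\<close>
    have "W \<le> W / 2 + C' / 2 * E" unfolding W_def by (rule cSUP_least) (use wle W_def in auto)
    then have "W \<le> C' * E" by simp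
    then show "norm (w t) \<le> C' * E" using wW[of t] by linarith
  qed
qed

end

section \<open>The free evolution of the bound state at the origin\<close>

text \<open>Polar coordinates for radial functions. Both measures are compared on half-lines, where
  the left one is the volume of a ball and the right one an elementary integral.\<close>

lemma distr_norm_lborel3:
  "distr (lborel :: (real^3) measure) borel norm = density lborel (\<lambda>r. ennreal (indicator {0<..} r * (4 * pi * r\<^sup>2)))"
  (is "?M = ?N")
proof (rule measure_eqI_generator_eq[where E = "range (\<lambda>a::real. {..a})" and \<Omega> = UNIV and A = "\<lambda>i::nat. {..real i}"])
  have em: "emeasure ?M {..a} = (if 0 \<le> a then ennreal (4 / 3 * pi * a ^ 3) else 0)" for a
  proof -
    have "emeasure ?M {..a} = emeasure lborel {y :: real^3. norm y \<le> a}"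
      by (subst emeasure_distr) (auto intro!: arg_cong[where f = "emeasure lborel"])
    also have "{y :: real^3. norm y \<le> a} = cball 0 a" by (auto simp: cball_def)
    also have "emeasure lborel (cball (0::real^3) a) = (if 0 \<le> a then ennreal (4 / 3 * pi * a ^ 3) else 0)"
      by (auto simp: emeasure_cball unit_ball_vol_3)
    finally show ?thesis .
  qed
  have en: "emeasure ?N {..a} = (if 0 \<le> a then ennreal (4 / 3 * pi * a ^ 3) else 0)" for a
  proof (cases "0 \<le> a")
    case True
    have "emeasure ?N {..a} = (\<integral>\<^sup>+r. ennreal (4 * pi * r\<^sup>2) * indicator {0..a} r \<partial>lborel)"
      by (subst emeasure_density) (auto intro!: nn_integral_cong simp: indicator_def)
    also have "\<dots> = ennreal (4 / 3 * pi * a ^ 3 - 4 / 3 * pi * 0 ^ 3)"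
      by (rule nn_integral_FTC_Icc[where F = "\<lambda>r. 4 / 3 * pi * r ^ 3"])
        (use True in \<open>auto intro!: derivative_eq_intros simp: power2_eq_square power3_eq_cube\<close>)
    finally show ?thesis using True by simp
  next
    case False
    have "emeasure ?N {..a} = (\<integral>\<^sup>+r. ennreal (indicator {0<..} r * (4 * pi * r\<^sup>2)) * indicator {..a} r \<partial>lborel)"
      by (subst emeasure_density) auto
    also have "\<dots> = (\<integral>\<^sup>+(r::real). 0 \<partial>lborel)"
      by (rule nn_integral_cong) (use False in \<open>auto simp: indicator_def\<close>)
    finally show ?thesis using False by simp
  qed
  show "\<And>X. X \<in> range (\<lambda>a::real. {..a}) \<Longrightarrow> emeasure ?M X = emeasure ?N X" using em en by auto
  show "emeasure ?M {..real i} \<noteq> \<infinity>" for i :: nat unfolding em by simp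
  show "Int_stable (range (\<lambda>a::real. {..a}))"
    by (auto simp: Int_stable_def)
  show "sets ?M = sigma_sets UNIV (range (\<lambda>a::real. {..a}))" "sets ?N = sigma_sets UNIV (range (\<lambda>a::real. {..a}))"
    by (simp_all add: borel_eq_atMost)
  show "(\<Union>i::nat. {..real i}) = UNIV" by (auto intro: real_arch_simple)
qed auto

lemma radial_integral:
  fixes f :: "real \<Rightarrow> complex"
  assumes [measurable]: "f \<in> borel_measurable borel"
  shows "(LINT y|(lborel :: (real^3) measure). f (norm y)) = (LINT r|lborel. (indicator {0<..} r * (4 * pi * r\<^sup>2)) *\<^sub>R f r)"
proof -
  have "(LINT y|(lborel :: (real^3) measure). f (norm y)) = (LINT r|distr (lborel :: (real^3) measure) borel norm. f r)"
    by (rule integral_distr[symmetric]) auto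
  also have "\<dots> = (LINT r|lborel. (indicator {0<..} r * (4 * pi * r\<^sup>2)) *\<^sub>R f r)"
    unfolding distr_norm_lborel3 by (rule integral_density) auto
  finally show ?thesis .
qed

section \<open>Oscillatory radial integrals for the bound state\<close>

lemma exp_decay_integrals:
  fixes b :: real
  assumes b: "0 < b"
  shows "set_integrable lborel {0<..} (\<lambda>r. exp (- b * r))" "(LINT r:{0<..}|lborel. exp (- b * r)) = 1 / b"
    and "set_integrable lborel {0<..} (\<lambda>r. r * exp (- b * r))" "(LINT r:{0<..}|lborel. r * exp (- b * r)) = 1 / b\<^sup>2"
proof -
  have pc: "einterval (ereal 0) \<infinity> = {0<..}" by (auto simp: einterval_def)
  have "((\<lambda>x. - exp (- b * x) / b) \<longlongrightarrow> 0) at_top" using b by real_asymp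
  then have l1: "(((\<lambda>x. - exp (- b * x) / b) \<circ> real_of_ereal) \<longlongrightarrow> 0) (at_left \<infinity>)" by (simp add: ereal_tendsto_simps)
  have "((\<lambda>x. - exp (- b * x) / b) \<longlongrightarrow> - exp (- b * 0) / b) (at_right 0)" using b by (intro tendsto_intros) auto
  then have l0: "(((\<lambda>x. - exp (- b * x) / b) \<circ> real_of_ereal) \<longlongrightarrow> - 1 / b) (at_right (ereal 0))" by (simp add: ereal_tendsto_simps)
  have d: "DERIV (\<lambda>x. - exp (- b * x) / b) x :> exp (- b * x)" for x
    using b by (auto intro!: derivative_eq_intros simp: field_simps)
  note F1 = interval_integral_FTC_nonneg[of "ereal 0" \<infinity> "\<lambda>x. - exp (- b * x) / b" "\<lambda>x. exp (- b * x)" "- 1 / b" 0]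
  show "set_integrable lborel {0<..} (\<lambda>r. exp (- b * r))" "(LINT r:{0<..}|lborel. exp (- b * r)) = 1 / b"
    using F1 d l0 l1 unfolding pc by (auto simp: interval_lebesgue_integral_def pc)
  have "((\<lambda>x. - (x / b + 1 / b\<^sup>2) * exp (- b * x)) \<longlongrightarrow> 0) at_top" using b by real_asymp
  then have m1: "(((\<lambda>x. - (x / b + 1 / b\<^sup>2) * exp (- b * x)) \<circ> real_of_ereal) \<longlongrightarrow> 0) (at_left \<infinity>)" by (simp add: ereal_tendsto_simps)
  have "((\<lambda>x. - (x / b + 1 / b\<^sup>2) * exp (- b * x)) \<longlongrightarrow> - (0 / b + 1 / b\<^sup>2) * exp (- b * 0)) (at_right 0)" using b by (intro tendsto_intros) auto
  then have m0: "(((\<lambda>x. - (x / b + 1 / b\<^sup>2) * exp (- b * x)) \<circ> real_of_ereal) \<longlongrightarrow> - 1 / b\<^sup>2) (at_right (ereal 0))" by (simp add: ereal_tendsto_simps)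
  have e: "DERIV (\<lambda>x. - (x / b + 1 / b\<^sup>2) * exp (- b * x)) x :> x * exp (- b * x)" for x
    using b by (auto intro!: derivative_eq_intros simp: field_simps power2_eq_square)
  have nn: "AE x in lborel. ereal 0 < ereal x \<longrightarrow> ereal x < \<infinity> \<longrightarrow> 0 \<le> x * exp (- b * x)" by (intro AE_I2) auto
  note F2 = interval_integral_FTC_nonneg[of "ereal 0" \<infinity> "\<lambda>x. - (x / b + 1 / b\<^sup>2) * exp (- b * x)" "\<lambda>x. x * exp (- b * x)" "- 1 / b\<^sup>2" 0, OF _ _ _ nn]
  show "set_integrable lborel {0<..} (\<lambda>r. r * exp (- b * r))" "(LINT r:{0<..}|lborel. r * exp (- b * r)) = 1 / b\<^sup>2"
    using F2 e m0 m1 unfolding pc by (auto simp: interval_lebesgue_integral_def pc)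
qed

text \<open>The bound 1 / b^2 ignores the oscillation. The bound 4 \<tau> comes from one integration
  by parts: a boundary term of modulus 2 \<tau> and a remainder 2 \<tau> b times an integral of
  modulus at most 1 / b. The second bound softens the singularity of the propagator at \<tau> = 0,
  the first is used for large \<tau>.\<close>

lemma oscillatory_integral_bound:
  fixes b \<tau> :: real
  assumes b: "0 < b" and \<tau>: "0 < \<tau>"
  shows "norm (LINT r:{0<..}|lborel. of_real (r * exp (- b * r)) * exp (\<i> * of_real (r\<^sup>2 / (4 * \<tau>)))) \<le> min (4 * \<tau>) (1 / b\<^sup>2)"
proof -
  note X = exp_decay_integrals[OF b]
  define e where "e = (\<lambda>r::real. exp (\<i> * of_real (r\<^sup>2 / (4 * \<tau>))))"
  have ne: "norm (e r) = 1" for r unfolding e_def norm_exp_i_times ..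
  have em[measurable]: "e \<in> borel_measurable borel" unfolding e_def by measurable
  define f0 f1 where "f0 = (\<lambda>r. of_real (exp (- b * r)) * e r)" and "f1 = (\<lambda>r. of_real (r * exp (- b * r)) * e r)"
  have i0: "set_integrable lborel {0<..} f0" unfolding set_integrable_def f0_def
    by (rule Bochner_Integration.integrable_bound[OF X(1)[unfolded set_integrable_def]]) (auto simp: norm_mult ne)
  have i1: "set_integrable lborel {0<..} f1" unfolding set_integrable_def f1_def
    by (rule Bochner_Integration.integrable_bound[OF X(3)[unfolded set_integrable_def]]) (auto simp: norm_mult ne)
  have n0: "norm (LINT r:{0<..}|lborel. f0 r) \<le> 1 / b"
    unfolding X(2)[symmetric] set_lebesgue_integral_def
    by (rule Bochner_Integration.integral_norm_bound_integral[OF i0[unfolded set_integrable_def] X(1)[unfolded set_integrable_def]])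
      (simp add: f0_def norm_mult ne)
  have n1: "norm (LINT r:{0<..}|lborel. f1 r) \<le> 1 / b\<^sup>2"
    unfolding X(4)[symmetric] set_lebesgue_integral_def
    by (rule Bochner_Integration.integral_norm_bound_integral[OF i1[unfolded set_integrable_def] X(3)[unfolded set_integrable_def]])
      (auto simp add: f1_def norm_mult ne indicator_def)
  \<comment> \<open>The factor -2 i \<tau> is the inverse of the phase derivative i r / (2 \<tau>)
    up to r, so differentiation produces \<open>f1\<close> with coefficient 1.\<close>
  define W where "W = (\<lambda>r::real. - (2 * \<i> * of_real \<tau>) * exp (\<i> * of_real (r\<^sup>2 / (4 * \<tau>)) - of_real (b * r)))"
  have fe: "f0 r = exp (\<i> * of_real (r\<^sup>2 / (4 * \<tau>)) - of_real (b * r))" for r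
    by (simp add: f0_def e_def exp_of_real[symmetric] mult.commute flip: exp_add)
  have f10: "f1 r = of_real r * f0 r" for r by (simp add: f0_def f1_def)
  have der: "(W has_vector_derivative (f1 r + 2 * \<i> * of_real (\<tau> * b) * f0 r)) (at r)" for r
  proof -
    have "((\<lambda>z. - (2 * \<i> * of_real \<tau>) * exp (\<i> * (z\<^sup>2 / (4 * of_real \<tau>)) - of_real b * z)) has_field_derivative
        - (2 * \<i> * of_real \<tau>) * (exp (\<i> * ((of_real r)\<^sup>2 / (4 * of_real \<tau>)) - of_real b * of_real r) * (\<i> * (2 * of_real r / (4 * of_real \<tau>)) - of_real b))) (at (of_real r))"
      using \<tau> by (auto intro!: derivative_eq_intros)
    from has_vector_derivative_real_field[OF this]
    have "(W has_vector_derivative - (2 * \<i> * of_real \<tau>) * (exp (\<i> * ((of_real r)\<^sup>2 / (4 * of_real \<tau>)) - of_real b * of_real r) * (\<i> * (2 * of_real r / (4 * of_real \<tau>)) - of_real b))) (at r)"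
      by (simp add: W_def o_def)
    also have "- (2 * \<i> * of_real \<tau>) * (exp (\<i> * ((of_real r)\<^sup>2 / (4 * of_real \<tau>)) - of_real b * of_real r) * (\<i> * (2 * of_real r / (4 * of_real \<tau>)) - of_real b))
       = f1 r + 2 * \<i> * of_real (\<tau> * b) * f0 r"
    proof -
      have "f0 r = exp (\<i> * ((of_real r)\<^sup>2 / (4 * of_real \<tau>)) - of_real b * of_real r)" by (simp add: fe)
      moreover have "- (2 * \<i> * of_real \<tau>) * (E * (\<i> * (2 * of_real r / (4 * of_real \<tau>)) - of_real b)) = of_real r * E + 2 * \<i> * of_real (\<tau> * b) * E" for E
        using \<tau> by (simp add: field_simps)
      ultimately show ?thesis unfolding f10 by simp
    qed
    finally show ?thesis .
  qed
  have cont: "isCont (\<lambda>r. f1 r + 2 * \<i> * of_real (\<tau> * b) * f0 r) r" for r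
    unfolding f10 fe using \<tau> by (intro continuous_intros) auto
  have pc: "einterval (ereal 0) \<infinity> = {0<..}" by (auto simp: einterval_def)
  have int: "set_integrable lborel {0<..} (\<lambda>r. f1 r + 2 * \<i> * of_real (\<tau> * b) * f0 r)"
    using i0 i1 by (intro set_integral_add(1) set_integrable_mult_right) auto
  have "(W \<longlongrightarrow> - (2 * \<i> * of_real \<tau>) * exp (\<i> * of_real (0\<^sup>2 / (4 * \<tau>)) - of_real (b * 0))) (at_right 0)"
    unfolding W_def using \<tau> by (intro tendsto_intros) auto
  then have l0: "((W \<circ> real_of_ereal) \<longlongrightarrow> - (2 * \<i> * of_real \<tau>)) (at_right (ereal 0))"
    by (simp add: ereal_tendsto_simps)
  have "norm (W r) = 2 * \<tau> * exp (- b * r)" for r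
    using \<tau> by (simp add: W_def norm_mult norm_exp_eq_Re)
  moreover have "((\<lambda>r. 2 * \<tau> * exp (- b * r)) \<longlongrightarrow> 0) at_top" using b by real_asymp
  ultimately have "((\<lambda>r. norm (W r)) \<longlongrightarrow> 0) at_top" by simp
  then have "(W \<longlongrightarrow> 0) at_top" by (rule tendsto_norm_zero_cancel)
  then have l1: "((W \<circ> real_of_ereal) \<longlongrightarrow> 0) (at_left \<infinity>)" by (simp add: ereal_tendsto_simps)
  have "(LBINT r=ereal 0..\<infinity>. f1 r + 2 * \<i> * of_real (\<tau> * b) * f0 r) = 0 - (- (2 * \<i> * of_real \<tau>))"
    by (rule interval_integral_FTC_integrable[where F = W]) (use der cont int l0 l1 pc in auto)
  then have "(LINT r:{0<..}|lborel. f1 r + 2 * \<i> * of_real (\<tau> * b) * f0 r) = 2 * \<i> * of_real \<tau>"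
    by (simp add: interval_lebesgue_integral_def pc)
  moreover have "(LINT r:{0<..}|lborel. f1 r + 2 * \<i> * of_real (\<tau> * b) * f0 r) = (LINT r:{0<..}|lborel. f1 r) + 2 * \<i> * of_real (\<tau> * b) * (LINT r:{0<..}|lborel. f0 r)"
    using i0 i1 by (subst set_integral_add(2)) (auto intro!: set_integrable_mult_right)
  ultimately have "(LINT r:{0<..}|lborel. f1 r) = 2 * \<i> * of_real \<tau> - 2 * \<i> * of_real (\<tau> * b) * (LINT r:{0<..}|lborel. f0 r)"
    by (simp add: algebra_simps)
  also have "norm \<dots> \<le> norm (2 * \<i> * complex_of_real \<tau>) + norm (2 * \<i> * of_real (\<tau> * b) * (LINT r:{0<..}|lborel. f0 r))"
    by (rule norm_triangle_ineq4)
  also have "\<dots> \<le> 2 * \<tau> + 2 * (\<tau> * b) * (1 / b)"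
    using \<tau> b by (intro add_mono) (auto simp: norm_mult intro!: mult_left_mono order_trans[OF mult_left_mono[OF n0]])
  also have "\<dots> = 4 * \<tau>" using b by simp
  finally show ?thesis using n1 by (simp add: f1_def e_def)
qed

text \<open>A positive real factor splits off the principal logarithm additively. The exponential
  form shows measurability in \<tau>, the norm the decay.\<close>

lemma free_propagator_prefactor:
  assumes "0 < \<tau>"
  shows "(4 * of_real pi * \<i> * of_real \<tau>) powr (-3/2) = exp (-3/2 * (of_real (ln (4 * pi * \<tau>)) + Ln \<i>))"
    and "norm ((4 * of_real pi * \<i> * of_real \<tau>) powr (-3/2) :: complex) = (4 * pi * \<tau>) powr (-3/2)"
proof -
  have e: "4 * of_real pi * \<i> * of_real \<tau> = of_real (4 * pi * \<tau>) * \<i>" by simp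
  have r: "0 < 4 * pi * \<tau>" using assms by simp
  have "Ln (of_real (4 * pi * \<tau>) * \<i>) = of_real (ln (4 * pi * \<tau>)) + Ln \<i>"
    using Ln_times_of_real[OF r, of \<i>] Ln_of_real[OF r] by (simp only: complex_i_not_zero not_False_eq_True simp_thms)
  then have "Ln (4 * of_real pi * \<i> * of_real \<tau>) = of_real (ln (4 * pi * \<tau>)) + Ln \<i>"
    unfolding e .
  then show *: "(4 * of_real pi * \<i> * of_real \<tau>) powr (-3/2) = exp (-3/2 * (of_real (ln (4 * pi * \<tau>)) + Ln \<i>))"
    using assms by (simp add: powr_def)
  show "norm ((4 * of_real pi * \<i> * of_real \<tau>) powr (-3/2) :: complex) = (4 * pi * \<tau>) powr (-3/2)"
    unfolding * norm_exp_eq_Re using assms by (simp add: powr_def)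
qed

text \<open>In polar coordinates r^2 from the volume element cancels the singularity 1 / r of the
  bound state and leaves r exp (- b r) with b = 4 pi |a|. The power -3/2 of \<tau> times the two
  oscillatory bounds then reproduces the two branches of \<open>majorant\<close>.\<close>

lemma free_at_origin_phi_bound:
  assumes a: "a < 0" and \<tau>: "0 < \<tau>"
  defines "C \<equiv> (4 * pi) powr (-3/2) * (4 * pi * sqrt (2 * \<bar>a\<bar>)) * (4 + 1 / (4 * pi * \<bar>a\<bar>)\<^sup>2)"
  shows "norm (free_at_origin (phi a) \<tau>) \<le> C * majorant \<tau>"
proof -
  define b where "b = 4 * pi * \<bar>a\<bar>"
  have b: "0 < b" unfolding b_def using a by (intro mult_pos_pos) auto
  define K where "K = (4 * of_real pi * \<i> * of_real \<tau>) powr (-3/2)"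
  define G where "G = (\<lambda>r::real. exp (\<i> * of_real (r\<^sup>2 / (4 * \<tau>))) * complex_of_real (sqrt (2 * \<bar>a\<bar>) * exp (4 * pi * a * r) / r))"
  have [measurable]: "G \<in> borel_measurable borel" unfolding G_def by measurable
  define I where "I = (LINT r:{0<..}|lborel. of_real (r * exp (- b * r)) * exp (\<i> * of_real (r\<^sup>2 / (4 * \<tau>))))"
  have nK: "norm K = (4 * pi * \<tau>) powr (-3/2)"
    unfolding K_def by (rule free_propagator_prefactor(2)[OF \<tau>])
  have nc: "norm (complex_of_real (4 * pi * sqrt (2 * \<bar>a\<bar>))) = 4 * pi * sqrt (2 * \<bar>a\<bar>)"
    unfolding norm_of_real by simp
  have "free_at_origin (phi a) \<tau> = K * (LINT y|(lborel :: (real^3) measure). G (norm y))"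
    unfolding free_at_origin_def phi_def G_def K_def mult.assoc by (rule integral_mult_right_zero)
  also have "(LINT y|(lborel :: (real^3) measure). G (norm y)) = (LINT r|lborel. of_real (4 * pi * sqrt (2 * \<bar>a\<bar>)) * (indicator {0<..} r *\<^sub>R (of_real (r * exp (- b * r)) * exp (\<i> * of_real (r\<^sup>2 / (4 * \<tau>))))))"
  proof (subst radial_integral)
    have "4 * pi * a * r = - b * r" for r using a by (simp add: b_def)
    then show "(LINT r|lborel. (indicator {0<..} r * (4 * pi * r\<^sup>2)) *\<^sub>R G r) = (LINT r|lborel. of_real (4 * pi * sqrt (2 * \<bar>a\<bar>)) * (indicator {0<..} r *\<^sub>R (of_real (r * exp (- b * r)) * exp (\<i> * of_real (r\<^sup>2 / (4 * \<tau>))))))"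
      by (intro Bochner_Integration.integral_cong) (auto simp: G_def indicator_def scaleR_conv_of_real power2_eq_square)
  qed measurable
  also have "\<dots> = of_real (4 * pi * sqrt (2 * \<bar>a\<bar>)) * I"
    unfolding I_def set_lebesgue_integral_def by (rule integral_mult_right_zero)
  finally have "norm (free_at_origin (phi a) \<tau>) = (4 * pi * \<tau>) powr (-3/2) * ((4 * pi * sqrt (2 * \<bar>a\<bar>)) * norm I)"
    by (simp only: norm_mult nK nc)
  also have "\<dots> \<le> (4 * pi * \<tau>) powr (-3/2) * ((4 * pi * sqrt (2 * \<bar>a\<bar>)) * min (4 * \<tau>) (1 / b\<^sup>2))"
    unfolding I_def by (intro mult_left_mono oscillatory_integral_bound b \<tau>) auto
  also have "\<dots> = (4 * pi) powr (-3/2) * (4 * pi * sqrt (2 * \<bar>a\<bar>)) * (\<tau> powr (-3/2) * min (4 * \<tau>) (1 / b\<^sup>2))"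
    using \<tau> by (simp add: powr_mult mult_ac)
  also have "\<dots> \<le> (4 * pi) powr (-3/2) * (4 * pi * sqrt (2 * \<bar>a\<bar>)) * ((4 + 1 / b\<^sup>2) * majorant \<tau>)"
  proof (intro mult_left_mono)
    have p: "\<tau> powr (-3/2) = 1 / (\<tau> * sqrt \<tau>)"
    proof -
      have "\<tau> powr (-3/2) = inverse (\<tau> powr (1 + 1/2))" by (simp flip: powr_minus)
      also have "\<tau> powr (1 + 1/2) = \<tau> * sqrt \<tau>" using \<tau> by (simp only: powr_add) (simp add: powr_half_sqrt)
      finally show ?thesis by (simp add: inverse_eq_divide)
    qed
    have 1: "\<tau> powr (-3/2) * min (4 * \<tau>) (1 / b\<^sup>2) \<le> 4 * (1 / sqrt \<tau>)"
    proof -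
      have "\<tau> powr (-3/2) * min (4 * \<tau>) (1 / b\<^sup>2) \<le> \<tau> powr (-3/2) * (4 * \<tau>)" by (intro mult_left_mono) auto
      also have "\<dots> = 4 * (1 / sqrt \<tau>)" unfolding p using \<tau> by simp
      finally show ?thesis .
    qed
    have 2: "\<tau> powr (-3/2) * min (4 * \<tau>) (1 / b\<^sup>2) \<le> (1 / b\<^sup>2) * (1 / (\<tau> * sqrt \<tau>))"
    proof -
      have "\<tau> powr (-3/2) * min (4 * \<tau>) (1 / b\<^sup>2) \<le> \<tau> powr (-3/2) * (1 / b\<^sup>2)" by (intro mult_left_mono) auto
      then show ?thesis unfolding p by (simp add: mult.commute)
    qed
    have "majorant \<tau> = 1 / sqrt \<tau> \<or> majorant \<tau> = 1 / (\<tau> * sqrt \<tau>)" using \<tau> by (simp add: majorant_def min_def)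
    moreover have "0 \<le> 1 / b\<^sup>2 * majorant \<tau>" "0 \<le> 4 * majorant \<tau>" using majorant_nonneg[of \<tau>] by auto
    ultimately show "\<tau> powr (-3/2) * min (4 * \<tau>) (1 / b\<^sup>2) \<le> (4 + 1 / b\<^sup>2) * majorant \<tau>"
      unfolding distrib_right using 1 2 by (smt (verit))
  qed auto
  finally show ?thesis by (simp add: C_def b_def mult_ac)
qed

lemma free_at_origin_phi_measurable:
  "(\<lambda>\<tau>. indicator {0..} \<tau> *\<^sub>R free_at_origin (phi a) \<tau>) \<in> borel_measurable borel"
proof -
  have [measurable]: "phi a \<in> borel_measurable borel" unfolding phi_def by measurable
  have "(\<lambda>\<tau>. indicator {0..} \<tau> *\<^sub>R free_at_origin (phi a) \<tau>)
    = (\<lambda>\<tau>. indicator {0<..} \<tau> *\<^sub>R (exp (-3/2 * (of_real (ln (4 * pi * \<tau>)) + Ln \<i>)) *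
         (LINT y|(lborel :: (real^3) measure). exp (\<i> * of_real ((norm y)\<^sup>2 / (4 * \<tau>))) * phi a y)))"
  proof (rule ext)
    fix \<tau> :: real
    have e: "free_at_origin (phi a) \<tau> = (4 * of_real pi * \<i> * of_real \<tau>) powr (-3/2) * (LINT y|(lborel :: (real^3) measure). exp (\<i> * of_real ((norm y)\<^sup>2 / (4 * \<tau>))) * phi a y)"
      unfolding free_at_origin_def mult.assoc by (rule integral_mult_right_zero)
    consider "\<tau> < 0" | "\<tau> = 0" | "0 < \<tau>" by linarith
    then show "indicator {0..} \<tau> *\<^sub>R free_at_origin (phi a) \<tau>
     = indicator {0<..} \<tau> *\<^sub>R (exp (-3/2 * (of_real (ln (4 * pi * \<tau>)) + Ln \<i>)) *
         (LINT y|(lborel :: (real^3) measure). exp (\<i> * of_real ((norm y)\<^sup>2 / (4 * \<tau>))) * phi a y))"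
    proof cases
      \<comment> \<open>At \<tau> = 0 the principal power of 0 is 0, matching the indicator of the
        open half-line on the right.\<close>
      case 2
      then show ?thesis unfolding e by simp
    next
      case 3
      then show ?thesis unfolding e free_propagator_prefactor(1)[OF 3] by simp
    qed simp
  qed
  also have "\<dots> \<in> borel_measurable borel" by measurable
  finally show ?thesis .
qed

lemma free_at_origin_zero: "free_at_origin \<Psi> 0 = 0"
  by (simp add: free_at_origin_def)

section \<open>The charge equation\<close>

lemma abel_kernel_nonneg: "0 \<le> abel_kernel x" by (simp add: abel_kernel_def)

lemma nn_conv_abel_kernel_abel_kernel: "(\<integral>\<^sup>+x. ennreal (abel_kernel x * abel_kernel (t - x)) \<partial>lborel) \<le> ennreal pi"
proof -
  have "(\<integral>\<^sup>+x. ennreal (abel_kernel x * abel_kernel (t - x)) \<partial>lborel) = ennreal (conv abel_kernel abel_kernel t)"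
    unfolding conv_def real_scaleR_def
    by (rule nn_integral_eq_integral) (use conv_abel_kernel_abel_kernel(1) abel_kernel_nonneg in auto)
  then show ?thesis unfolding conv_abel_kernel_abel_kernel(2) by (auto intro!: ennreal_leI)
qed

text \<open>An Abel singularity at the origin is admissible because the Abel kernel convolved with
  itself is at most pi. The bound is required only up to time t, since the charge is not yet known
  to be globally bounded.\<close>

lemma conv_abel_kernel_bound:
  fixes u :: "real \<Rightarrow> complex"
  assumes [measurable]: "u \<in> borel_measurable borel" and C: "0 \<le> C" and u: "\<And>s. s \<le> t \<Longrightarrow> norm (u s) \<le> C * abel_kernel s"
  shows "integrable lborel (\<lambda>x. abel_kernel x *\<^sub>R u (t - x))" "norm (conv abel_kernel u t) \<le> C * pi"
proof -
  have bd: "norm (abel_kernel x *\<^sub>R u (t - x)) \<le> C * (abel_kernel x * abel_kernel (t - x))" for x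
  proof (cases "0 < x")
    case True
    then have "abel_kernel x * norm (u (t - x)) \<le> abel_kernel x * (C * abel_kernel (t - x))" by (intro mult_left_mono u abel_kernel_nonneg) auto
    then show ?thesis by (simp add: abel_kernel_nonneg mult_ac)
  qed (simp add: abel_kernel_def)
  show I: "integrable lborel (\<lambda>x. abel_kernel x *\<^sub>R u (t - x))"
  proof (rule Bochner_Integration.integrable_bound[OF integrable_mult_right[OF conv_abel_kernel_abel_kernel(1)[of t], of C]])
    show "AE x in lborel. norm (abel_kernel x *\<^sub>R u (t - x)) \<le> norm (C * (abel_kernel x * abel_kernel (t - x)))"
      by (intro AE_I2 order_trans[OF bd]) simp
  qed measurable
  have "norm (conv abel_kernel u t) \<le> (LINT x|lborel. C * (abel_kernel x * abel_kernel (t - x)))"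
    unfolding conv_def
    by (rule Bochner_Integration.integral_norm_bound_integral[OF I integrable_mult_right[OF conv_abel_kernel_abel_kernel(1)]]) (rule bd)
  also have "\<dots> = C * conv abel_kernel abel_kernel t" by (simp add: conv_def)
  also have "\<dots> \<le> C * pi" unfolding conv_abel_kernel_abel_kernel(2) using C by auto
  finally show "norm (conv abel_kernel u t) \<le> C * pi" .
qed

text \<open>Associativity moves \<open>mix_kernel\<close> onto the Abel kernel, where the
  convolution is known. Absolute convergence follows from the bound pi on the inner integral and the
  integrability of \<open>mix_kernel\<close>.\<close>

lemma conv_abel_kernel_regularize:
  fixes u :: "real \<Rightarrow> complex"
  assumes [measurable]: "u \<in> borel_measurable borel" and C: "0 \<le> C" and u: "\<And>s. s \<le> t \<Longrightarrow> norm (u s) \<le> C * abel_kernel s"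
  shows "integrable lborel (\<lambda>x. mix_kernel x *\<^sub>R conv abel_kernel u (t - x))"
    and "conv mix_kernel (conv abel_kernel u) t = conv abel_kernel u t - conv reg_kernel u t"
proof -
  note gl = good_kernelD[OF good_kernel_mix_kernel] and gs = good_kernelD[OF good_kernel_reg_kernel]
  have bd: "norm (mix_kernel x *\<^sub>R conv abel_kernel u (t - x)) \<le> (C * pi) * mix_kernel x" for x
  proof (cases "0 < x")
    case True
    have "norm (conv abel_kernel u (t - x)) \<le> C * pi" by (rule conv_abel_kernel_bound(2)) (use C u True in auto)
    then have "mix_kernel x * norm (conv abel_kernel u (t - x)) \<le> mix_kernel x * (C * pi)" by (intro mult_left_mono gl(2))
    then show ?thesis using gl(2)[of x] by (simp add: mult_ac)
  qed (simp add: gl(4))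
  show "integrable lborel (\<lambda>x. mix_kernel x *\<^sub>R conv abel_kernel u (t - x))"
  proof (rule Bochner_Integration.integrable_bound[OF integrable_mult_right[OF good_kernel_integrable[OF good_kernel_mix_kernel], of "C * pi"]])
    show "AE x in lborel. norm (mix_kernel x *\<^sub>R conv abel_kernel u (t - x)) \<le> norm (C * pi * mix_kernel x)"
      by (intro AE_I2 order_trans[OF bd]) simp
  qed measurable
  have "(\<integral>\<^sup>+x. \<integral>\<^sup>+y. ennreal (norm (mix_kernel x *\<^sub>R abel_kernel y *\<^sub>R u (t - x - y))) \<partial>lborel \<partial>lborel) \<le> (\<integral>\<^sup>+x. ennreal (mix_kernel x) * ennreal (C * pi) \<partial>lborel)"
  proof (rule nn_integral_mono)
    fix x :: real
    have "(\<integral>\<^sup>+y. ennreal (norm (mix_kernel x *\<^sub>R abel_kernel y *\<^sub>R u (t - x - y))) \<partial>lborel) \<le> (\<integral>\<^sup>+y. ennreal (mix_kernel x * C) * ennreal (abel_kernel y * abel_kernel (t - x - y)) \<partial>lborel)"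
    proof (rule nn_integral_mono)
      fix y :: real
      have "norm (mix_kernel x *\<^sub>R abel_kernel y *\<^sub>R u (t - x - y)) \<le> (mix_kernel x * C) * (abel_kernel y * abel_kernel (t - x - y))"
      proof (cases "0 < x \<and> 0 < y")
        case True
        then have "norm (u (t - x - y)) \<le> C * abel_kernel (t - x - y)" by (intro u) auto
        then have "(mix_kernel x * abel_kernel y) * norm (u (t - x - y)) \<le> (mix_kernel x * abel_kernel y) * (C * abel_kernel (t - x - y))"
          by (intro mult_left_mono mult_nonneg_nonneg gl(2) abel_kernel_nonneg)
        then show ?thesis using gl(2)[of x] abel_kernel_nonneg[of y] by (simp add: mult_ac)
      qed (auto simp: gl(4) abel_kernel_nonpos)
      then show "ennreal (norm (mix_kernel x *\<^sub>R abel_kernel y *\<^sub>R u (t - x - y))) \<le> ennreal (mix_kernel x * C) * ennreal (abel_kernel y * abel_kernel (t - x - y))"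
        using gl(2)[of x] C by (simp add: ennreal_mult'[symmetric] ennreal_leI)
    qed
    also have "\<dots> = ennreal (mix_kernel x * C) * (\<integral>\<^sup>+y. ennreal (abel_kernel y * abel_kernel (t - x - y)) \<partial>lborel)"
      by (rule nn_integral_cmult) measurable
    also have "\<dots> \<le> ennreal (mix_kernel x * C) * ennreal pi" by (intro mult_left_mono nn_conv_abel_kernel_abel_kernel) auto
    also have "\<dots> = ennreal (mix_kernel x) * ennreal (C * pi)" using gl(2)[of x] C by (simp add: ennreal_mult'[symmetric] mult_ac)
    finally show "(\<integral>\<^sup>+y. ennreal (norm (mix_kernel x *\<^sub>R abel_kernel y *\<^sub>R u (t - x - y))) \<partial>lborel) \<le> ennreal (mix_kernel x) * ennreal (C * pi)" .
  qed
  also have "\<dots> = (\<integral>\<^sup>+x. ennreal (mix_kernel x) \<partial>lborel) * ennreal (C * pi)" by (rule nn_integral_multc) measurable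
  also have "\<dots> < \<infinity>"
    using good_kernel_integrable[OF good_kernel_mix_kernel] gl(2)
    by (subst nn_integral_eq_integral) (auto simp: ennreal_mult_less_top)
  finally have fin: "(\<integral>\<^sup>+x. \<integral>\<^sup>+y. ennreal (norm (mix_kernel x *\<^sub>R abel_kernel y *\<^sub>R u (t - x - y))) \<partial>lborel \<partial>lborel) < \<infinity>" .
  have "conv mix_kernel (conv abel_kernel u) t = conv (conv mix_kernel abel_kernel) u t"
    by (rule conv_assoc) (use conv_mix_kernel_abel_kernel(1) fin in auto)
  also have "\<dots> = (LINT x|lborel. abel_kernel x *\<^sub>R u (t - x) - reg_kernel x *\<^sub>R u (t - x))"
    unfolding conv_def[of "conv mix_kernel abel_kernel"] conv_mix_kernel_abel_kernel(2) by (simp add: scaleR_diff_left)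
  also have "\<dots> = conv abel_kernel u t - conv reg_kernel u t"
    unfolding conv_def
  proof (rule Bochner_Integration.integral_diff)
    show I: "integrable lborel (\<lambda>x. abel_kernel x *\<^sub>R u (t - x))" by (rule conv_abel_kernel_bound(1)[OF _ C u]) auto
    show "integrable lborel (\<lambda>x. reg_kernel x *\<^sub>R u (t - x))"
    proof (rule Bochner_Integration.integrable_bound[OF I])
      have "reg_kernel x \<le> abel_kernel x" for x by (simp add: reg_kernel_def abel_kernel_def)
      then show "AE x in lborel. norm (reg_kernel x *\<^sub>R u (t - x)) \<le> norm (abel_kernel x *\<^sub>R u (t - x))"
        using gs(2) abel_kernel_nonneg by (auto intro!: AE_I2 mult_right_mono)
    qed measurable
  qed
  finally show "conv mix_kernel (conv abel_kernel u) t = conv abel_kernel u t - conv reg_kernel u t" .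
qed

text \<open>On (0,R] the Abel kernel is at least 1 / sqrt R, so locally bounded functions satisfy
  the hypothesis of the convolution estimates.\<close>

lemma abel_kernel_bound_of_bounded:
  assumes "0 < s" "s \<le> R" "x \<le> M" "0 \<le> M"
  shows "x \<le> M * sqrt R * abel_kernel s"
proof -
  have "1 \<le> sqrt R * abel_kernel s" using assms by (simp add: abel_kernel_def)
  then have "M * 1 \<le> M * (sqrt R * abel_kernel s)" using assms by (intro mult_left_mono) auto
  then show ?thesis using assms by (simp add: mult.assoc)
qed

context ionization
begin

text \<open>Extending charge and forcing by zero turns the equation on t >= 0 into a convolution
  equation on the whole line.\<close>

lemma charge_abel_kernel_equation:
  fixes q :: "real \<Rightarrow> complex"
  assumes q: "is_charge \<alpha> \<Psi> q"
  defines "q0 \<equiv> \<lambda>t. indicator {0..} t *\<^sub>R q t" and "F0 \<equiv> \<lambda>t. indicator {0..} t *\<^sub>R free_at_origin \<Psi> t"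
  shows "q0 t + kappa * conv abel_kernel (\<lambda>s. of_real (\<alpha> s) * q0 s) t = kappa * conv abel_kernel F0 t"
proof -
  have refl: "conv abel_kernel u t = (LINT \<tau>|lborel. abel_kernel (t - \<tau>) *\<^sub>R u \<tau>)" for u :: "real \<Rightarrow> complex"
    unfolding conv_def using lborel_integral_real_affine[of "- 1" "\<lambda>\<tau>. abel_kernel (t - \<tau>) *\<^sub>R u \<tau>" t] by simp
  show ?thesis
  proof (cases "0 \<le> t")
    case True
    have 1: "(LINT \<tau>:{0..t}|lborel. of_real (\<alpha> \<tau>) * q \<tau> / of_real (sqrt (t - \<tau>))) = conv abel_kernel (\<lambda>s. of_real (\<alpha> s) * q0 s) t"
      unfolding refl set_lebesgue_integral_def
      by (intro Bochner_Integration.integral_cong) (auto simp: q0_def abel_kernel_def indicator_def scaleR_conv_of_real)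
    have 2: "(LINT \<tau>:{0..t}|lborel. free_at_origin \<Psi> \<tau> / of_real (sqrt (t - \<tau>))) = conv abel_kernel F0 t"
      unfolding refl set_lebesgue_integral_def
      by (intro Bochner_Integration.integral_cong) (auto simp: F0_def abel_kernel_def indicator_def scaleR_conv_of_real)
    have qt: "q0 t = q t" using True by (simp add: q0_def)
    have "q t + kappa * (LINT \<tau>:{0..t}|lborel. of_real (\<alpha> \<tau>) * q \<tau> / of_real (sqrt (t - \<tau>)))
        = kappa * (LINT \<tau>:{0..t}|lborel. free_at_origin \<Psi> \<tau> / of_real (sqrt (t - \<tau>)))"
      using q True unfolding is_charge_def kappa_def by blast
    then show ?thesis unfolding 1 2 qt .
  next
    case False
    have "(\<lambda>x. abel_kernel x *\<^sub>R (of_real (\<alpha> (t - x)) * q0 (t - x))) = (\<lambda>x. 0)" "(\<lambda>x. abel_kernel x *\<^sub>R F0 (t - x)) = (\<lambda>x. 0)"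
      using False by (auto simp: abel_kernel_def q0_def F0_def fun_eq_iff)
    then show ?thesis using False by (simp add: conv_def q0_def)
  qed
qed

text \<open>\<open>is_charge\<close> gives only local integrability. The equation bounds |q| by a
  constant plus an Abel convolution of |q|; iterating once more replaces the singular kernel by its
  bounded square, so the local L1 norm suffices. The estimate is run in \<open>ennreal\<close>,
  since the first convolution might be infinite a priori.\<close>

lemma charge_locally_bounded:
  fixes q :: "real \<Rightarrow> complex"
  assumes q: "is_charge \<alpha> \<Psi> q"
  defines "q0 \<equiv> \<lambda>t. indicator {0..} t *\<^sub>R q t" and "F0 \<equiv> \<lambda>t. indicator {0..} t *\<^sub>R free_at_origin \<Psi> t"
  assumes F[measurable]: "F0 \<in> borel_measurable borel" and C: "0 \<le> C" and FC: "\<And>s. norm (F0 s) \<le> C * abel_kernel s"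
  shows "q0 \<in> borel_measurable borel" and "\<exists>M\<ge>0. \<forall>t\<le>R. norm (q0 t) \<le> M"
proof -
  have qI: "set_integrable lborel {0..t} q" if "0 \<le> t" for t using q that by (simp add: is_charge_def)
  show m[measurable]: "q0 \<in> borel_measurable borel"
  proof (rule borel_measurable_LIMSEQ_metric)
    show "(\<lambda>t. indicator {0..real n} t *\<^sub>R q t) \<in> borel_measurable borel" for n
      using borel_measurable_integrable[OF qI[of "real n", unfolded set_integrable_def]] by simp
    show "(\<lambda>n. indicator {0..real n} t *\<^sub>R q t) \<longlonglongrightarrow> q0 t" for t
    proof (rule tendsto_eventually)
      obtain n0 where "t \<le> real n0" using real_arch_simple by blast
      then show "\<forall>\<^sub>F n in sequentially. indicator {0..real n} t *\<^sub>R q t = q0 t"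
        by (intro eventually_sequentiallyI[of n0]) (auto simp: q0_def indicator_def)
    qed
  qed
  define D where "D = norm kappa * (C * pi)"
  define D' where "D' = norm kappa * alpha_norm"
  have D: "0 \<le> D" "0 \<le> D'" using C alpha_norm_nonneg by (auto simp: D_def D'_def)
  define Q where "Q = (\<lambda>t. \<integral>\<^sup>+x. ennreal (abel_kernel x * norm (q0 (t - x))) \<partial>lborel)"
  have [measurable]: "Q \<in> borel_measurable borel" unfolding Q_def by measurable
  have q_le: "ennreal (norm (q0 t)) \<le> ennreal D + ennreal D' * Q t" for t
  proof -
    have "norm (q0 t) \<le> norm (kappa * conv abel_kernel F0 t) + norm (kappa * conv abel_kernel (\<lambda>s. of_real (\<alpha> s) * q0 s) t)"
    proof -
      have "q0 t + kappa * conv abel_kernel (\<lambda>s. of_real (\<alpha> s) * q0 s) t = kappa * conv abel_kernel F0 t"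
        unfolding q0_def F0_def by (rule charge_abel_kernel_equation[OF q])
      then have "q0 t = kappa * conv abel_kernel F0 t - kappa * conv abel_kernel (\<lambda>s. of_real (\<alpha> s) * q0 s) t"
        by (rule eq_diff_eq[THEN iffD2])
      then show ?thesis by (metis norm_triangle_ineq4)
    qed
    also have "\<dots> \<le> D + norm kappa * norm (conv abel_kernel (\<lambda>s. of_real (\<alpha> s) * q0 s) t)"
      unfolding norm_mult D_def by (intro add_mono mult_left_mono conv_abel_kernel_bound(2)) (use C FC in auto)
    finally have 1: "norm (q0 t) \<le> D + norm kappa * norm (conv abel_kernel (\<lambda>s. of_real (\<alpha> s) * q0 s) t)" .
    have "ennreal (norm (conv abel_kernel (\<lambda>s. of_real (\<alpha> s) * q0 s) t)) \<le> (\<integral>\<^sup>+x. ennreal (norm (abel_kernel x *\<^sub>R (of_real (\<alpha> (t - x)) * q0 (t - x)))) \<partial>lborel)"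
    proof (cases "integrable lborel (\<lambda>x. abel_kernel x *\<^sub>R (of_real (\<alpha> (t - x)) * q0 (t - x)))")
      case True
      then show ?thesis unfolding conv_def by (rule integral_norm_bound_ennreal)
    next
      \<comment> \<open>A non-integrable integrand has integral 0 by convention, so the estimate
        still holds.\<close>
      case False
      then show ?thesis unfolding conv_def by (simp add: not_integrable_integral_eq)
    qed
    also have "\<dots> \<le> (\<integral>\<^sup>+x. ennreal alpha_norm * ennreal (abel_kernel x * norm (q0 (t - x))) \<partial>lborel)"
    proof (rule nn_integral_mono)
      fix x
      have "abel_kernel x * (\<bar>\<alpha> (t - x)\<bar> * norm (q0 (t - x))) \<le> abel_kernel x * (alpha_norm * norm (q0 (t - x)))"
        by (intro mult_left_mono mult_right_mono alpha_bound abel_kernel_nonneg) auto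
      then show "ennreal (norm (abel_kernel x *\<^sub>R (of_real (\<alpha> (t - x)) * q0 (t - x)))) \<le> ennreal alpha_norm * ennreal (abel_kernel x * norm (q0 (t - x)))"
        using alpha_norm_nonneg abel_kernel_nonneg[of x] by (simp add: ennreal_mult'[symmetric] norm_mult mult_ac ennreal_leI)
    qed
    also have "\<dots> = ennreal alpha_norm * Q t" unfolding Q_def by (rule nn_integral_cmult) measurable
    finally have 2: "ennreal (norm (conv abel_kernel (\<lambda>s. of_real (\<alpha> s) * q0 s) t)) \<le> ennreal alpha_norm * Q t" .
    have "ennreal (norm (q0 t)) \<le> ennreal (D + norm kappa * norm (conv abel_kernel (\<lambda>s. of_real (\<alpha> s) * q0 s) t))"
      by (rule ennreal_leI[OF 1])
    also have "\<dots> = ennreal D + ennreal (norm kappa) * ennreal (norm (conv abel_kernel (\<lambda>s. of_real (\<alpha> s) * q0 s) t))"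
      using D by (simp add: ennreal_mult')
    also have "\<dots> \<le> ennreal D + ennreal (norm kappa) * (ennreal alpha_norm * Q t)"
      by (intro add_left_mono mult_left_mono 2) auto
    also have "\<dots> = ennreal D + ennreal D' * Q t"
      by (simp add: D'_def ennreal_mult' mult.assoc)
    finally show ?thesis .
  qed
  define R' where "R' = max R 0"
  define qR where "qR = (\<lambda>s. indicator {0..R'} s *\<^sub>R q s)"
  have qRi: "integrable lborel qR" using qI[of R'] by (simp add: qR_def set_integrable_def R'_def)
  have [measurable]: "qR \<in> borel_measurable borel" using borel_measurable_integrable[OF qRi] by simp
  define J where "J = (\<integral>\<^sup>+s. ennreal (norm (qR s)) \<partial>lborel)"
  have J: "J < \<infinity>" using qRi unfolding J_def by (simp add: integrable_iff_bounded)
  have Q_fin: "Q t \<le> ennreal D * ennreal (2 * sqrt R') + ennreal D' * (ennreal pi * J)" if t: "t \<le> R'" for t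
  proof -
    have Qt: "Q t = (\<integral>\<^sup>+x. ennreal (abel_kernel x * norm (q0 (t - x))) \<partial>lborel)" by (simp add: Q_def)
    have "Q t \<le> (\<integral>\<^sup>+x. ennreal D * ennreal (indicator {0<..R'} x *\<^sub>R (1 / sqrt x)) + ennreal D' * (ennreal (abel_kernel x) * Q (t - x)) \<partial>lborel)"
      unfolding Qt
    proof (rule nn_integral_mono)
      fix x
      show "ennreal (abel_kernel x * norm (q0 (t - x))) \<le> ennreal D * ennreal (indicator {0<..R'} x *\<^sub>R (1 / sqrt x)) + ennreal D' * (ennreal (abel_kernel x) * Q (t - x))"
      proof (cases "0 < x \<and> x \<le> R'")
        case True
        have "ennreal (abel_kernel x * norm (q0 (t - x))) = ennreal (abel_kernel x) * ennreal (norm (q0 (t - x)))"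
          using abel_kernel_nonneg by (simp add: ennreal_mult')
        also have "\<dots> \<le> ennreal (abel_kernel x) * (ennreal D + ennreal D' * Q (t - x))"
          by (intro mult_left_mono q_le) auto
        also have "\<dots> = ennreal D * ennreal (indicator {0<..R'} x *\<^sub>R (1 / sqrt x)) + ennreal D' * (ennreal (abel_kernel x) * Q (t - x))"
          using True by (simp add: abel_kernel_def distrib_left mult_ac)
        finally show ?thesis .
      next
        case False
        then have "abel_kernel x * norm (q0 (t - x)) = 0" using t by (auto simp: abel_kernel_def q0_def)
        then show ?thesis by (simp only: ennreal_0 zero_le)
      qed
    qed
    also have "\<dots> = ennreal D * (\<integral>\<^sup>+x. ennreal (indicator {0<..R'} x *\<^sub>R (1 / sqrt x)) \<partial>lborel) + ennreal D' * (\<integral>\<^sup>+x. ennreal (abel_kernel x) * Q (t - x) \<partial>lborel)"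
      by (subst nn_integral_add) (auto simp: nn_integral_cmult)
    also have "(\<integral>\<^sup>+x. ennreal (indicator {0<..R'} x *\<^sub>R (1 / sqrt x)) \<partial>lborel) = ennreal (2 * sqrt R')"
    proof -
      have R': "0 \<le> R'" by (simp add: R'_def)
      show ?thesis
        unfolding inverse_sqrt_integral(2)[OF R', symmetric] set_lebesgue_integral_def
        by (rule nn_integral_eq_integral) (use inverse_sqrt_integral(1)[OF R'] in \<open>auto simp: set_integrable_def indicator_def\<close>)
    qed
    \<comment> \<open>Second iterate: by Tonelli the two Abel kernels are integrated against each
      other first, which costs pi, and only the L1 norm of q on [0,R'] is left.\<close>
    also have "(\<integral>\<^sup>+x. ennreal (abel_kernel x) * Q (t - x) \<partial>lborel) \<le> ennreal pi * J"
    proof -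
      have "(\<integral>\<^sup>+x. ennreal (abel_kernel x) * Q (t - x) \<partial>lborel) = (\<integral>\<^sup>+x. \<integral>\<^sup>+w. ennreal (abel_kernel x * abel_kernel (w - x)) * ennreal (norm (q0 (t - w))) \<partial>lborel \<partial>lborel)"
      proof (rule nn_integral_cong)
        fix x
        have "ennreal (abel_kernel x) * Q (t - x) = (\<integral>\<^sup>+y. ennreal (abel_kernel x) * ennreal (abel_kernel y * norm (q0 (t - x - y))) \<partial>lborel)"
          unfolding Q_def by (rule nn_integral_cmult[symmetric]) measurable
        also have "\<dots> = (\<integral>\<^sup>+w. ennreal (abel_kernel x * abel_kernel (w - x)) * ennreal (norm (q0 (t - w))) \<partial>lborel)"
          by (subst nn_integral_real_affine[where c = 1 and t = "- x"])
            (auto simp: abel_kernel_nonneg ennreal_mult'[symmetric] mult.assoc algebra_simps intro!: nn_integral_cong)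
        finally show "ennreal (abel_kernel x) * Q (t - x) = (\<integral>\<^sup>+w. ennreal (abel_kernel x * abel_kernel (w - x)) * ennreal (norm (q0 (t - w))) \<partial>lborel)" .
      qed
      also have "\<dots> = (\<integral>\<^sup>+w. \<integral>\<^sup>+x. ennreal (abel_kernel x * abel_kernel (w - x)) * ennreal (norm (q0 (t - w))) \<partial>lborel \<partial>lborel)"
        by (rule lborel_pair.Fubini') measurable
      also have "\<dots> \<le> (\<integral>\<^sup>+w. ennreal pi * ennreal (norm (qR (t - w))) \<partial>lborel)"
      proof (rule nn_integral_mono)
        fix w
        show "(\<integral>\<^sup>+x. ennreal (abel_kernel x * abel_kernel (w - x)) * ennreal (norm (q0 (t - w))) \<partial>lborel) \<le> ennreal pi * ennreal (norm (qR (t - w)))"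
        proof (cases "0 < w")
          case True
          have "(\<integral>\<^sup>+x. ennreal (abel_kernel x * abel_kernel (w - x)) * ennreal (norm (q0 (t - w))) \<partial>lborel) = (\<integral>\<^sup>+x. ennreal (abel_kernel x * abel_kernel (w - x)) \<partial>lborel) * ennreal (norm (q0 (t - w)))"
            by (rule nn_integral_multc) measurable
          also have "\<dots> \<le> ennreal pi * ennreal (norm (q0 (t - w)))"
            by (intro mult_right_mono nn_conv_abel_kernel_abel_kernel) auto
          finally have "(\<integral>\<^sup>+x. ennreal (abel_kernel x * abel_kernel (w - x)) * ennreal (norm (q0 (t - w))) \<partial>lborel) \<le> ennreal pi * ennreal (norm (q0 (t - w)))" .
          moreover have "q0 (t - w) = qR (t - w)" using True t by (auto simp: q0_def qR_def indicator_def)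
          ultimately show ?thesis by (simp only:)
        next
          case False
          then have "abel_kernel x * abel_kernel (w - x) = 0" for x by (auto simp: abel_kernel_def)
          then show ?thesis by (simp only: ennreal_0 mult_zero_left nn_integral_const zero_le)
        qed
      qed
      also have "\<dots> = ennreal pi * (\<integral>\<^sup>+w. ennreal (norm (qR (t - w))) \<partial>lborel)"
        by (rule nn_integral_cmult) measurable
      also have "(\<integral>\<^sup>+w. ennreal (norm (qR (t - w))) \<partial>lborel) = J"
        unfolding J_def by (subst nn_integral_real_affine[where c = "- 1" and t = t]) auto
      finally show ?thesis .
    qed
    finally show ?thesis by (simp add: add_left_mono mult_left_mono)
  qed
  define Z where "Z = ennreal D + ennreal D' * (ennreal D * ennreal (2 * sqrt R') + ennreal D' * (ennreal pi * J))"
  have Z: "Z < \<infinity>" using J by (simp add: Z_def ennreal_mult_less_top)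
  have "norm (q0 t) \<le> enn2real Z" if "t \<le> R" for t
  proof -
    have "ennreal (norm (q0 t)) \<le> Z"
      unfolding Z_def by (rule order_trans[OF q_le]) (intro add_left_mono mult_left_mono Q_fin, use that in \<open>auto simp: R'_def\<close>)
    then have "ennreal (norm (q0 t)) \<le> ennreal (enn2real Z)" using Z by simp
    then show ?thesis by (subst (asm) ennreal_le_iff) auto
  qed
  then show "\<exists>M\<ge>0. \<forall>t\<le>R. norm (q0 t) \<le> M" by (intro exI[of _ "enn2real Z"]) auto
qed

text \<open>The Abel equation minus its convolution with \<open>mix_kernel\<close>. The value at t =
  0 is included in the vanishing because both convolutions are 0 there.\<close>

lemma charge_regular_equation:
  fixes q :: "real \<Rightarrow> complex"
  assumes q: "is_charge \<alpha> \<Psi> q"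
  defines "q0 \<equiv> \<lambda>t. indicator {0..} t *\<^sub>R q t" and "F0 \<equiv> \<lambda>t. indicator {0..} t *\<^sub>R free_at_origin \<Psi> t"
  assumes F[measurable]: "F0 \<in> borel_measurable borel" and C: "0 \<le> C" and FC: "\<And>s. norm (F0 s) \<le> C * abel_kernel s"
  shows "t \<le> 0 \<Longrightarrow> q0 t = 0" and "reg_op \<alpha> 0 q0 t = kappa * conv reg_kernel F0 t"
proof -
  have E: "q0 t + kappa * conv abel_kernel (\<lambda>s. of_real (\<alpha> s) * q0 s) t = kappa * conv abel_kernel F0 t" for t
    unfolding q0_def F0_def by (rule charge_abel_kernel_equation[OF q])
  have lb1[measurable]: "q0 \<in> borel_measurable borel"
    unfolding q0_def by (rule charge_locally_bounded(1)[OF q F[unfolded F0_def] C FC[unfolded F0_def]])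
  have lb2: "\<exists>M\<ge>0. \<forall>t\<le>R. norm (q0 t) \<le> M" for R
    unfolding q0_def by (rule charge_locally_bounded(2)[OF q F[unfolded F0_def] C FC[unfolded F0_def]])
  define u where "u = (\<lambda>s. of_real (\<alpha> s) * q0 s)"
  have [measurable]: "u \<in> borel_measurable borel" unfolding u_def by measurable
  show q00: "q0 t = 0" if "t \<le> 0" for t
  proof (cases "t < 0")
    case False
    with that have "t = 0" by simp
    have "(\<lambda>x. abel_kernel x *\<^sub>R (of_real (\<alpha> (0 - x)) * q0 (0 - x))) = (\<lambda>x. 0)" "(\<lambda>x. abel_kernel x *\<^sub>R F0 (0 - x)) = (\<lambda>x. 0)"
      by (auto simp: abel_kernel_def q0_def F0_def fun_eq_iff)
    then have "conv abel_kernel (\<lambda>s. of_real (\<alpha> s) * q0 s) 0 = 0" "conv abel_kernel F0 0 = 0" by (simp_all add: conv_def)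
    then show ?thesis using E[of 0] \<open>t = 0\<close> by simp
  qed (simp add: q0_def)
  obtain M where M: "0 \<le> M" "\<And>s. s \<le> t \<Longrightarrow> norm (q0 s) \<le> M" using lb2[of t] by blast
  \<comment> \<open>The maximum with 0 makes the constant meaningful for negative t, where the
    source vanishes.\<close>
  define C1 where "C1 = alpha_norm * M * sqrt (max t 0)"
  have C1: "0 \<le> C1" using alpha_norm_nonneg M by (simp add: C1_def)
  have uC: "norm (u s) \<le> C1 * abel_kernel s" if "s \<le> t" for s
  proof (cases "0 < s")
    case True
    have "norm (u s) \<le> alpha_norm * M" unfolding u_def by (rule alpha_mult_bound[OF M(2)[OF that]])
    then show ?thesis unfolding C1_def using True that alpha_norm_nonneg M(1) by (intro abel_kernel_bound_of_bounded) auto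
  next
    case False
    then show ?thesis using q00[of s] by (simp add: u_def abel_kernel_def)
  qed
  note rF = conv_abel_kernel_regularize[OF F C FC, of t]
  have ru: "integrable lborel (\<lambda>x. mix_kernel x *\<^sub>R conv abel_kernel u (t - x))"
      "conv mix_kernel (conv abel_kernel u) t = conv abel_kernel u t - conv reg_kernel u t"
    by (rule conv_abel_kernel_regularize[OF _ C1 uC]; simp)+
  have q0_eq: "q0 s = kappa * conv abel_kernel F0 s - kappa * conv abel_kernel u s" for s
    using E[of s] unfolding u_def by (simp add: algebra_simps)
  have "conv mix_kernel q0 t = (LINT x|lborel. kappa * (mix_kernel x *\<^sub>R conv abel_kernel F0 (t - x)) - kappa * (mix_kernel x *\<^sub>R conv abel_kernel u (t - x)))"
    unfolding conv_def[of mix_kernel] q0_eq by (simp add: algebra_simps scaleR_diff_right)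
  also have "\<dots> = kappa * conv mix_kernel (conv abel_kernel F0) t - kappa * conv mix_kernel (conv abel_kernel u) t"
    unfolding conv_def[of mix_kernel]
    by (subst Bochner_Integration.integral_diff[OF integrable_mult_right[OF rF(1)] integrable_mult_right[OF ru(1)]])
      (simp only: integral_mult_right_zero)
  also have "\<dots> = kappa * (conv abel_kernel F0 t - conv reg_kernel F0 t) - kappa * (conv abel_kernel u t - conv reg_kernel u t)"
    using rF(2) ru(2) by simp
  finally have lq: "conv mix_kernel q0 t = kappa * (conv abel_kernel F0 t - conv reg_kernel F0 t) - kappa * (conv abel_kernel u t - conv reg_kernel u t)" .
  have "reg_op \<alpha> 0 q0 t = q0 t - conv mix_kernel q0 t + kappa * conv reg_kernel u t" by (simp add: reg_op_def u_def)
  then show "reg_op \<alpha> 0 q0 t = kappa * conv reg_kernel F0 t"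
    unfolding lq q0_eq[of t] by (simp add: algebra_simps)
qed

end

section \<open>Boundedness of the charge\<close>

lemma kernel_integral_bound:
  fixes m :: "real \<Rightarrow> complex"
  assumes f: "good_kernel f" and [measurable]: "m \<in> borel_measurable borel" and B: "\<And>x. 0 < x \<Longrightarrow> norm (m x) \<le> B"
  shows "integrable lborel (\<lambda>x. f x *\<^sub>R m x)" "integrable lborel (\<lambda>x. majorant x * norm (m x))"
    "norm (LINT x|lborel. f x *\<^sub>R m x) \<le> (LINT x|lborel. majorant x * norm (m x))"
proof -
  note g = good_kernelD[OF f]
  note [measurable] = g(1)
  have B0: "0 \<le> B" using order_trans[OF norm_ge_zero B[of 1]] by simp
  have bd: "majorant x * norm (m x) \<le> B * majorant x" for x
  proof (cases "0 < x")
    case True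
    then show ?thesis using mult_left_mono[OF B[OF True] majorant_nonneg[of x]] by (simp add: mult.commute)
  qed (simp add: majorant_def)
  have fb: "norm (f x *\<^sub>R m x) \<le> majorant x * norm (m x)" for x
    using g(2,3)[of x] by (simp add: mult_right_mono)
  show I2: "integrable lborel (\<lambda>x. majorant x * norm (m x))"
  proof (rule Bochner_Integration.integrable_bound[OF integrable_mult_right[OF majorant_integrable, of B]])
    show "AE x in lborel. norm (majorant x * norm (m x)) \<le> norm (B * majorant x)"
      using bd B0 majorant_nonneg by (auto intro!: AE_I2 simp: abs_mult)
  qed measurable
  show I1: "integrable lborel (\<lambda>x. f x *\<^sub>R m x)"
  proof (rule Bochner_Integration.integrable_bound[OF I2])
    show "AE x in lborel. norm (f x *\<^sub>R m x) \<le> norm (majorant x * norm (m x))"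
      by (intro AE_I2 order_trans[OF fb]) simp
  qed measurable
  show "norm (LINT x|lborel. f x *\<^sub>R m x) \<le> (LINT x|lborel. majorant x * norm (m x))"
    by (rule Bochner_Integration.integral_norm_bound_integral[OF I1 I2 fb])
qed

lemma majorant_integral_tendsto_0:
  fixes f :: "nat \<Rightarrow> real \<Rightarrow> real"
  assumes [measurable]: "\<And>n. f n \<in> borel_measurable borel" and b: "\<And>n x. 0 < x \<Longrightarrow> \<bar>f n x\<bar> \<le> 1"
    and l: "\<And>x. 0 < x \<Longrightarrow> (\<lambda>n. f n x) \<longlonglongrightarrow> 0"
  shows "(\<lambda>n. LINT x|lborel. majorant x * f n x) \<longlonglongrightarrow> 0"
proof -
  have "(\<lambda>n. LINT x|lborel. majorant x * f n x) \<longlonglongrightarrow> (LINT x::real|lborel. (0::real))"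
  proof (rule integral_dominated_convergence[where w = majorant])
    show "integrable lborel majorant" by (rule majorant_integrable)
    show "AE x in lborel. (\<lambda>n. majorant x * f n x) \<longlonglongrightarrow> 0"
    proof (rule AE_I2)
      fix x show "(\<lambda>n. majorant x * f n x) \<longlonglongrightarrow> 0"
        by (cases "0 < x") (auto intro: tendsto_mult_right_zero l simp: majorant_def)
    qed
    show "AE x in lborel. norm (majorant x * f n x) \<le> majorant x" for n
    proof (rule AE_I2)
      fix x show "norm (majorant x * f n x) \<le> majorant x"
      proof (cases "0 < x")
        case True
        then have "majorant x * \<bar>f n x\<bar> \<le> majorant x * 1" by (intro mult_left_mono b majorant_nonneg)
        then show ?thesis using majorant_nonneg[of x] by (simp add: abs_mult)
      qed (simp add: majorant_def)
    qed
  qed measurable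
  then show ?thesis by simp
qed

lemma majorant_tail:
  assumes X: "0 < X"
  shows "(LINT x|lborel. majorant x * indicator {X<..} x) \<le> 2 / sqrt X"
proof -
  note T = inverse_x_sqrt_integral[OF X]
  have "(LINT x|lborel. majorant x * indicator {X<..} x) \<le> (LINT x|lborel. indicator {X<..} x *\<^sub>R (1 / (x * sqrt x)))"
  proof (rule integral_mono)
    show "integrable lborel (\<lambda>x. majorant x * indicator {X<..} x)"
      by (rule integrable_real_mult_indicator) (use majorant_integrable in auto)
    show "integrable lborel (\<lambda>x. indicator {X<..} x *\<^sub>R (1 / (x * sqrt x)))" using T(1) by (simp add: set_integrable_def)
    show "majorant x * indicator {X<..} x \<le> indicator {X<..} x *\<^sub>R (1 / (x * sqrt x))" for x
      using majorant_le_tail[of x] X by (auto simp: indicator_def)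
  qed
  then show ?thesis using T(2) by (simp add: set_lebesgue_integral_def)
qed

text \<open>Everything the decay argument uses about the charge: local boundedness, causality and
  the regular equation with a forcing of decay 3/2. The initial datum enters only through g.\<close>

locale ionization_charge = ionization +
  fixes q0 g :: "real \<Rightarrow> complex" and G :: real
  assumes q0_meas [measurable]: "q0 \<in> borel_measurable borel"
    and q0_zero: "t \<le> 0 \<Longrightarrow> q0 t = 0"
    and q0_loc: "\<exists>M\<ge>0. \<forall>t\<le>R. norm (q0 t) \<le> M"
    and q0_eq: "reg_op \<alpha> 0 q0 t = g t"
    and g_bound: "norm (g t) \<le> G"
    and g_decay: "0 \<le> t \<Longrightarrow> norm (g t) \<le> G * (1 + t) powr (-3/2)"
begin

section \<open>Commutators with weights and Volterra bounds\<close>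

definition op_const :: real where "op_const = 1 + norm kappa * alpha_norm"

lemma op_const_ge: "1 \<le> op_const" using alpha_norm_nonneg by (simp add: op_const_def)

lemma G_nonneg: "0 \<le> G" using order_trans[OF norm_ge_zero g_bound] .

text \<open>Commutator estimate: moving a weight through the operator multiplies each kernel by exp
  (- \<gamma> x) \<rho> (t - x) - \<rho> t. Both kernels are then replaced by
  \<open>majorant\<close>, so a slowly varying weight produces a small error.\<close>

lemma reg_op_weighted:
  assumes \<gamma>: "0 \<le> \<gamma>" and [measurable]: "\<rho> \<in> borel_measurable borel" and R: "\<And>s. \<bar>\<rho> s\<bar> \<le> R"
  shows "integrable lborel (\<lambda>x. majorant x * (\<bar>exp (- \<gamma> * x) * \<rho> (t - x) - \<rho> t\<bar> * norm (q0 (t - x))))"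
    and "norm (reg_op \<alpha> \<gamma> (\<lambda>s. \<rho> s *\<^sub>R q0 s) t) \<le> \<bar>\<rho> t\<bar> * norm (g t)
      + op_const * (LINT x|lborel. majorant x * (\<bar>exp (- \<gamma> * x) * \<rho> (t - x) - \<rho> t\<bar> * norm (q0 (t - x))))"
proof -
  obtain M where M: "0 \<le> M" "\<And>s. s \<le> t \<Longrightarrow> norm (q0 s) \<le> M" using q0_loc[of t] by blast
  have R0: "0 \<le> R" using order_trans[OF abs_ge_zero R] .
  define d where "d = (\<lambda>x. exp (- \<gamma> * x) * \<rho> (t - x) - \<rho> t)"
  have [measurable]: "d \<in> borel_measurable borel" unfolding d_def by measurable
  have e: "\<bar>exp (- \<gamma> * x) * \<rho> (t - x)\<bar> \<le> R" if "0 < x" for x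
  proof -
    have "exp (- \<gamma> * x) * \<bar>\<rho> (t - x)\<bar> \<le> 1 * R" using that \<gamma> R by (intro mult_mono) auto
    then show ?thesis by (simp add: abs_mult)
  qed
  have dB: "\<bar>d x\<bar> \<le> 2 * R" if "0 < x" for x using e[OF that] R[of t] unfolding d_def by linarith
  have b1: "norm (exp (- \<gamma> * x) *\<^sub>R (\<rho> (t - x) *\<^sub>R q0 (t - x))) \<le> R * M" if "0 < x" for x
  proof -
    have "\<bar>exp (- \<gamma> * x) * \<rho> (t - x)\<bar> * norm (q0 (t - x)) \<le> R * M" using that R0 by (intro mult_mono e M) auto
    then show ?thesis by (simp add: abs_mult mult.assoc)
  qed
  have b2: "norm (\<rho> t *\<^sub>R q0 (t - x)) \<le> R * M" if "0 < x" for x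
    using that R0 by (auto intro!: mult_mono R M)
  have b3: "norm (d x *\<^sub>R q0 (t - x)) \<le> 2 * R * M" if "0 < x" for x
    using that R0 dB[OF that] M by (auto intro!: mult_mono)
  have ba: "norm (of_real (\<alpha> s) * y) \<le> alpha_norm * B" if "norm y \<le> B" for y :: complex and B s by (rule alpha_mult_bound[OF that])
  note kl = kernel_integral_bound[OF good_kernel_mix_kernel] and ks = kernel_integral_bound[OF good_kernel_reg_kernel]
  show I: "integrable lborel (\<lambda>x. majorant x * (\<bar>exp (- \<gamma> * x) * \<rho> (t - x) - \<rho> t\<bar> * norm (q0 (t - x))))"
    using kl(2)[OF _ b3] by (simp add: d_def)
  have L: "conv (\<lambda>x. exp (- \<gamma> * x) * mix_kernel x) (\<lambda>s. \<rho> s *\<^sub>R q0 s) t - \<rho> t *\<^sub>R conv mix_kernel q0 t = (LINT x|lborel. mix_kernel x *\<^sub>R (d x *\<^sub>R q0 (t - x)))"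
  proof -
    have "conv (\<lambda>x. exp (- \<gamma> * x) * mix_kernel x) (\<lambda>s. \<rho> s *\<^sub>R q0 s) t - \<rho> t *\<^sub>R conv mix_kernel q0 t
      = (LINT x|lborel. mix_kernel x *\<^sub>R (exp (- \<gamma> * x) *\<^sub>R (\<rho> (t - x) *\<^sub>R q0 (t - x)))) - (LINT x|lborel. mix_kernel x *\<^sub>R (\<rho> t *\<^sub>R q0 (t - x)))"
      unfolding conv_def integral_scaleR_right[symmetric] by (simp add: mult_ac)
    also have "\<dots> = (LINT x|lborel. mix_kernel x *\<^sub>R (exp (- \<gamma> * x) *\<^sub>R (\<rho> (t - x) *\<^sub>R q0 (t - x))) - mix_kernel x *\<^sub>R (\<rho> t *\<^sub>R q0 (t - x)))"
      by (rule Bochner_Integration.integral_diff[symmetric]) (rule kl(1)[OF _ b1] kl(1)[OF _ b2]; simp)+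
    finally show ?thesis by (simp add: d_def algebra_simps)
  qed
  have S: "conv (\<lambda>x. exp (- \<gamma> * x) * reg_kernel x) (\<lambda>s. of_real (\<alpha> s) * (\<rho> s *\<^sub>R q0 s)) t - \<rho> t *\<^sub>R conv reg_kernel (\<lambda>s. of_real (\<alpha> s) * q0 s) t
     = (LINT x|lborel. reg_kernel x *\<^sub>R (of_real (\<alpha> (t - x)) * (d x *\<^sub>R q0 (t - x))))"
  proof -
    have "conv (\<lambda>x. exp (- \<gamma> * x) * reg_kernel x) (\<lambda>s. of_real (\<alpha> s) * (\<rho> s *\<^sub>R q0 s)) t - \<rho> t *\<^sub>R conv reg_kernel (\<lambda>s. of_real (\<alpha> s) * q0 s) t
      = (LINT x|lborel. reg_kernel x *\<^sub>R (of_real (\<alpha> (t - x)) * (exp (- \<gamma> * x) *\<^sub>R (\<rho> (t - x) *\<^sub>R q0 (t - x))))) - (LINT x|lborel. reg_kernel x *\<^sub>R (of_real (\<alpha> (t - x)) * (\<rho> t *\<^sub>R q0 (t - x))))"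
      unfolding conv_def integral_scaleR_right[symmetric] by (simp add: mult_ac)
    also have "\<dots> = (LINT x|lborel. reg_kernel x *\<^sub>R (of_real (\<alpha> (t - x)) * (exp (- \<gamma> * x) *\<^sub>R (\<rho> (t - x) *\<^sub>R q0 (t - x)))) - reg_kernel x *\<^sub>R (of_real (\<alpha> (t - x)) * (\<rho> t *\<^sub>R q0 (t - x))))"
      by (rule Bochner_Integration.integral_diff[symmetric]) (rule ks(1)[OF _ ba[OF b1]] ks(1)[OF _ ba[OF b2]]; simp)+
    finally show ?thesis by (simp add: d_def algebra_simps)
  qed
  define Y where "Y = (LINT x|lborel. majorant x * (\<bar>d x\<bar> * norm (q0 (t - x))))"
  have nL: "norm (LINT x|lborel. mix_kernel x *\<^sub>R (d x *\<^sub>R q0 (t - x))) \<le> Y"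
    using kl(3)[OF _ b3] by (simp add: Y_def)
  have nS: "norm (LINT x|lborel. reg_kernel x *\<^sub>R (of_real (\<alpha> (t - x)) * (d x *\<^sub>R q0 (t - x)))) \<le> alpha_norm * Y"
  proof -
    have "norm (LINT x|lborel. reg_kernel x *\<^sub>R (of_real (\<alpha> (t - x)) * (d x *\<^sub>R q0 (t - x)))) \<le> (LINT x|lborel. majorant x * norm (of_real (\<alpha> (t - x)) * (d x *\<^sub>R q0 (t - x))))"
      by (rule ks(3)[OF _ ba[OF b3]]) auto
    also have "\<dots> \<le> (LINT x|lborel. alpha_norm * (majorant x * (\<bar>d x\<bar> * norm (q0 (t - x)))))"
    proof (rule integral_mono)
      show "integrable lborel (\<lambda>x. majorant x * norm (of_real (\<alpha> (t - x)) * (d x *\<^sub>R q0 (t - x))))"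
        by (rule ks(2)[OF _ ba[OF b3]]) auto
      show "integrable lborel (\<lambda>x. alpha_norm * (majorant x * (\<bar>d x\<bar> * norm (q0 (t - x)))))" using I by (simp add: d_def)
      fix x
      have "norm (of_real (\<alpha> (t - x)) * (d x *\<^sub>R q0 (t - x))) \<le> alpha_norm * (\<bar>d x\<bar> * norm (q0 (t - x)))"
        by (rule ba) simp
      then have "majorant x * norm (of_real (\<alpha> (t - x)) * (d x *\<^sub>R q0 (t - x))) \<le> majorant x * (alpha_norm * (\<bar>d x\<bar> * norm (q0 (t - x))))"
        by (intro mult_left_mono majorant_nonneg)
      then show "majorant x * norm (of_real (\<alpha> (t - x)) * (d x *\<^sub>R q0 (t - x))) \<le> alpha_norm * (majorant x * (\<bar>d x\<bar> * norm (q0 (t - x))))"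
        by (simp only: mult.left_commute)
    qed
    finally show ?thesis by (simp add: Y_def)
  qed
  define X1 where "X1 = (LINT x|lborel. mix_kernel x *\<^sub>R (d x *\<^sub>R q0 (t - x)))"
  define X2 where "X2 = (LINT x|lborel. reg_kernel x *\<^sub>R (of_real (\<alpha> (t - x)) * (d x *\<^sub>R q0 (t - x))))"
  \<comment> \<open>Pure algebra separating the weighted equation from the two commutators.\<close>
  have lin: "r *\<^sub>R y - a' + kappa * b' = r *\<^sub>R (y - a + kappa * b) - (a' - r *\<^sub>R a) + kappa * (b' - r *\<^sub>R b)"
    for r :: real and y a a' b b' :: complex
    by (simp add: algebra_simps)
  have A0: "q0 t - conv mix_kernel q0 t + kappa * conv reg_kernel (\<lambda>s. of_real (\<alpha> s) * q0 s) t = g t"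
    using q0_eq[of t] by (simp add: reg_op_def)
  have "reg_op \<alpha> \<gamma> (\<lambda>s. \<rho> s *\<^sub>R q0 s) t = \<rho> t *\<^sub>R g t - X1 + kappa * X2"
    unfolding X1_def X2_def L[symmetric] S[symmetric] A0[symmetric] reg_op_def by (rule lin)
  then have "norm (reg_op \<alpha> \<gamma> (\<lambda>s. \<rho> s *\<^sub>R q0 s) t) = norm (\<rho> t *\<^sub>R g t - X1 + kappa * X2)" by (rule arg_cong)
  also have "\<dots> \<le> norm (\<rho> t *\<^sub>R g t) + norm X1 + norm (kappa * X2)"
    by (rule order_trans[OF norm_triangle_ineq add_right_mono[OF norm_triangle_ineq4]])
  also have "\<dots> \<le> \<bar>\<rho> t\<bar> * norm (g t) + Y + norm kappa * (alpha_norm * Y)"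
    using nL nS unfolding X1_def[symmetric] X2_def[symmetric] norm_mult norm_scaleR
    by (intro add_mono mult_left_mono) auto
  also have "\<dots> = \<bar>\<rho> t\<bar> * norm (g t) + op_const * Y" by (simp add: op_const_def distrib_right)
  finally show "norm (reg_op \<alpha> \<gamma> (\<lambda>s. \<rho> s *\<^sub>R q0 s) t) \<le> \<bar>\<rho> t\<bar> * norm (g t)
      + op_const * (LINT x|lborel. majorant x * (\<bar>exp (- \<gamma> * x) * \<rho> (t - x) - \<rho> t\<bar> * norm (q0 (t - x))))"
    by (simp only: Y_def d_def)
qed

lemma q0_volterra_bound:
  "integrable lborel (\<lambda>x. majorant x * norm (q0 (t - x)))"
  "norm (q0 t) \<le> norm (g t) + op_const * (LINT x|lborel. majorant x * norm (q0 (t - x)))"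
proof -
  obtain M where M: "0 \<le> M" "\<And>s. s \<le> t \<Longrightarrow> norm (q0 s) \<le> M" using q0_loc[of t] by blast
  have b: "norm (q0 (t - x)) \<le> M" if "0 < x" for x using that by (intro M) auto
  have ba: "norm (of_real (\<alpha> (t - x)) * q0 (t - x)) \<le> alpha_norm * M" if "0 < x" for x by (rule alpha_mult_bound[OF b[OF that]])
  note kl = kernel_integral_bound[OF good_kernel_mix_kernel] and ks = kernel_integral_bound[OF good_kernel_reg_kernel]
  show I: "integrable lborel (\<lambda>x. majorant x * norm (q0 (t - x)))" by (rule kl(2)[OF _ b]) auto
  define Y where "Y = (LINT x|lborel. majorant x * norm (q0 (t - x)))"
  have nL: "norm (conv mix_kernel q0 t) \<le> Y" unfolding conv_def Y_def by (rule kl(3)[OF _ b]) auto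
  have nS: "norm (conv reg_kernel (\<lambda>s. of_real (\<alpha> s) * q0 s) t) \<le> alpha_norm * Y"
  proof -
    have "norm (conv reg_kernel (\<lambda>s. of_real (\<alpha> s) * q0 s) t) \<le> (LINT x|lborel. majorant x * norm (of_real (\<alpha> (t - x)) * q0 (t - x)))"
      unfolding conv_def by (rule ks(3)[OF _ ba]) auto
    also have "\<dots> \<le> (LINT x|lborel. alpha_norm * (majorant x * norm (q0 (t - x))))"
    proof (rule integral_mono)
      show "integrable lborel (\<lambda>x. majorant x * norm (of_real (\<alpha> (t - x)) * q0 (t - x)))" by (rule ks(2)[OF _ ba]) auto
      show "integrable lborel (\<lambda>x. alpha_norm * (majorant x * norm (q0 (t - x))))" using I by simp
      fix x
      have "norm (of_real (\<alpha> (t - x)) * q0 (t - x)) \<le> alpha_norm * norm (q0 (t - x))" by (rule alpha_mult_bound) simp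
      then have "majorant x * norm (of_real (\<alpha> (t - x)) * q0 (t - x)) \<le> majorant x * (alpha_norm * norm (q0 (t - x)))"
        by (intro mult_left_mono majorant_nonneg)
      then show "majorant x * norm (of_real (\<alpha> (t - x)) * q0 (t - x)) \<le> alpha_norm * (majorant x * norm (q0 (t - x)))"
        by (simp only: mult.left_commute)
    qed
    finally show ?thesis by (simp add: Y_def)
  qed
  have "q0 t = reg_op \<alpha> 0 q0 t + conv mix_kernel q0 t - kappa * conv reg_kernel (\<lambda>s. of_real (\<alpha> s) * q0 s) t"
    by (simp add: reg_op_def)
  then have "norm (q0 t) = norm (reg_op \<alpha> 0 q0 t + conv mix_kernel q0 t - kappa * conv reg_kernel (\<lambda>s. of_real (\<alpha> s) * q0 s) t)"
    by (rule arg_cong)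
  also have "\<dots> \<le> norm (reg_op \<alpha> 0 q0 t) + norm (conv mix_kernel q0 t) + norm (kappa * conv reg_kernel (\<lambda>s. of_real (\<alpha> s) * q0 s) t)"
    by (rule order_trans[OF norm_triangle_ineq4 add_right_mono[OF norm_triangle_ineq]])
  also have "\<dots> \<le> norm (g t) + Y + norm kappa * (alpha_norm * Y)"
    unfolding q0_eq norm_mult by (intro add_mono mult_left_mono nL nS) auto
  finally show "norm (q0 t) \<le> norm (g t) + op_const * (LINT x|lborel. majorant x * norm (q0 (t - x)))"
    by (simp add: op_const_def Y_def algebra_simps)
qed

text \<open>A large rate makes the mass of the damped majorant so small that the Volterra inequality
  becomes a contraction. This is the crude starting point for lowering the rate.\<close>

lemma q0_exp_bound: "\<exists>\<Gamma>\<ge>0. \<exists>M. \<forall>t. exp (- \<Gamma> * t) * norm (q0 t) \<le> M"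
proof -
  have "(\<lambda>n. LINT x|lborel. majorant x * exp (- real n * x)) \<longlonglongrightarrow> 0"
  proof (rule majorant_integral_tendsto_0)
    show "(\<lambda>n. exp (- real n * x)) \<longlonglongrightarrow> 0" if "0 < x" for x using that by real_asymp
  qed auto
  then have "(\<lambda>n. op_const * (LINT x|lborel. majorant x * exp (- real n * x))) \<longlonglongrightarrow> op_const * 0" by (intro tendsto_intros)
  then have "\<forall>\<^sub>F n in sequentially. op_const * (LINT x|lborel. majorant x * exp (- real n * x)) < 1 / 2"
    by (intro order_tendstoD(2)) auto
  then obtain n where n: "op_const * (LINT x|lborel. majorant x * exp (- real n * x)) < 1 / 2"
    unfolding eventually_sequentially by blast
  define \<Gamma> where "\<Gamma> = real n"
  define J where "J = (LINT x|lborel. majorant x * exp (- \<Gamma> * x))"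
  have J: "op_const * J < 1 / 2" using n by (simp add: J_def \<Gamma>_def)
  have Ji: "integrable lborel (\<lambda>x. majorant x * exp (- \<Gamma> * x))"
  proof (rule Bochner_Integration.integrable_bound[OF majorant_integrable])
    show "AE x in lborel. norm (majorant x * exp (- \<Gamma> * x)) \<le> norm (majorant x)"
    proof (rule AE_I2)
      fix x show "norm (majorant x * exp (- \<Gamma> * x)) \<le> norm (majorant x)"
      proof (cases "0 < x")
        case True
        then have "exp (- \<Gamma> * x) \<le> 1" by (simp add: \<Gamma>_def)
        then show ?thesis using majorant_nonneg[of x] by (simp add: abs_mult mult_left_le)
      qed (simp add: majorant_def)
    qed
  qed measurable
  have "exp (- \<Gamma> * t) * norm (q0 t) \<le> 2 * G" for t
  proof -
    \<comment> \<open>The supremum is taken up to t only, where local boundedness makes it finite;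
      the bound 2 G obtained does not depend on t.\<close>
    define S where "S = (SUP s\<in>{..t}. exp (- \<Gamma> * s) * norm (q0 s))"
    obtain M where M: "0 \<le> M" "\<And>s. s \<le> t \<Longrightarrow> norm (q0 s) \<le> M" using q0_loc[of t] by blast
    have "exp (- \<Gamma> * s) * norm (q0 s) \<le> 1 * M" if "s \<le> t" for s
    proof (cases "0 < s")
      case True
      then show ?thesis using that M by (intro mult_mono) (auto simp: \<Gamma>_def)
    qed (use M q0_zero in auto)
    then have bdd: "bdd_above ((\<lambda>s. exp (- \<Gamma> * s) * norm (q0 s)) ` {..t})" by (auto simp: bdd_above_def)
    have le_S: "exp (- \<Gamma> * s) * norm (q0 s) \<le> S" if "s \<le> t" for s
      unfolding S_def using that by (intro cSUP_upper[OF _ bdd]) auto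
    have S0: "0 \<le> S" using order_trans[OF _ le_S[of t]] by simp
    have step: "exp (- \<Gamma> * s) * norm (q0 s) \<le> G + S / 2" if s: "s \<le> t" for s
    proof (cases "0 < s")
      case True
      have "exp (- \<Gamma> * s) * norm (q0 s) \<le> exp (- \<Gamma> * s) * (norm (g s) + op_const * (LINT x|lborel. majorant x * norm (q0 (s - x))))"
        by (intro mult_left_mono q0_volterra_bound) auto
      also have "\<dots> = exp (- \<Gamma> * s) * norm (g s) + op_const * (LINT x|lborel. exp (- \<Gamma> * s) * (majorant x * norm (q0 (s - x))))"
        unfolding distrib_left integral_mult_right_zero by (simp only: mult.left_commute)
      also have "\<dots> \<le> 1 * G + op_const * (S * J)"
      proof (rule add_mono)
        have "exp (- \<Gamma> * s) \<le> 1" using True by (simp add: \<Gamma>_def)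
        then show "exp (- \<Gamma> * s) * norm (g s) \<le> 1 * G" by (intro mult_mono g_bound) auto
        have "(LINT x|lborel. exp (- \<Gamma> * s) * (majorant x * norm (q0 (s - x)))) \<le> (LINT x|lborel. S * (majorant x * exp (- \<Gamma> * x)))"
        proof (rule integral_mono)
          show "integrable lborel (\<lambda>x. exp (- \<Gamma> * s) * (majorant x * norm (q0 (s - x))))"
            by (rule integrable_mult_right) (rule q0_volterra_bound)
          show "integrable lborel (\<lambda>x. S * (majorant x * exp (- \<Gamma> * x)))" by (rule integrable_mult_right) (rule Ji)
          fix x
          show "exp (- \<Gamma> * s) * (majorant x * norm (q0 (s - x))) \<le> S * (majorant x * exp (- \<Gamma> * x))"
          proof (cases "0 < x")
            case True
            have "exp (- \<Gamma> * (s - x)) * norm (q0 (s - x)) \<le> S" using True s by (intro le_S) auto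
            then have "(majorant x * exp (- \<Gamma> * x)) * (exp (- \<Gamma> * (s - x)) * norm (q0 (s - x))) \<le> (majorant x * exp (- \<Gamma> * x)) * S"
              by (intro mult_left_mono mult_nonneg_nonneg majorant_nonneg) auto
            moreover have "exp (- \<Gamma> * s) = exp (- \<Gamma> * x) * exp (- \<Gamma> * (s - x))" by (simp add: algebra_simps flip: exp_add)
            ultimately show ?thesis by (simp only: mult_ac)
          qed (simp add: majorant_def)
        qed
        also have "\<dots> = S * J" by (simp add: J_def)
        finally show "op_const * (LINT x|lborel. exp (- \<Gamma> * s) * (majorant x * norm (q0 (s - x)))) \<le> op_const * (S * J)"
          using op_const_ge by (intro mult_left_mono) auto
      qed
      also have "op_const * (S * J) \<le> S * (1 / 2)"
        using mult_left_mono[OF less_imp_le[OF J] S0] by (simp add: mult_ac)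
      finally show ?thesis by simp
    qed (use G_nonneg S0 q0_zero in auto)
    have "S \<le> G + S / 2" unfolding S_def by (rule cSUP_least) (use step S_def in auto)
    then show ?thesis using le_S[of t] by simp
  qed
  then show ?thesis by (intro exI[of _ \<Gamma>] conjI exI[of _ "2 * G"]) (auto simp: \<Gamma>_def)
qed

text \<open>Only 0 < x < t matters: \<open>majorant\<close> vanishes for x <= 0 and the charge at t
  - x for x >= t.\<close>

lemma weight_comm_le:
  assumes "\<And>x. 0 < x \<Longrightarrow> x < t \<Longrightarrow> \<bar>exp (- \<gamma> * x) * \<rho> (t - x) - \<rho> t\<bar> * norm (q0 (t - x)) \<le> f x"
    and "\<And>x. 0 < x \<Longrightarrow> 0 \<le> f x"
  shows "majorant x * (\<bar>exp (- \<gamma> * x) * \<rho> (t - x) - \<rho> t\<bar> * norm (q0 (t - x))) \<le> majorant x * f x"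
proof (cases "0 < x")
  case True
  have "\<bar>exp (- \<gamma> * x) * \<rho> (t - x) - \<rho> t\<bar> * norm (q0 (t - x)) \<le> f x"
  proof (cases "x < t")
    case False
    then show ?thesis using assms(2)[OF True] q0_zero[of "t - x"] by simp
  qed (use assms(1)[OF True] in auto)
  then show ?thesis by (intro mult_left_mono majorant_nonneg)
qed (simp add: majorant_def)

text \<open>Continuity argument on the set E of admissible exponential rates. The a priori bound C G
  is the same for all rates in E, so the infimum inherits it. If the infimum were positive, a
  slightly smaller rate would still be admissible, with the commutator as a small
  perturbation.\<close>

lemma q0_bounded: "\<exists>M\<ge>0. \<forall>t. norm (q0 t) \<le> M"
proof -
  obtain \<Gamma> M0 where \<Gamma>: "0 \<le> \<Gamma>" "\<And>t. exp (- \<Gamma> * t) * norm (q0 t) \<le> M0" using q0_exp_bound by blast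
  obtain C where C: "0 < C" and ap: "\<And>\<gamma> w E t. \<gamma> \<in> {0..\<Gamma>} \<Longrightarrow> bdd_meas w \<Longrightarrow> (\<And>t. norm (reg_op \<alpha> \<gamma> w t) \<le> E) \<Longrightarrow> norm (w t) \<le> C * E"
    using apriori_estimate[of \<Gamma>] by meson
  define E where "E = {\<gamma>. 0 \<le> \<gamma> \<and> \<gamma> \<le> \<Gamma> \<and> (\<exists>M. \<forall>t. exp (- \<gamma> * t) * norm (q0 t) \<le> M)}"
  have \<Gamma>E: "\<Gamma> \<in> E" using \<Gamma> by (auto simp: E_def)
  have unif: "exp (- \<gamma> * t) * norm (q0 t) \<le> C * G" if \<gamma>: "\<gamma> \<in> E" for \<gamma> t
  proof -
    from \<gamma> obtain M where g: "0 \<le> \<gamma>" "\<gamma> \<le> \<Gamma>" and M: "\<And>t. exp (- \<gamma> * t) * norm (q0 t) \<le> M" by (auto simp: E_def)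
    \<comment> \<open>With the exact exponential the commutator vanishes wherever it counts, so
      damping costs nothing. The maximum with 0 keeps the weight bounded on the negative
      axis.\<close>
    define \<rho> where "\<rho> = (\<lambda>t::real. exp (- \<gamma> * max 0 t))"
    have [measurable]: "\<rho> \<in> borel_measurable borel" unfolding \<rho>_def by measurable
    have r1: "0 \<le> \<rho> t" "\<rho> t \<le> 1" for t using g by (auto simp: \<rho>_def)
    have v: "norm (\<rho> t *\<^sub>R q0 t) = exp (- \<gamma> * t) * norm (q0 t)" for t
      using q0_zero[of t] by (cases "0 < t") (auto simp: \<rho>_def)
    have "norm (\<rho> t *\<^sub>R q0 t) \<le> C * G"
    proof (rule ap[of \<gamma> "\<lambda>t. \<rho> t *\<^sub>R q0 t" G])
      show "\<gamma> \<in> {0..\<Gamma>}" using g by simp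
      show "bdd_meas (\<lambda>t. \<rho> t *\<^sub>R q0 t)" unfolding bdd_meas_def v using M by auto
      fix t
      note A = reg_op_weighted[OF g(1) _ , of \<rho> 1 t]
      have "(LINT x|lborel. majorant x * (\<bar>exp (- \<gamma> * x) * \<rho> (t - x) - \<rho> t\<bar> * norm (q0 (t - x)))) \<le> (LINT x|lborel. majorant x * 0)"
      proof (rule integral_mono)
        show "integrable lborel (\<lambda>x. majorant x * (\<bar>exp (- \<gamma> * x) * \<rho> (t - x) - \<rho> t\<bar> * norm (q0 (t - x))))"
          by (rule A(1)) (use r1 in auto)
        show "majorant x * (\<bar>exp (- \<gamma> * x) * \<rho> (t - x) - \<rho> t\<bar> * norm (q0 (t - x))) \<le> majorant x * 0" for x
          by (rule weight_comm_le) (auto simp: \<rho>_def algebra_simps simp flip: exp_add)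
      qed simp
      then have c0: "op_const * (LINT x|lborel. majorant x * (\<bar>exp (- \<gamma> * x) * \<rho> (t - x) - \<rho> t\<bar> * norm (q0 (t - x)))) \<le> 0"
        using op_const_ge by (intro mult_nonneg_nonpos) auto
      have "norm (reg_op \<alpha> \<gamma> (\<lambda>s. \<rho> s *\<^sub>R q0 s) t) \<le> \<bar>\<rho> t\<bar> * norm (g t) + op_const * (LINT x|lborel. majorant x * (\<bar>exp (- \<gamma> * x) * \<rho> (t - x) - \<rho> t\<bar> * norm (q0 (t - x))))"
        by (rule A(2)) (use r1 in auto)
      also have "\<bar>\<rho> t\<bar> * norm (g t) \<le> 1 * G" using r1[of t] g_bound by (intro mult_mono) auto
      finally show "norm (reg_op \<alpha> \<gamma> (\<lambda>s. \<rho> s *\<^sub>R q0 s) t) \<le> G" using c0 by simp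
    qed
    then show ?thesis unfolding v .
  qed
  define \<gamma>s where "\<gamma>s = Inf E"
  have Ebd: "bdd_below E" by (auto simp: E_def bdd_below_def)
  have gs: "0 \<le> \<gamma>s" "\<gamma>s \<le> \<Gamma>"
    unfolding \<gamma>s_def using \<Gamma>E Ebd by (auto intro!: cInf_greatest cInf_lower simp: E_def)
  have "\<gamma>s \<in> closure E" unfolding \<gamma>s_def using \<Gamma>E Ebd by (intro closure_contains_Inf) auto
  then obtain X where X: "\<And>n. X n \<in> E" "X \<longlonglongrightarrow> \<gamma>s" unfolding closure_sequential by blast
  have star: "exp (- \<gamma>s * t) * norm (q0 t) \<le> C * G" for t
  proof (rule LIMSEQ_le_const2)
    show "(\<lambda>n. exp (- X n * t) * norm (q0 t)) \<longlonglongrightarrow> exp (- \<gamma>s * t) * norm (q0 t)" by (intro tendsto_intros X)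
    show "\<exists>N. \<forall>n\<ge>N. exp (- X n * t) * norm (q0 t) \<le> C * G" using unif[OF X(1)] by blast
  qed
  have "\<gamma>s = 0"
  proof (rule ccontr)
    assume "\<gamma>s \<noteq> 0"
    with gs have gp: "0 < \<gamma>s" by simp
    \<comment> \<open>Size of the commutator when the rate is lowered by \<delta>. It is at most 1
      as long as \<delta> <= \<open>\<gamma>s\<close> and tends to 0 pointwise, so its integral
      against \<open>majorant\<close> can be made small.\<close>
    define \<phi> where "\<phi> = (\<lambda>\<delta> x::real. exp (- \<gamma>s * x) * (exp (\<delta> * x) - 1))"
    have \<phi>01: "0 \<le> \<phi> \<delta> x \<and> \<phi> \<delta> x \<le> 1" if "0 \<le> \<delta>" "\<delta> \<le> \<gamma>s" "0 < x" for \<delta> x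
    proof -
      have "\<delta> * x \<le> \<gamma>s * x" using that by simp
      then have "exp (- \<gamma>s * x) * exp (\<delta> * x) \<le> 1" by (simp flip: exp_add)
      moreover have "1 \<le> exp (\<delta> * x)" using that by simp
      moreover have "0 < exp (- \<gamma>s * x)" by simp
      ultimately have "exp (- \<gamma>s * x) * exp (\<delta> * x) - exp (- \<gamma>s * x) \<le> 1" by linarith
      then show ?thesis using \<open>1 \<le> exp (\<delta> * x)\<close> by (simp add: \<phi>_def right_diff_distrib)
    qed
    define \<delta>n where "\<delta>n = (\<lambda>n. \<gamma>s / real (Suc n))"
    have dn: "0 < \<delta>n n" "\<delta>n n \<le> \<gamma>s" for n using gp by (auto simp: \<delta>n_def field_simps)
    have "\<delta>n \<longlonglongrightarrow> \<gamma>s * 0" unfolding \<delta>n_def divide_inverse by (intro tendsto_intros LIMSEQ_inverse_real_of_nat)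
    then have dlim: "\<delta>n \<longlonglongrightarrow> 0" by simp
    have "(\<lambda>n. LINT x|lborel. majorant x * \<phi> (\<delta>n n) x) \<longlonglongrightarrow> 0"
    proof (rule majorant_integral_tendsto_0)
      show "\<bar>\<phi> (\<delta>n n) x\<bar> \<le> 1" if "0 < x" for n x using \<phi>01[OF less_imp_le[OF dn(1)] dn(2) that] by simp
      have "(\<lambda>n. exp (- \<gamma>s * x) * (exp (\<delta>n n * x) - 1)) \<longlonglongrightarrow> exp (- \<gamma>s * x) * (exp (0 * x) - 1)" for x
        by (intro tendsto_intros dlim)
      then show "(\<lambda>n. \<phi> (\<delta>n n) x) \<longlonglongrightarrow> 0" for x by (simp add: \<phi>_def)
    qed (simp add: \<phi>_def)
    then have "(\<lambda>n. C * (op_const * (LINT x|lborel. majorant x * \<phi> (\<delta>n n) x))) \<longlonglongrightarrow> C * (op_const * 0)" by (intro tendsto_intros)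
    then have "\<forall>\<^sub>F n in sequentially. C * (op_const * (LINT x|lborel. majorant x * \<phi> (\<delta>n n) x)) < 1 / 2"
      by (intro order_tendstoD(2)) auto
    then obtain n where n: "C * (op_const * (LINT x|lborel. majorant x * \<phi> (\<delta>n n) x)) < 1 / 2"
      unfolding eventually_sequentially by blast
    define \<delta> where "\<delta> = \<delta>n n"
    have d: "0 < \<delta>" "\<delta> \<le> \<gamma>s" using dn by (auto simp: \<delta>_def)
    define D where "D = (LINT x|lborel. majorant x * \<phi> \<delta> x)"
    have CD: "C * (op_const * D) < 1 / 2" using n by (simp add: D_def \<delta>_def)
    have \<phi>i: "integrable lborel (\<lambda>x. majorant x * \<phi> \<delta> x)"
    proof (rule Bochner_Integration.integrable_bound[OF majorant_integrable])
      show "(\<lambda>x. majorant x * \<phi> \<delta> x) \<in> borel_measurable lborel" unfolding \<phi>_def by measurable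
      show "AE x in lborel. norm (majorant x * \<phi> \<delta> x) \<le> norm (majorant x)"
      proof (rule AE_I2)
        fix x show "norm (majorant x * \<phi> \<delta> x) \<le> norm (majorant x)"
        proof (cases "0 < x")
          case True
          then show ?thesis using majorant_nonneg[of x] \<phi>01[of \<delta> x] d by (simp add: abs_mult mult_left_le)
        qed (simp add: majorant_def)
      qed
    qed
    have main: "exp (- \<gamma>s * t + \<delta> * t) * norm (q0 t) \<le> 2 * (C * G)" if t: "0 < t" for t
    proof -
      \<comment> \<open>The improved growth of the weight stops at N, so the weighted charge is
        bounded by what is already known and its supremum V is finite. Choosing N = t gives the full
        improvement at t, and the bound does not depend on N.\<close>
      define N where "N = t"
      have N: "0 < N" using t by (simp add: N_def)
      define \<rho> where "\<rho> = (\<lambda>t::real. exp (- \<gamma>s * max 0 t + \<delta> * min (max 0 t) N))"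
      have [measurable]: "\<rho> \<in> borel_measurable borel" unfolding \<rho>_def by measurable
      have r1: "0 \<le> \<rho> s" "\<rho> s \<le> 1" for s
      proof -
        have "\<delta> * min (max 0 s) N \<le> \<gamma>s * max 0 s" using d N by (intro mult_mono) auto
        then show "\<rho> s \<le> 1" by (simp add: \<rho>_def)
      qed (simp add: \<rho>_def)
      have vb: "norm (\<rho> s *\<^sub>R q0 s) \<le> exp (\<delta> * N) * (C * G)" for s
      proof (cases "0 < s")
        case True
        have "\<rho> s \<le> exp (\<delta> * N) * exp (- \<gamma>s * s)"
          using True d by (simp add: \<rho>_def flip: exp_add)
        then have "\<rho> s * norm (q0 s) \<le> (exp (\<delta> * N) * exp (- \<gamma>s * s)) * norm (q0 s)" by (intro mult_right_mono) auto
        also have "\<dots> \<le> exp (\<delta> * N) * (C * G)" unfolding mult.assoc by (intro mult_left_mono star) auto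
        finally show ?thesis using r1[of s] by simp
      qed (use q0_zero C G_nonneg in auto)
      define V where "V = (SUP s. norm (\<rho> s *\<^sub>R q0 s))"
      have bdd: "bdd_above (range (\<lambda>s. norm (\<rho> s *\<^sub>R q0 s)))" using vb by (auto simp: bdd_above_def)
      have vV: "norm (\<rho> s *\<^sub>R q0 s) \<le> V" for s unfolding V_def by (rule cSUP_upper[OF _ bdd]) simp
      have V0: "0 \<le> V" using order_trans[OF norm_ge_zero vV] .
      have est: "norm (\<rho> s *\<^sub>R q0 s) \<le> C * (G + op_const * (D * V))" for s
      proof (rule ap[of \<gamma>s "\<lambda>t. \<rho> t *\<^sub>R q0 t"])
        show "\<gamma>s \<in> {0..\<Gamma>}" using gs by simp
        show "bdd_meas (\<lambda>t. \<rho> t *\<^sub>R q0 t)" unfolding bdd_meas_def using vb by auto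
        fix s
        note A = reg_op_weighted[OF gs(1) _ , of \<rho> 1 s]
        have "(LINT x|lborel. majorant x * (\<bar>exp (- \<gamma>s * x) * \<rho> (s - x) - \<rho> s\<bar> * norm (q0 (s - x)))) \<le> (LINT x|lborel. majorant x * (\<phi> \<delta> x * V))"
        proof (rule integral_mono)
          show "integrable lborel (\<lambda>x. majorant x * (\<bar>exp (- \<gamma>s * x) * \<rho> (s - x) - \<rho> s\<bar> * norm (q0 (s - x))))"
            by (rule A(1)) (use r1 in auto)
          show "integrable lborel (\<lambda>x. majorant x * (\<phi> \<delta> x * V))"
            using integrable_mult_left[OF \<phi>i, of V] by (simp add: mult.assoc)
          fix x
          show "majorant x * (\<bar>exp (- \<gamma>s * x) * \<rho> (s - x) - \<rho> s\<bar> * norm (q0 (s - x))) \<le> majorant x * (\<phi> \<delta> x * V)"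
          proof (rule weight_comm_le)
            show "0 \<le> \<phi> \<delta> x * V" if "0 < x" for x using \<phi>01[of \<delta> x] d that V0 by simp
            fix x assume x: "0 < x" "x < s"
            \<comment> \<open>Increment of the truncated exponent over [s - x, s]; truncation can
              only shorten it.\<close>
            define e where "e = min s N - min (s - x) N"
            have e: "0 \<le> e" "e \<le> x" using x by (auto simp: e_def min_def)
            have "\<rho> s = exp (- \<gamma>s * x) * \<rho> (s - x) * exp (\<delta> * e)"
              using x by (simp add: \<rho>_def e_def algebra_simps flip: exp_add)
            then have "\<bar>exp (- \<gamma>s * x) * \<rho> (s - x) - \<rho> s\<bar> = exp (- \<gamma>s * x) * \<rho> (s - x) * \<bar>1 - exp (\<delta> * e)\<bar>"
            proof -
              assume r: "\<rho> s = exp (- \<gamma>s * x) * \<rho> (s - x) * exp (\<delta> * e)"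
              have "exp (- \<gamma>s * x) * \<rho> (s - x) - \<rho> s = exp (- \<gamma>s * x) * \<rho> (s - x) * (1 - exp (\<delta> * e))"
                unfolding r by (simp add: algebra_simps)
              then show ?thesis using r1(1)[of "s - x"] by (simp add: abs_mult)
            qed
            also have "\<bar>1 - exp (\<delta> * e)\<bar> \<le> exp (\<delta> * x) - 1"
            proof -
              have "1 \<le> exp (\<delta> * e)" "exp (\<delta> * e) \<le> exp (\<delta> * x)" using d e by auto
              then show ?thesis by linarith
            qed
            finally have "\<bar>exp (- \<gamma>s * x) * \<rho> (s - x) - \<rho> s\<bar> \<le> exp (- \<gamma>s * x) * \<rho> (s - x) * (exp (\<delta> * x) - 1)"
              using r1(1)[of "s - x"] by (simp add: mult_left_mono)
            then have "\<bar>exp (- \<gamma>s * x) * \<rho> (s - x) - \<rho> s\<bar> * norm (q0 (s - x)) \<le> (exp (- \<gamma>s * x) * \<rho> (s - x) * (exp (\<delta> * x) - 1)) * norm (q0 (s - x))"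
              by (intro mult_right_mono) auto
            also have "\<dots> = \<phi> \<delta> x * (\<rho> (s - x) * norm (q0 (s - x)))" by (simp add: \<phi>_def mult_ac)
            also have "\<dots> \<le> \<phi> \<delta> x * V"
              using \<phi>01[of \<delta> x] d x vV[of "s - x"] r1(1)[of "s - x"] by (intro mult_left_mono) auto
            finally show "\<bar>exp (- \<gamma>s * x) * \<rho> (s - x) - \<rho> s\<bar> * norm (q0 (s - x)) \<le> \<phi> \<delta> x * V" .
          qed
        qed
        also have "\<dots> = D * V"
        proof -
          have "(LINT x|lborel. majorant x * (\<phi> \<delta> x * V)) = (LINT x|lborel. (majorant x * \<phi> \<delta> x) * V)" by (simp only: mult.assoc)
          then show ?thesis unfolding D_def integral_mult_left_zero .
        qed
        finally have "op_const * (LINT x|lborel. majorant x * (\<bar>exp (- \<gamma>s * x) * \<rho> (s - x) - \<rho> s\<bar> * norm (q0 (s - x)))) \<le> op_const * (D * V)"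
          using op_const_ge by (intro mult_left_mono) auto
        moreover have "\<bar>\<rho> s\<bar> * norm (g s) \<le> 1 * G" using r1[of s] g_bound by (intro mult_mono) auto
        moreover have "norm (reg_op \<alpha> \<gamma>s (\<lambda>s. \<rho> s *\<^sub>R q0 s) s) \<le> \<bar>\<rho> s\<bar> * norm (g s) + op_const * (LINT x|lborel. majorant x * (\<bar>exp (- \<gamma>s * x) * \<rho> (s - x) - \<rho> s\<bar> * norm (q0 (s - x))))"
          by (rule A(2)) (use r1 in auto)
        ultimately show "norm (reg_op \<alpha> \<gamma>s (\<lambda>s. \<rho> s *\<^sub>R q0 s) s) \<le> G + op_const * (D * V)" by linarith
      qed
      have "V \<le> C * (G + op_const * (D * V))" unfolding V_def by (rule cSUP_least) (use est V_def in auto)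
      also have "\<dots> = C * G + (C * (op_const * D)) * V" by (simp add: algebra_simps)
      also have "\<dots> \<le> C * G + 1 / 2 * V" using CD V0 by (intro add_left_mono mult_right_mono) auto
      finally have "V \<le> 2 * (C * G)" by simp
      then have "norm (\<rho> t *\<^sub>R q0 t) \<le> 2 * (C * G)" using vV[of t] by linarith
      moreover have "\<rho> t = exp (- \<gamma>s * t + \<delta> * t)" using t by (simp add: \<rho>_def N_def)
      ultimately show ?thesis by simp
    qed
    have "\<gamma>s - \<delta> \<in> E"
      unfolding E_def
    proof (intro CollectI conjI exI allI)
      show "0 \<le> \<gamma>s - \<delta>" "\<gamma>s - \<delta> \<le> \<Gamma>" using d gs by auto
      show "exp (- (\<gamma>s - \<delta>) * t) * norm (q0 t) \<le> 2 * (C * G)" for t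
      proof (cases "0 < t")
        case True
        then show ?thesis using main[OF True] by (simp add: algebra_simps)
      qed (use q0_zero C G_nonneg in auto)
    qed
    then have "\<gamma>s \<le> \<gamma>s - \<delta>" unfolding \<gamma>s_def using Ebd by (rule cInf_lower)
    then show False using d by simp
  qed
  then have "norm (q0 t) \<le> C * G" for t using star[of t] by simp
  then show ?thesis using C G_nonneg by (intro exI[of _ "C * G"]) auto
qed

end

section \<open>Decay of the charge\<close>

context ionization_charge
begin

text \<open>The charge is multiplied by a truncated version of (1 + s)^b and the commutator is split
  at X and s/2. For x <= X the weight hardly changes once s is large; for X < x <= s/2 it changes by
  a bounded factor while the tail of \<open>majorant\<close> is small; for x > s/2 the kernel is of
  order s^(-3/2) and the hypothesis on the L1 norm compensates the weight.\<close>

lemma decay_improvement: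
  assumes b: "0 \<le> b" "b \<le> 3/2" and M: "0 \<le> M" "\<And>t. norm (q0 t) \<le> M"
    and C1: "0 \<le> C1" and L: "\<And>t. 0 \<le> t \<Longrightarrow> (LINT s:{0..t}|lborel. norm (q0 s)) \<le> C1 * (1 + t) powr (3/2 - b)"
  shows "\<exists>C2\<ge>0. \<forall>t\<ge>0. norm (q0 t) \<le> C2 * (1 + t) powr (- b)"
proof -
  obtain C where C: "0 < C" and ap: "\<And>w E t. bdd_meas w \<Longrightarrow> (\<And>t. norm (reg_op \<alpha> 0 w t) \<le> E) \<Longrightarrow> norm (w t) \<le> C * E"
    using apriori_estimate[of 0] by (metis atLeastAtMost_iff order_refl)
  have op_const: "0 < op_const" using op_const_ge by simp
  have CK: "0 < C * op_const" using C op_const by simp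
  \<comment> \<open>With 64 C \<open>op_const\<close> as its square root, the middle region
    contributes at most 8/64 of V / C, below the allowed quarter.\<close>
  define X where "X = (64 * (C * op_const))\<^sup>2"
  have X: "0 < X" "C * op_const * (4 * (2 / sqrt X)) \<le> 1/4"
  proof -
    show "0 < X" unfolding X_def by (rule zero_less_power) (use CK in linarith)
    have sx: "sqrt X = 64 * (C * op_const)" unfolding X_def real_sqrt_abs using CK by simp
    show "C * op_const * (4 * (2 / sqrt X)) \<le> 1/4" unfolding sx using C op_const by simp
  qed
  have "((\<lambda>t. C * op_const * (4 * (((1 + t) / (1 + t - X)) powr b - 1))) \<longlongrightarrow> C * op_const * (4 * (1 powr b - 1))) at_top"
  proof (intro tendsto_intros)
    show "((\<lambda>t. (1 + t) / (1 + t - X)) \<longlongrightarrow> 1) at_top" by real_asymp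
  qed auto
  then have "\<forall>\<^sub>F t in at_top. C * op_const * (4 * (((1 + t) / (1 + t - X)) powr b - 1)) < 1/4"
    by (intro order_tendstoD(2)) auto
  then obtain T1 where T1: "\<And>t. T1 \<le> t \<Longrightarrow> C * op_const * (4 * (((1 + t) / (1 + t - X)) powr b - 1)) < 1/4"
    unfolding eventually_at_top_linorder by blast
  \<comment> \<open>Beyond T0 the near region is under control, X lies below s/2, and 1 + s <= 2 s
    holds.\<close>
  define T0 where "T0 = max T1 (max 1 (2 * X))"
  have T0: "T1 \<le> T0" "1 \<le> T0" "2 * X \<le> T0" by (auto simp: T0_def)
  \<comment> \<open>Collects what is not proportional to V: the forcing, the far region, and all
    times up to T0.\<close>
  define Z where "Z = G + op_const * (8 * C1) + op_const * (4 * ((1 + T0) powr b * M))"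
  have Z0: "0 \<le> Z" using G_nonneg op_const C1 M(1) by (simp add: Z_def)
  have main: "norm (q0 t) \<le> (2 powr b * (2 * (C * Z))) * (1 + t) powr (- b)" if t: "0 \<le> t" for t
  proof -
    \<comment> \<open>The weight saturates at 1 / \<epsilon> = 1 + t, so it is bounded for each t,
      yet at time t itself it has lost at most a factor 2 in the base.\<close>
    define \<epsilon> where "\<epsilon> = 1 / (1 + t)"
    have eps: "0 < \<epsilon>" "\<epsilon> \<le> 1" using t by (auto simp: \<epsilon>_def)
    define r where "r = (\<lambda>s::real. (1 + max 0 s) / (1 + \<epsilon> * max 0 s))"
    define \<rho> where "\<rho> = (\<lambda>s. r s powr b)"
    have [measurable]: "\<rho> \<in> borel_measurable borel" unfolding \<rho>_def r_def by measurable
    have den: "0 < 1 + \<epsilon> * max 0 s" for s using eps by (simp add: add_pos_nonneg)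
    have r_ge: "1 \<le> r s" for s
    proof -
      have "\<epsilon> * max 0 s \<le> 1 * max 0 s" using eps by (intro mult_right_mono) auto
      then show ?thesis using den[of s] by (simp add: r_def)
    qed
    have r_le: "r s \<le> 1 + max 0 s" for s
    proof -
      have "(1 + max 0 s) * 1 \<le> (1 + max 0 s) * (1 + \<epsilon> * max 0 s)" using eps by (intro mult_left_mono) auto
      then show ?thesis using den[of s] by (simp add: r_def pos_divide_le_eq)
    qed
    have r_bd: "r s \<le> 1 / \<epsilon>" for s
    proof -
      have "\<epsilon> + \<epsilon> * max 0 s \<le> 1 + \<epsilon> * max 0 s" using eps by simp
      then show ?thesis using den[of s] eps by (simp add: r_def field_simps)
    qed
    have rho_bd: "\<bar>\<rho> s\<bar> \<le> (1 / \<epsilon>) powr b" for s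
      using r_bd[of s] r_ge[of s] b by (auto simp: \<rho>_def intro!: powr_mono2)
    have rho_pos: "0 < \<rho> s" for s using r_ge[of s] by (simp add: \<rho>_def)
    have rho_le: "\<rho> s \<le> (1 + s) powr b" if "0 \<le> s" for s
      using r_le[of s] r_ge[of s] b that by (auto simp: \<rho>_def intro!: powr_mono2)
    have r_mono: "r s' \<le> r s" if "0 \<le> s'" "s' \<le> s" for s s'
    proof -
      have "(1 + s') * (1 + \<epsilon> * s) \<le> (1 + s) * (1 + \<epsilon> * s')"
      proof -
        have "(1 + s) * (1 + \<epsilon> * s') - (1 + s') * (1 + \<epsilon> * s) = (1 - \<epsilon>) * (s - s')" by (simp add: algebra_simps)
        moreover have "0 \<le> (1 - \<epsilon>) * (s - s')" using eps that by simp
        ultimately show ?thesis by linarith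
      qed
      then show ?thesis using den[of s] den[of s'] that by (simp add: r_def frac_le_eq divide_le_eq mult.commute pos_divide_le_eq pos_le_divide_eq)
    qed
    have rho_mono: "\<rho> s' \<le> \<rho> s" if "0 \<le> s'" "s' \<le> s" for s s'
      using r_mono[OF that] r_ge[of s'] b by (auto simp: \<rho>_def intro!: powr_mono2)
    have ratio: "\<rho> s \<le> ((1 + s) / (1 + s - x)) powr b * \<rho> (s - x)" if "0 < x" "x < s" for s x
    proof -
      have p: "0 < 1 + s - x" "0 < 1 + \<epsilon> * s" "0 < 1 + \<epsilon> * (s - x)" using that eps by (auto simp: add_pos_nonneg)
      have "r s \<le> ((1 + s) / (1 + s - x)) * r (s - x)"
      proof -
        have "((1 + s) / (1 + s - x)) * r (s - x) = (1 + s) / (1 + \<epsilon> * (s - x))"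
          using that p by (simp add: r_def add_diff_eq)
        moreover have "(1 + s) / (1 + \<epsilon> * s) \<le> (1 + s) / (1 + \<epsilon> * (s - x))"
          using that p eps by (intro divide_left_mono mult_pos_pos) auto
        ultimately show ?thesis using that by (simp add: r_def)
      qed
      then have "r s powr b \<le> (((1 + s) / (1 + s - x)) * r (s - x)) powr b"
        using r_ge[of s] b by (intro powr_mono2) auto
      also have "\<dots> = ((1 + s) / (1 + s - x)) powr b * r (s - x) powr b"
        by (rule powr_mult)
      finally show ?thesis by (simp add: \<rho>_def)
    qed
    define V where "V = (SUP s. norm (\<rho> s *\<^sub>R q0 s))"
    have vb: "norm (\<rho> s *\<^sub>R q0 s) \<le> (1 / \<epsilon>) powr b * M" for s
      using rho_bd[of s] M by (auto intro!: mult_mono)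
    have bdd: "bdd_above (range (\<lambda>s. norm (\<rho> s *\<^sub>R q0 s)))" using vb by (auto simp: bdd_above_def)
    have vV: "\<rho> s * norm (q0 s) \<le> V" for s
      using cSUP_upper[OF _ bdd, of s] rho_pos[of s] by (simp add: V_def)
    have V0: "0 \<le> V" using order_trans[OF _ vV[of 0]] rho_pos[of 0] by simp
    note A = reg_op_weighted[OF order_refl _ rho_bd]
    have q0i: "integrable lborel (\<lambda>x. norm (indicator {0..s} (s - x) *\<^sub>R q0 (s - x)))"
      and q0e: "(LINT x|lborel. norm (indicator {0..s} (s - x) *\<^sub>R q0 (s - x))) = (LINT y:{0..s}|lborel. norm (q0 y))" if s: "0 \<le> s" for s
    proof -
      have I: "integrable lborel (\<lambda>y. norm (indicator {0..s} y *\<^sub>R q0 y))"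
      proof (rule integrable_norm, rule integrableI_bounded_set_indicator)
        show "AE x\<in>{0..s} in lborel. norm (q0 x) \<le> M" using M by auto
      qed (use s in auto)
      show "integrable lborel (\<lambda>x. norm (indicator {0..s} (s - x) *\<^sub>R q0 (s - x)))"
        using lborel_integrable_real_affine[OF I, of "- 1" s] by simp
      have "(LINT y|lborel. norm (indicator {0..s} y *\<^sub>R q0 y)) = (LINT x|lborel. norm (indicator {0..s} (s - x) *\<^sub>R q0 (s - x)))"
        using lborel_integral_real_affine[of "- 1" "\<lambda>y. norm (indicator {0..s} y *\<^sub>R q0 y)" s] by simp
      then show "(LINT x|lborel. norm (indicator {0..s} (s - x) *\<^sub>R q0 (s - x))) = (LINT y:{0..s}|lborel. norm (q0 y))"
        by (simp add: set_lebesgue_integral_def)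
    qed
    have gs: "\<bar>\<rho> s\<bar> * norm (g s) \<le> G" for s
    proof (cases "0 \<le> s")
      case True
      have "\<rho> s * norm (g s) \<le> (1 + s) powr b * (G * (1 + s) powr (-3/2))"
        using rho_pos[of s] by (intro mult_mono rho_le g_decay True) auto
      also have "\<dots> = G * (1 + s) powr (b - 3/2)" using True by (simp add: powr_add[symmetric] algebra_simps)
      also have "\<dots> \<le> G * 1"
      proof (intro mult_left_mono G_nonneg)
        have "(1 + s) powr (b - 3/2) \<le> (1 + s) powr 0" using True b by (intro powr_mono) auto
        then show "(1 + s) powr (b - 3/2) \<le> 1" using True by simp
      qed
      finally show ?thesis using rho_pos[of s] by simp
    next
      case False
      then show ?thesis using g_bound[of s] by (simp add: \<rho>_def r_def)
    qed
    \<comment> \<open>The part proportional to V carries the factor 1 / (2 C), so after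
      multiplication by C from the a priori bound only V / 2 has to be absorbed.\<close>
    have comm: "op_const * (LINT x|lborel. majorant x * (\<bar>exp (- 0 * x) * \<rho> (s - x) - \<rho> s\<bar> * norm (q0 (s - x)))) \<le> op_const * (8 * C1) + op_const * (4 * ((1 + T0) powr b * M)) + (1 / (2 * C)) * V" for s
    proof (cases "T0 < s")
      case False
      have "(LINT x|lborel. majorant x * (\<bar>exp (- 0 * x) * \<rho> (s - x) - \<rho> s\<bar> * norm (q0 (s - x)))) \<le> (LINT x|lborel. majorant x * ((1 + T0) powr b * M))"
      proof (rule integral_mono[OF A(1)])
        show "integrable lborel (\<lambda>x. majorant x * ((1 + T0) powr b * M))" by (rule integrable_mult_left) (rule majorant_integrable)
        show "majorant x * (\<bar>exp (- 0 * x) * \<rho> (s - x) - \<rho> s\<bar> * norm (q0 (s - x))) \<le> majorant x * ((1 + T0) powr b * M)" for x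
        proof (rule weight_comm_le)
          fix x assume x: "0 < x" "x < s"
          have "\<rho> (s - x) \<le> \<rho> s" using x by (intro rho_mono) auto
          then have "\<bar>\<rho> (s - x) - \<rho> s\<bar> \<le> \<rho> s" using rho_pos[of "s - x"] by simp
          also have "\<dots> \<le> (1 + s) powr b" using x by (intro rho_le) auto
          also have "\<dots> \<le> (1 + T0) powr b" using x False b by (intro powr_mono2) auto
          finally show "\<bar>exp (- 0 * x) * \<rho> (s - x) - \<rho> s\<bar> * norm (q0 (s - x)) \<le> (1 + T0) powr b * M"
            using M by (intro mult_mono) auto
        qed (use M in auto)
      qed measurable
      also have "\<dots> = (LINT x|lborel. majorant x) * ((1 + T0) powr b * M)" by (rule integral_mult_left_zero)
      also have "\<dots> \<le> 4 * ((1 + T0) powr b * M)" using majorant_integral_le M(1) by (intro mult_right_mono) auto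
      finally have "op_const * (LINT x|lborel. majorant x * (\<bar>exp (- 0 * x) * \<rho> (s - x) - \<rho> s\<bar> * norm (q0 (s - x)))) \<le> op_const * (4 * ((1 + T0) powr b * M))"
        using op_const by (intro mult_left_mono) auto
      moreover have "0 \<le> op_const * (8 * C1)" "0 \<le> (1 / (2 * C)) * V" using op_const C1 C V0 by auto
      ultimately show ?thesis by linarith
    next
      case True
      have s1: "1 \<le> s" "2 * X \<le> s" "T1 \<le> s" using True T0 by auto
      define \<eta> where "\<eta> = ((1 + s) / (1 + s - X)) powr b - 1"
      have eta: "0 \<le> \<eta>"
      proof -
        have "1 \<le> (1 + s) / (1 + s - X)" using s1 X(1) by simp
        then show ?thesis using b by (simp add: \<eta>_def ge_one_powr_ge_zero)
      qed
      \<comment> \<open>In the far region the weight difference is at most (1 + s)^b and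
        \<open>majorant\<close> is at most its tail bound at s/2.\<close>
      define H where "H = (1 + s) powr b * (1 / ((s/2) * sqrt (s/2)))"
      have H0: "0 \<le> H" using s1 by (simp add: H_def)
      define f where "f = (\<lambda>x. majorant x * (\<eta> * V) + (majorant x * indicator {X<..} x) * (4 * V) + H * norm (indicator {0..s} (s - x) *\<^sub>R q0 (s - x)))"
      have i1: "integrable lborel (\<lambda>x. majorant x * (\<eta> * V))" by (rule integrable_mult_left) (rule majorant_integrable)
      have i2: "integrable lborel (\<lambda>x. (majorant x * indicator {X<..} x) * (4 * V))"
        by (rule integrable_mult_left, rule integrable_real_mult_indicator) (use majorant_integrable in auto)
      have i3: "integrable lborel (\<lambda>x. H * norm (indicator {0..s} (s - x) *\<^sub>R q0 (s - x)))"
        by (rule integrable_mult_right) (rule q0i, use s1 in simp)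
      have "(LINT x|lborel. majorant x * (\<bar>exp (- 0 * x) * \<rho> (s - x) - \<rho> s\<bar> * norm (q0 (s - x)))) \<le> (LINT x|lborel. f x)"
      proof (rule integral_mono[OF A(1)])
        show "integrable lborel f" unfolding f_def using i1 i2 i3 by (intro Bochner_Integration.integrable_add)
        fix x
        have f0: "0 \<le> majorant x * (\<eta> * V)" "0 \<le> (majorant x * indicator {X<..} x) * (4 * V)" "0 \<le> H * norm (indicator {0..s} (s - x) *\<^sub>R q0 (s - x))"
          using majorant_nonneg[of x] eta V0 H0 by auto
        show "majorant x * (\<bar>exp (- 0 * x) * \<rho> (s - x) - \<rho> s\<bar> * norm (q0 (s - x))) \<le> f x"
        proof (cases "0 < x \<and> x < s")
          case False
          then have "majorant x * (\<bar>exp (- 0 * x) * \<rho> (s - x) - \<rho> s\<bar> * norm (q0 (s - x))) = 0"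
            using q0_zero[of "s - x"] by (auto simp: majorant_def)
          then show ?thesis using f0 unfolding f_def by linarith
        next
          case x: True
          have mono: "\<rho> (s - x) \<le> \<rho> s" using x by (intro rho_mono) auto
          have d: "\<bar>exp (- 0 * x) * \<rho> (s - x) - \<rho> s\<bar> = \<rho> s - \<rho> (s - x)" using mono by simp
          show ?thesis
          proof (cases "x \<le> s / 2")
            case le: True
            have base: "(\<rho> s - \<rho> (s - x)) * norm (q0 (s - x)) \<le> c * V" if c: "((1 + s) / (1 + s - x)) powr b - 1 \<le> c" "0 \<le> c" for c
            proof -
              have "\<rho> s - \<rho> (s - x) \<le> (((1 + s) / (1 + s - x)) powr b - 1) * \<rho> (s - x)"
                using ratio[of x s] x by (simp add: algebra_simps)
              also have "\<dots> \<le> c * \<rho> (s - x)" using c rho_pos[of "s - x"] by (intro mult_right_mono) auto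
              finally have "(\<rho> s - \<rho> (s - x)) * norm (q0 (s - x)) \<le> c * \<rho> (s - x) * norm (q0 (s - x))" by (intro mult_right_mono) auto
              also have "\<dots> \<le> c * V" unfolding mult.assoc using c by (intro mult_left_mono vV) auto
              finally show ?thesis .
            qed
            show ?thesis
            proof (cases "x \<le> X")
              case True
              have "(1 + s) / (1 + s - x) \<le> (1 + s) / (1 + s - X)" using True x s1 X(1) by (intro divide_left_mono mult_pos_pos) auto
              then have "((1 + s) / (1 + s - x)) powr b \<le> ((1 + s) / (1 + s - X)) powr b" using b x by (intro powr_mono2) auto
              then have "(\<rho> s - \<rho> (s - x)) * norm (q0 (s - x)) \<le> \<eta> * V" by (intro base eta) (simp add: \<eta>_def)
              then have "majorant x * ((\<rho> s - \<rho> (s - x)) * norm (q0 (s - x))) \<le> majorant x * (\<eta> * V)" by (intro mult_left_mono majorant_nonneg)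
              then show ?thesis unfolding d f_def using f0 by linarith
            next
              case False
              \<comment> \<open>For x <= s/2 the base at most doubles; with b <= 3/2 <= 2 this
                yields the factor 4.\<close>
              have "(1 + s) / (1 + s - x) \<le> 2" using le x by (simp add: pos_divide_le_eq)
              then have "((1 + s) / (1 + s - x)) powr b \<le> 2 powr b" using b x by (intro powr_mono2) auto
              also have "\<dots> \<le> 2 powr 2" using b by (intro powr_mono) auto
              finally have "(\<rho> s - \<rho> (s - x)) * norm (q0 (s - x)) \<le> 4 * V" by (intro base) auto
              then have "majorant x * ((\<rho> s - \<rho> (s - x)) * norm (q0 (s - x))) \<le> majorant x * (4 * V)" by (intro mult_left_mono majorant_nonneg)
              also have "\<dots> = (majorant x * indicator {X<..} x) * (4 * V)" using False by simp
              finally show ?thesis unfolding d f_def using f0 by linarith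
            qed
          next
            case gt: False
            have "\<rho> s - \<rho> (s - x) \<le> (1 + s) powr b" using rho_le[of s] rho_pos[of "s - x"] s1 by linarith
            moreover have "majorant x \<le> 1 / ((s/2) * sqrt (s/2))"
            proof (rule order_trans[OF majorant_le_tail])
              show "1 / (x * sqrt x) \<le> 1 / ((s/2) * sqrt (s/2))" using gt s1 x by (intro divide_left_mono mult_mono mult_pos_pos) auto
            qed (use x in simp)
            ultimately have "(\<rho> s - \<rho> (s - x)) * majorant x \<le> H"
              unfolding H_def using majorant_nonneg[of x] by (intro mult_mono) auto
            then have "((\<rho> s - \<rho> (s - x)) * majorant x) * norm (q0 (s - x)) \<le> H * norm (q0 (s - x))" by (intro mult_right_mono) auto
            moreover have "norm (q0 (s - x)) = norm (indicator {0..s} (s - x) *\<^sub>R q0 (s - x))" using x by simp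
            ultimately have "majorant x * ((\<rho> s - \<rho> (s - x)) * norm (q0 (s - x))) \<le> H * norm (indicator {0..s} (s - x) *\<^sub>R q0 (s - x))"
              by (simp only: mult_ac)
            then show ?thesis unfolding d f_def using f0 by linarith
          qed
        qed
      qed measurable
      also have "(LINT x|lborel. f x) = (LINT x|lborel. majorant x) * (\<eta> * V) + (LINT x|lborel. majorant x * indicator {X<..} x) * (4 * V) + H * (LINT y:{0..s}|lborel. norm (q0 y))"
      proof -
        have "(LINT x|lborel. f x) = (LINT x|lborel. majorant x * (\<eta> * V)) + (LINT x|lborel. (majorant x * indicator {X<..} x) * (4 * V)) + (LINT x|lborel. H * norm (indicator {0..s} (s - x) *\<^sub>R q0 (s - x)))"
          unfolding f_def Bochner_Integration.integral_add[OF Bochner_Integration.integrable_add[OF i1 i2] i3] Bochner_Integration.integral_add[OF i1 i2] ..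
        then show ?thesis using q0e[of s] s1 unfolding integral_mult_left_zero integral_mult_right_zero by simp
      qed
      also have "\<dots> \<le> 4 * (\<eta> * V) + (2 / sqrt X) * (4 * V) + 8 * C1"
      proof (intro add_mono)
        show "(LINT x|lborel. majorant x) * (\<eta> * V) \<le> 4 * (\<eta> * V)" using majorant_integral_le eta V0 by (intro mult_right_mono) auto
        show "(LINT x|lborel. majorant x * indicator {X<..} x) * (4 * V) \<le> (2 / sqrt X) * (4 * V)" using majorant_tail[OF X(1)] V0 by (intro mult_right_mono) auto
        have "H * (LINT y:{0..s}|lborel. norm (q0 y)) \<le> H * (C1 * (1 + s) powr (3/2 - b))" using s1 H0 by (intro mult_left_mono L) auto
        also have "\<dots> = C1 * ((1 + s) powr (3/2) / ((s/2) * sqrt (s/2)))"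
          using s1 by (simp add: H_def powr_add[symmetric])
        also have "\<dots> \<le> C1 * 8"
        proof (intro mult_left_mono C1)
          \<comment> \<open>The powers with exponents b and 3/2 - b have combined to 3/2, and 1 + s
            <= 4 (s/2) turns this into 4^(3/2) = 8 times the denominator.\<close>
          have "(1 + s) powr (3/2) \<le> (4 * (s/2)) powr (3/2)" using s1 by (intro powr_mono2) auto
          also have "\<dots> = 4 powr (3/2) * (s/2) powr (3/2)" by (rule powr_mult)
          also have "(4::real) powr (3/2) = 8"
          proof -
            have "(4::real) powr (3/2) = (2 powr 2) powr (3/2)" by simp
            also have "\<dots> = 2 powr 3" unfolding powr_powr by simp
            finally show ?thesis by simp
          qed
          also have "(s/2) powr (3/2) = (s/2) * sqrt (s/2)"
          proof -
            have "(s/2) powr (3/2) = (s/2) powr (1 + 1/2)" by simp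
            also have "\<dots> = (s/2) * sqrt (s/2)" using s1 by (simp only: powr_add) (simp add: powr_half_sqrt)
            finally show ?thesis .
          qed
          finally have "(1 + s) powr (3/2) \<le> 8 * ((s/2) * sqrt (s/2))" .
          moreover have "0 < (s/2) * sqrt (s/2)" using s1 by simp
          ultimately show "(1 + s) powr (3/2) / ((s/2) * sqrt (s/2)) \<le> 8" by (simp only: pos_divide_le_eq)
        qed
        finally show "H * (LINT y:{0..s}|lborel. norm (q0 y)) \<le> 8 * C1" by simp
      qed
      finally have "op_const * (LINT x|lborel. majorant x * (\<bar>exp (- 0 * x) * \<rho> (s - x) - \<rho> s\<bar> * norm (q0 (s - x)))) \<le> op_const * (4 * (\<eta> * V) + (2 / sqrt X) * (4 * V) + 8 * C1)"
        using op_const by (intro mult_left_mono) auto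
      also have "\<dots> = (C * op_const * (4 * \<eta>) + C * op_const * (4 * (2 / sqrt X))) * (V / C) + op_const * (8 * C1)" using C by (simp add: field_simps)
      also have "\<dots> \<le> (1/4 + 1/4) * (V / C) + op_const * (8 * C1)"
        using T1[OF s1(3)] X(2) V0 C by (intro add_right_mono mult_right_mono add_mono) (auto simp: \<eta>_def)
      also have "(1/4 + 1/4) * (V / C) = (1 / (2 * C)) * V" by simp
      finally have "op_const * (LINT x|lborel. majorant x * (\<bar>exp (- 0 * x) * \<rho> (s - x) - \<rho> s\<bar> * norm (q0 (s - x)))) \<le> (1 / (2 * C)) * V + op_const * (8 * C1)" .
      moreover have "0 \<le> op_const * (4 * ((1 + T0) powr b * M))" using op_const M(1) by auto
      ultimately show ?thesis by linarith
    qed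
    have est: "norm (\<rho> s *\<^sub>R q0 s) \<le> C * (Z + (1 / (2 * C)) * V)" for s
    proof (rule ap[of "\<lambda>s. \<rho> s *\<^sub>R q0 s"])
      show "bdd_meas (\<lambda>t. \<rho> t *\<^sub>R q0 t)" unfolding bdd_meas_def using vb by auto
      fix s
      have "norm (reg_op \<alpha> 0 (\<lambda>s. \<rho> s *\<^sub>R q0 s) s) \<le> \<bar>\<rho> s\<bar> * norm (g s) + op_const * (LINT x|lborel. majorant x * (\<bar>exp (- 0 * x) * \<rho> (s - x) - \<rho> s\<bar> * norm (q0 (s - x))))"
        by (rule A(2)) measurable
      then show "norm (reg_op \<alpha> 0 (\<lambda>s. \<rho> s *\<^sub>R q0 s) s) \<le> Z + (1 / (2 * C)) * V"
        using gs[of s] comm[of s] unfolding Z_def by linarith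
    qed
    have "V \<le> C * (Z + (1 / (2 * C)) * V)" unfolding V_def by (rule cSUP_least) (use est V_def in auto)
    also have "\<dots> = C * Z + V / 2" using C by (simp add: field_simps)
    finally have V: "V \<le> 2 * (C * Z)" by simp
    have half: "(1 + t) / 2 \<le> r t"
    proof -
      have "\<epsilon> * t \<le> 1" using t by (simp add: \<epsilon>_def)
      then have "1 + \<epsilon> * max 0 t \<le> 2" using t by simp
      then have "(1 + t) / 2 \<le> (1 + t) / (1 + \<epsilon> * max 0 t)" using den[of t] t by (intro divide_left_mono) auto
      then show ?thesis using t by (simp add: r_def)
    qed
    have "((1 + t) / 2) powr b \<le> \<rho> t" unfolding \<rho>_def using half t b by (intro powr_mono2) auto
    then have "((1 + t) / 2) powr b * norm (q0 t) \<le> \<rho> t * norm (q0 t)" by (intro mult_right_mono) auto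
    also have "\<dots> \<le> 2 * (C * Z)" using vV[of t] V by linarith
    finally have "(1 + t) powr b * norm (q0 t) \<le> 2 powr b * (2 * (C * Z))"
      using t by (simp add: powr_divide field_simps)
    moreover have "0 < (1 + t) powr b" using t by simp
    ultimately show ?thesis by (simp add: powr_minus field_simps)
  qed
  show ?thesis
    by (rule exI[of _ "2 powr b * (2 * (C * Z))"]) (use main Z0 C in auto)
qed

text \<open>The exponent 1 is excluded to avoid a logarithm. The same formula serves exponents below
  1, where it grows, and above 1, where it stays bounded.\<close>

lemma powr_decay_integral:
  assumes b: "b \<noteq> 1" and C: "0 \<le> C" and q: "\<And>t. 0 \<le> t \<Longrightarrow> norm (q0 t) \<le> C * (1 + t) powr (- b)" and t: "0 \<le> t"
  shows "(LINT s:{0..t}|lborel. norm (q0 s)) \<le> C * (((1 + t) powr (1 - b) - 1) / (1 - b))"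
proof -
  have cont: "continuous_on {0..t} (\<lambda>s. C * (1 + s) powr (- b))" by (intro continuous_intros) auto
  have e: "(LINT s:{0..t}|lborel. C * (1 + s) powr (- b)) = C * (1 + t) powr (1 - b) / (1 - b) - C * (1 + 0) powr (1 - b) / (1 - b)"
    unfolding set_lebesgue_integral_def
  proof (rule integral_FTC_atLeastAtMost[OF t _ cont])
    fix x assume x: "0 \<le> x" "x \<le> t"
    have "((\<lambda>s. C * (1 + s) powr (1 - b) / (1 - b)) has_real_derivative C * (1 + x) powr (- b)) (at x within {0..t})"
      using x b by (auto intro!: derivative_eq_intros)
    then show "((\<lambda>s. C * (1 + s) powr (1 - b) / (1 - b)) has_vector_derivative C * (1 + x) powr (- b)) (at x within {0..t})"
      by (simp add: has_real_derivative_iff_has_vector_derivative)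
  qed
  have "(LINT s:{0..t}|lborel. norm (q0 s)) \<le> (LINT s:{0..t}|lborel. C * (1 + s) powr (- b))"
  proof (rule set_integral_mono)
    show I: "set_integrable lborel {0..t} (\<lambda>s. C * (1 + s) powr (- b))" by (rule borel_integrable_atLeastAtMost'[OF cont])
    show "set_integrable lborel {0..t} (\<lambda>s. norm (q0 s))"
      unfolding set_integrable_def
      by (rule Bochner_Integration.integrable_bound[OF I[unfolded set_integrable_def]])
        (use q in \<open>auto simp: indicator_def intro!: AE_I2 order_trans[OF q]\<close>)
    show "norm (q0 s) \<le> C * (1 + s) powr (- b)" if "s \<in> {0..t}" for s using q that by simp
  qed
  also have "\<dots> = C * (((1 + t) powr (1 - b) - 1) / (1 - b))" unfolding e by (simp add: diff_divide_distrib right_diff_distrib)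
  finally show ?thesis .
qed

text \<open>Decay of order b' < 1 lets the L1 norm on [0,t] grow like t^(1 - b'), which permits the
  exponent b' + 1/2 in the next round. From 1/2 the step is shortened to 3/4 to avoid the logarithm
  at 1; then 5/4 makes the charge integrable and 3/2 follows.\<close>

lemma q0_decay: "\<exists>C\<ge>0. \<forall>t\<ge>0. norm (q0 t) \<le> C * (1 + t) powr (- (3/2))"
proof -
  obtain M where M: "0 \<le> M" "\<And>t. norm (q0 t) \<le> M" using q0_bounded by blast
  have L0: "(LINT s:{0..t}|lborel. norm (q0 s)) \<le> M * (1 + t) powr (3/2 - 1/2)" if t: "0 \<le> t" for t
  proof -
    have "(LINT s:{0..t}|lborel. norm (q0 s)) \<le> M * (((1 + t) powr (1 - 0) - 1) / (1 - 0))"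
      by (rule powr_decay_integral) (use M t in auto)
    also have "\<dots> \<le> M * (1 + t)" using M t by (intro mult_left_mono) auto
    finally show ?thesis using t by simp
  qed
  obtain A1 where A1: "0 \<le> A1" "\<And>t. 0 \<le> t \<Longrightarrow> norm (q0 t) \<le> A1 * (1 + t) powr (- (1/2))"
    using decay_improvement[of "1/2" M M] M L0 by auto
  have L1: "(LINT s:{0..t}|lborel. norm (q0 s)) \<le> (2 * A1) * (1 + t) powr (3/2 - 3/4)" if t: "0 \<le> t" for t
  proof -
    have "(LINT s:{0..t}|lborel. norm (q0 s)) \<le> A1 * (((1 + t) powr (1 - 1/2) - 1) / (1 - 1/2))"
      by (rule powr_decay_integral) (use A1 t in auto)
    also have "\<dots> \<le> A1 * (2 * (1 + t) powr (1/2))" using A1 by (intro mult_left_mono) auto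
    also have "\<dots> \<le> A1 * (2 * (1 + t) powr (3/2 - 3/4))" using A1 t by (intro mult_left_mono powr_mono) auto
    finally show ?thesis by simp
  qed
  obtain A2 where A2: "0 \<le> A2" "\<And>t. 0 \<le> t \<Longrightarrow> norm (q0 t) \<le> A2 * (1 + t) powr (- (3/4))"
    using decay_improvement[of "3/4" M "2 * A1"] M A1 L1 by auto
  have L2: "(LINT s:{0..t}|lborel. norm (q0 s)) \<le> (4 * A2) * (1 + t) powr (3/2 - 5/4)" if t: "0 \<le> t" for t
  proof -
    have "(LINT s:{0..t}|lborel. norm (q0 s)) \<le> A2 * (((1 + t) powr (1 - 3/4) - 1) / (1 - 3/4))"
      by (rule powr_decay_integral) (use A2 t in auto)
    also have "\<dots> \<le> A2 * (4 * (1 + t) powr (1/4))" using A2 by (intro mult_left_mono) auto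
    finally show ?thesis by simp
  qed
  obtain A3 where A3: "0 \<le> A3" "\<And>t. 0 \<le> t \<Longrightarrow> norm (q0 t) \<le> A3 * (1 + t) powr (- (5/4))"
    using decay_improvement[of "5/4" M "4 * A2"] M A2 L2 by auto
  have L3: "(LINT s:{0..t}|lborel. norm (q0 s)) \<le> (4 * A3) * (1 + t) powr (3/2 - 3/2)" if t: "0 \<le> t" for t
  proof -
    have "(LINT s:{0..t}|lborel. norm (q0 s)) \<le> A3 * (((1 + t) powr (1 - 5/4) - 1) / (1 - 5/4))"
      by (rule powr_decay_integral) (use A3 t in auto)
    also have "\<dots> \<le> A3 * 4" using A3 by (intro mult_left_mono) auto
    finally show ?thesis using t by simp
  qed
  show ?thesis using decay_improvement[of "3/2" M "4 * A3"] M A3 L3 by auto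
qed

end

text \<open>In the convolution of two majorants one argument is at least t/2, where the tail bound
  applies, and the other factor has mass at most 4; the two cases give 8. Near t = 0 the comparison
  with the Abel kernel gives the bound pi.\<close>

lemma conv_majorant_decay:
  fixes u :: "real \<Rightarrow> complex"
  assumes f: "good_kernel f" and [measurable]: "u \<in> borel_measurable borel" and C: "0 \<le> C" and u: "\<And>s. norm (u s) \<le> C * majorant s"
  shows "norm (conv f u t) \<le> C * pi" and "0 < t \<Longrightarrow> norm (conv f u t) \<le> C * (8 * (1 / ((t/2) * sqrt (t/2))))"
    and "t \<le> 0 \<Longrightarrow> conv f u t = 0"
proof -
  note g = good_kernelD[OF f]
  note [measurable] = g(1)
  have majorant_abel_kernel: "majorant x \<le> abel_kernel x" for x by (simp add: majorant_def abel_kernel_def)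
  have hi: "integrable lborel (\<lambda>x. majorant x * majorant (t - x))"
  proof (rule Bochner_Integration.integrable_bound[OF conv_abel_kernel_abel_kernel(1)[of t]])
    show "AE x in lborel. norm (majorant x * majorant (t - x)) \<le> norm (abel_kernel x * abel_kernel (t - x))"
      using majorant_nonneg majorant_abel_kernel by (auto intro!: AE_I2 mult_mono simp: abs_mult abel_kernel_nonneg)
  qed measurable
  have bd: "norm (f x *\<^sub>R u (t - x)) \<le> C * (majorant x * majorant (t - x))" for x
  proof -
    have "f x * norm (u (t - x)) \<le> majorant x * (C * majorant (t - x))" using g(2,3)[of x] u majorant_nonneg by (intro mult_mono) auto
    then show ?thesis using g(2)[of x] by (simp add: mult_ac)
  qed
  have I: "integrable lborel (\<lambda>x. f x *\<^sub>R u (t - x))"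
  proof (rule Bochner_Integration.integrable_bound[OF integrable_mult_right[OF hi, of C]])
    show "AE x in lborel. norm (f x *\<^sub>R u (t - x)) \<le> norm (C * (majorant x * majorant (t - x)))" by (intro AE_I2 order_trans[OF bd]) simp
  qed measurable
  have le: "norm (conv f u t) \<le> C * (LINT x|lborel. majorant x * majorant (t - x))"
    unfolding conv_def integral_mult_right_zero[symmetric]
    by (rule Bochner_Integration.integral_norm_bound_integral[OF I integrable_mult_right[OF hi] bd])
  have "(LINT x|lborel. majorant x * majorant (t - x)) \<le> (LINT x|lborel. abel_kernel x * abel_kernel (t - x))"
    by (rule integral_mono[OF hi conv_abel_kernel_abel_kernel(1)]) (intro mult_mono majorant_abel_kernel majorant_nonneg abel_kernel_nonneg)
  also have "\<dots> \<le> pi" using conv_abel_kernel_abel_kernel(2)[of t] by (simp add: conv_def split: if_splits)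
  finally have "C * (LINT x|lborel. majorant x * majorant (t - x)) \<le> C * pi" using C by (rule mult_left_mono)
  then show "norm (conv f u t) \<le> C * pi" using le by linarith
  show "norm (conv f u t) \<le> C * (8 * (1 / ((t/2) * sqrt (t/2))))" if t: "0 < t"
  proof -
    define k where "k = 1 / ((t/2) * sqrt (t/2))"
    have k: "0 \<le> k" using t by (simp add: k_def)
    have far: "majorant y \<le> k" if "t/2 \<le> y" for y
    proof (rule order_trans[OF majorant_le_tail])
      show "1 / (y * sqrt y) \<le> k" unfolding k_def using that t by (intro divide_left_mono mult_mono mult_pos_pos) auto
    qed (use that t in linarith)
    have hr: "integrable lborel (\<lambda>x. majorant (t - x))" using lborel_integrable_real_affine[OF majorant_integrable, of "- 1" t] by simp
    have hre: "(LINT x|lborel. majorant (t - x)) = (LINT x|lborel. majorant x)" using lborel_integral_real_affine[of "- 1" majorant t] by simp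
    have "(LINT x|lborel. majorant x * majorant (t - x)) \<le> (LINT x|lborel. k * majorant x + k * majorant (t - x))"
    proof (rule integral_mono[OF hi])
      show "integrable lborel (\<lambda>x. k * majorant x + k * majorant (t - x))"
        using majorant_integrable hr by (intro Bochner_Integration.integrable_add integrable_mult_right)
      fix x
      show "majorant x * majorant (t - x) \<le> k * majorant x + k * majorant (t - x)"
      proof (cases "t/2 \<le> x")
        case True
        have "majorant x * majorant (t - x) \<le> k * majorant (t - x)" using far[OF True] majorant_nonneg by (intro mult_right_mono)
        moreover have "0 \<le> k * majorant x" using k majorant_nonneg by simp
        ultimately show ?thesis by linarith
      next
        case False
        then have "majorant (t - x) \<le> k" by (intro far) auto
        then have "majorant x * majorant (t - x) \<le> majorant x * k" using majorant_nonneg by (intro mult_left_mono)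
        moreover have "0 \<le> k * majorant (t - x)" using k majorant_nonneg by simp
        ultimately show ?thesis by (simp add: mult.commute)
      qed
    qed
    also have "\<dots> = k * (LINT x|lborel. majorant x) + k * (LINT x|lborel. majorant x)"
      using majorant_integrable hr hre by simp
    also have "\<dots> \<le> k * 4 + k * 4" using k majorant_integral_le by (intro add_mono mult_left_mono)
    finally have "C * (LINT x|lborel. majorant x * majorant (t - x)) \<le> C * (8 * k)" using C by (intro mult_left_mono) auto
    then show ?thesis using le unfolding k_def by linarith
  qed
  show "conv f u t = 0" if "t \<le> 0"
  proof -
    have "f x *\<^sub>R u (t - x) = 0" for x
    proof (cases "0 < x")
      case True
      then have "norm (u (t - x)) \<le> 0" using u[of "t - x"] that by (simp add: majorant_def)
      then show ?thesis by simp
    qed (simp add: g(4))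
    then show ?thesis by (simp only: conv_def Bochner_Integration.integral_zero)
  qed
qed

theorem mainTheorem8:
  fixes \<alpha> :: "real \<Rightarrow> real" and T :: real and c :: "int \<Rightarrow> complex"
    and q :: "real \<Rightarrow> complex"
  assumes "standing_assumptions \<alpha> T c"
    and "Re (c 0) < 0"
    and "generic c"
    and "is_charge \<alpha> (phi (\<alpha> 0)) q"
  shows "\<exists>A C B. C > 0 \<and> B > 0 \<and> (\<exists>R :: real \<Rightarrow> real.
           R \<sim>[at_top] (\<lambda>t. C * exp (- B * t)) \<and>
           (\<forall>\<^sub>F t in at_top. norm (q t) \<le> A * t powr (-3/2) + R t))"
proof -
  interpret ionization \<alpha> T c using assms(1,3) by unfold_locales
  define \<Psi> where "\<Psi> = phi (\<alpha> 0)"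
  define q0 where "q0 = (\<lambda>t. indicator {0..} t *\<^sub>R q t)"
  define F0 where "F0 = (\<lambda>t. indicator {0..} t *\<^sub>R free_at_origin \<Psi> t)"
  define CF where "CF = (4 * pi) powr (-3/2) * (4 * pi * sqrt (2 * \<bar>\<alpha> 0\<bar>)) * (4 + 1 / (4 * pi * \<bar>\<alpha> 0\<bar>)\<^sup>2)"
  have CF: "0 \<le> CF" by (simp add: CF_def)
  have FC: "norm (F0 s) \<le> CF * majorant s" for s
  proof (cases "0 < s")
    case True
    then show ?thesis using free_at_origin_phi_bound[OF alpha0 True] by (simp add: F0_def \<Psi>_def CF_def)
  next
    case False
    then have "F0 s = 0" using free_at_origin_zero[of \<Psi>] by (cases "s = 0") (auto simp: F0_def)
    then show ?thesis using CF majorant_nonneg[of s] by simp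
  qed
  have FA: "norm (F0 s) \<le> CF * abel_kernel s" for s
  proof -
    have "CF * majorant s \<le> CF * abel_kernel s" using CF by (intro mult_left_mono) (auto simp: majorant_def abel_kernel_def)
    then show ?thesis using FC[of s] by linarith
  qed
  have Fm: "F0 \<in> borel_measurable borel" unfolding F0_def \<Psi>_def by (rule free_at_origin_phi_measurable)
  have ch: "is_charge \<alpha> \<Psi> q" using assms(4) by (simp add: \<Psi>_def)
  note chF = ch Fm[unfolded F0_def] CF FA[unfolded F0_def]
  define D where "D = norm kappa * CF"
  have D: "0 \<le> D" using CF by (simp add: D_def)
  \<comment> \<open>One constant for both regimes: for t <= 1 the bound D pi <= 8 D is compared with
    (1 + t)^(-3/2) >= 1/8, and for t > 1 the factor 8 of the convolution bound meets 4^(3/2) =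
    8.\<close>
  define G where "G = 64 * D"
  interpret ionization_charge \<alpha> T c q0 "\<lambda>t. kappa * conv reg_kernel F0 t" G
  proof
    show "q0 \<in> borel_measurable borel" unfolding q0_def by (rule charge_locally_bounded(1)[OF chF])
    show "\<exists>M\<ge>0. \<forall>t\<le>R. norm (q0 t) \<le> M" for R unfolding q0_def by (rule charge_locally_bounded(2)[OF chF])
    show "q0 t = 0" if "t \<le> 0" for t unfolding q0_def by (rule charge_regular_equation(1)[OF chF that])
    show "reg_op \<alpha> 0 q0 t = kappa * conv reg_kernel F0 t" for t
      unfolding q0_def F0_def by (rule charge_regular_equation(2)[OF chF])
    note cv = conv_majorant_decay[OF good_kernel_reg_kernel Fm CF FC]
    have b1: "norm (kappa * conv reg_kernel F0 t) \<le> D * pi" for t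
      using mult_left_mono[OF cv(1)[of t], of "norm kappa"] by (simp add: norm_mult D_def mult_ac)
    have pi8: "D * pi \<le> D * 8" using D pi_less_4 by (intro mult_left_mono) auto
    show "norm (kappa * conv reg_kernel F0 t) \<le> G" for t using b1[of t] pi8 D by (simp add: G_def)
    show "norm (kappa * conv reg_kernel F0 t) \<le> G * (1 + t) powr (-3/2)" if t: "0 \<le> t" for t
    proof (cases "t \<le> 1")
      case True
      have "(1::real) \<le> 8 * 2 powr (-3/2)"
      proof -
        have "(2::real) powr (-3) \<le> 2 powr (-3/2)" by (intro powr_mono) auto
        moreover have "(2::real) powr (-3) = 1 / 8" by (simp add: powr_minus)
        ultimately show ?thesis by simp
      qed
      also have "(2::real) powr (-3/2) \<le> (1 + t) powr (-3/2)" using True t by (intro powr_mono2') auto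
      finally have "D * 8 * 1 \<le> D * 8 * (8 * (1 + t) powr (-3/2))" using D by (intro mult_left_mono) auto
      then show ?thesis using b1[of t] pi8 by (simp add: G_def)
    next
      case False
      have p32: "x powr (3/2) = x * sqrt x" if "0 < x" for x :: real
      proof -
        have "x powr (3/2) = x powr (1 + 1/2)" by simp
        also have "\<dots> = x * sqrt x" using that by (simp only: powr_add) (simp add: powr_half_sqrt)
        finally show ?thesis .
      qed
      have "1 / ((t/2) * sqrt (t/2)) = (t/2) powr (-3/2)"
      proof -
        have "(t/2) powr (-3/2) = inverse ((t/2) powr (3/2))" by (simp flip: powr_minus)
        also have "(t/2) powr (3/2) = (t/2) * sqrt (t/2)" by (rule p32) (use False in simp)
        finally show ?thesis by (simp only: inverse_eq_divide)
      qed
      \<comment> \<open>For t > 1 one has (1 + t)/4 <= t/2, and the exponent is negative.\<close>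
      also have "\<dots> \<le> ((1 + t) / 4) powr (-3/2)" using False by (intro powr_mono2') auto
      also have "\<dots> = (1 + t) powr (-3/2) / 4 powr (-3/2)" by (rule powr_divide)
      also have "(4::real) powr (-3/2) = 1 / 8"
      proof -
        have "(4::real) powr (-3/2) = (2 powr 2) powr (-3/2)" by simp
        also have "\<dots> = 2 powr (-3)" unfolding powr_powr by simp
        also have "\<dots> = 1 / 8" by (simp add: powr_minus)
        finally show ?thesis .
      qed
      finally have "1 / ((t/2) * sqrt (t/2)) \<le> 8 * (1 + t) powr (-3/2)" by simp
      then have "D * (8 * (1 / ((t/2) * sqrt (t/2)))) \<le> D * (8 * (8 * (1 + t) powr (-3/2)))"
        using D by (intro mult_left_mono) auto
      moreover have "norm (kappa * conv reg_kernel F0 t) \<le> D * (8 * (1 / ((t/2) * sqrt (t/2))))"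
        using mult_left_mono[OF cv(2)[of t], of "norm kappa"] False by (simp add: norm_mult D_def mult_ac)
      ultimately show ?thesis by (simp add: G_def)
    qed
  qed
  obtain A where A: "0 \<le> A" "\<And>t. 0 \<le> t \<Longrightarrow> norm (q0 t) \<le> A * (1 + t) powr (- (3/2))" using q0_decay by blast
  have "norm (q t) \<le> A * t powr (-3/2) + exp (- t)" if t: "1 \<le> t" for t
  proof -
    have "norm (q t) = norm (q0 t)" using t by (simp add: q0_def)
    also have "\<dots> \<le> A * (1 + t) powr (- (3/2))" using t by (intro A) auto
    also have "\<dots> \<le> A * t powr (-3/2)" using A t by (intro mult_left_mono) (auto intro!: powr_mono2')
    finally show ?thesis using exp_ge_zero[of "- t"] by linarith
  qed
  then have "\<forall>\<^sub>F t in at_top. norm (q t) \<le> A * t powr (-3/2) + exp (- t)"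
    unfolding eventually_at_top_linorder by blast
  \<comment> \<open>The exponential remainder is taken to be exp (- t), which corresponds to C = B =
    1.\<close>
  then show ?thesis
    by (intro exI[of _ A] exI[of _ 1] conjI exI[of _ "\<lambda>t. exp (- t)"]) (auto intro: asymp_equiv_refl)
qed

end
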